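(* For every $n\ge1$, $$\mathrm{Sdet}(G_n^{\mathbb{H}})^2\le_{\mathrm{Lt}}|\mathrm{per}_{\mathbb{H}}G_n^{\mathbb{H}}|^2.$$ Equivalently, $\Delta_n^{\mathbb{H}}\le_{\mathrm{Lt}}X_n^{\mathbb{H}}$, where $\Delta_n^{\mathbb{H}}=\mathrm{Sdet}(G_n^{\mathbb{H}})^2/n!$ and $X_n^{\mathbb{H}}=|\mathrm{per}_{\mathbb{H}}G_n^{\mathbb{H}}|^2/n!$.
   Context: $\mathbb{H}$ denotes the quaternions. $G_n^{\mathbb{H}}$ is an $n\times n$ matrix with i.i.d. standard quaternionic Gaussian entries: each entry has four independent $N(0,1/4)$ real coordinates. The row-ordered permanent is $\mathrm{per}_{\mathbb{H}}A=\sum_{\sigma\in S_n}a_{1,\sigma(1)}a_{2,\sigma(2)}\cdots a_{n,\sigma(n)}$. The Study determinant is $\mathrm{Sdet}A=\prod_{j=1}^n\sigma_j(A)$, where $\sigma_1(A),\dots,\sigma_n(A)\ge0$ are the quaternionic singular values of $A$, i.e. $A=U\,\mathrm{diag}(\sigma_1(A),\dots,\sigma_n(A))V^*$ with $U,V\in\mathbb{H}^{n\times n}$ unitary. For nonnegative random variables $U,V$, $U\le_{\mathrm{Lt}}V$ means $\mathbb{E}e^{-sU}\ge\mathbb{E}e^{-sV}$ for all $s\ge0$. *)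

theory Defs
  imports "HOL-Probability.Probability" "HOL-Combinatorics.Permutations"
    "Jordan_Normal_Form.Matrix"
begin

section \<open>The quaternions\<close>

codatatype quat = Quat (qRe: real) (qIm1: real) (qIm2: real) (qIm3: real)

lemma quat_eq_iff:
  "x = y \<longleftrightarrow> qRe x = qRe y \<and> qIm1 x = qIm1 y \<and> qIm2 x = qIm2 y \<and> qIm3 x = qIm3 y"
  by (auto intro: quat.expand)

instantiation quat :: ring_1
begin

primcorec zero_quat where
  "qRe 0 = 0" | "qIm1 0 = 0" | "qIm2 0 = 0" | "qIm3 0 = 0"

primcorec one_quat where
  "qRe 1 = 1" | "qIm1 1 = 0" | "qIm2 1 = 0" | "qIm3 1 = 0"

primcorec plus_quat where
  "qRe (x + y) = qRe x + qRe y"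
| "qIm1 (x + y) = qIm1 x + qIm1 y"
| "qIm2 (x + y) = qIm2 x + qIm2 y"
| "qIm3 (x + y) = qIm3 x + qIm3 y"

primcorec uminus_quat where
  "qRe (- x) = - qRe x"
| "qIm1 (- x) = - qIm1 x"
| "qIm2 (- x) = - qIm2 x"
| "qIm3 (- x) = - qIm3 x"

primcorec minus_quat where
  "qRe (x - y) = qRe x - qRe y"
| "qIm1 (x - y) = qIm1 x - qIm1 y"
| "qIm2 (x - y) = qIm2 x - qIm2 y"
| "qIm3 (x - y) = qIm3 x - qIm3 y"

primcorec times_quat where
  "qRe (x * y) = qRe x * qRe y - qIm1 x * qIm1 y - qIm2 x * qIm2 y - qIm3 x * qIm3 y"
| "qIm1 (x * y) = qRe x * qIm1 y + qIm1 x * qRe y + qIm2 x * qIm3 y - qIm3 x * qIm2 y"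
| "qIm2 (x * y) = qRe x * qIm2 y - qIm1 x * qIm3 y + qIm2 x * qRe y + qIm3 x * qIm1 y"
| "qIm3 (x * y) = qRe x * qIm3 y + qIm1 x * qIm2 y - qIm2 x * qIm1 y + qIm3 x * qRe y"

instance
  by standard (auto simp: quat_eq_iff algebra_simps)

end

definition qcnj :: "quat \<Rightarrow> quat" where
  "qcnj x = Quat (qRe x) (- qIm1 x) (- qIm2 x) (- qIm3 x)"

lemma qcnj_simps [simp]:
  "qRe (qcnj x) = qRe x" "qIm1 (qcnj x) = - qIm1 x"
  "qIm2 (qcnj x) = - qIm2 x" "qIm3 (qcnj x) = - qIm3 x"
  by (simp_all add: qcnj_def)

lemma qcnj_mult: "qcnj (x * y) = qcnj y * qcnj x"
  by (auto simp: quat_eq_iff algebra_simps)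

instantiation quat :: real_algebra_1
begin

primcorec scaleR_quat where
  "qRe (scaleR r x) = r * qRe x"
| "qIm1 (scaleR r x) = r * qIm1 x"
| "qIm2 (scaleR r x) = r * qIm2 x"
| "qIm3 (scaleR r x) = r * qIm3 x"

instance
  by standard (auto simp: quat_eq_iff algebra_simps)

end

instantiation quat :: real_normed_div_algebra
begin

definition norm_quat :: "quat \<Rightarrow> real" where
  "norm_quat x = sqrt ((qRe x)\<^sup>2 + (qIm1 x)\<^sup>2 + (qIm2 x)\<^sup>2 + (qIm3 x)\<^sup>2)"

definition sgn_quat :: "quat \<Rightarrow> quat" where "sgn_quat x = x /\<^sub>R norm x"

definition dist_quat :: "quat \<Rightarrow> quat \<Rightarrow> real" where "dist_quat x y = norm (x - y)"

definition uniformity_quat :: "(quat \<times> quat) filter" where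
  "uniformity_quat = (INF e\<in>{0 <..}. principal {(x, y). dist x y < e})"

definition open_quat :: "quat set \<Rightarrow> bool" where
  "open_quat S \<longleftrightarrow> (\<forall>x\<in>S. \<forall>\<^sub>F (x', y) in uniformity. x' = x \<longrightarrow> y \<in> S)"

definition inverse_quat :: "quat \<Rightarrow> quat" where
  "inverse_quat x = qcnj x /\<^sub>R (norm x)\<^sup>2"

definition divide_quat :: "quat \<Rightarrow> quat \<Rightarrow> quat" where
  "divide_quat x y = x * inverse y"

lemma norm_quat_squared:
  "(norm (x::quat))\<^sup>2 = (qRe x)\<^sup>2 + (qIm1 x)\<^sup>2 + (qIm2 x)\<^sup>2 + (qIm3 x)\<^sup>2"
  by (simp add: norm_quat_def)

lemma norm_quat_eq_0: "norm (x::quat) = 0 \<longleftrightarrow> x = 0"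
  by (auto simp: norm_quat_def quat_eq_iff add_nonneg_eq_0_iff)

lemma norm_quat_triangle: "norm (x + y :: quat) \<le> norm x + norm y"
proof -
  define a b where "a = norm ((qRe x, qIm1 x), qIm2 x, qIm3 x)"
    and "b = norm ((qRe y, qIm1 y), qIm2 y, qIm3 y)"
  have *: "norm z = norm ((qRe z, qIm1 z), qIm2 z, qIm3 z)" for z :: quat
    by (simp add: norm_quat_def norm_Pair add.assoc)
  have "norm (x + y) = norm (((qRe x, qIm1 x), qIm2 x, qIm3 x) + ((qRe y, qIm1 y), qIm2 y, qIm3 y))"
    by (simp add: *)
  also have "\<dots> \<le> a + b"
    unfolding a_def b_def by (rule norm_triangle_ineq)
  finally show ?thesis by (simp add: * a_def b_def)
qed

instance
proof
  fix x y :: quat and r s :: real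
  have sq: "(norm x)\<^sup>2 = qRe x * qRe x + qIm1 x * qIm1 x + qIm2 x * qIm2 x + qIm3 x * qIm3 x"
    unfolding norm_quat_squared by (simp add: power2_eq_square)
  show "norm x = 0 \<longleftrightarrow> x = 0" by (rule norm_quat_eq_0)
  show "norm (x + y) \<le> norm x + norm y" by (rule norm_quat_triangle)
  have "r\<^sup>2 * (a + b + c + d) = (r * qRe x)\<^sup>2 + (r * qIm1 x)\<^sup>2 + (r * qIm2 x)\<^sup>2 + (r * qIm3 x)\<^sup>2"
    if "a = (qRe x)\<^sup>2" "b = (qIm1 x)\<^sup>2" "c = (qIm2 x)\<^sup>2" "d = (qIm3 x)\<^sup>2" for a b c d
    using that by (simp add: power_mult_distrib distrib_left)
  then show "norm (r *\<^sub>R x) = \<bar>r\<bar> * norm x"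
    unfolding norm_quat_def by (simp flip: real_sqrt_mult real_sqrt_abs)
  show "norm (x * y) = norm x * norm y"
    unfolding norm_quat_def real_sqrt_mult [symmetric]
    by (simp add: power2_eq_square algebra_simps)
  show "inverse x * x = 1" "x * inverse x = 1" if "x \<noteq> 0"
  proof -
    have n0: "(norm x)\<^sup>2 \<noteq> 0" using that by (simp add: norm_quat_eq_0)
    have "qcnj x * x = (norm x)\<^sup>2 *\<^sub>R 1" "x * qcnj x = (norm x)\<^sup>2 *\<^sub>R 1"
      by (simp_all add: quat_eq_iff sq algebra_simps)
    then show "inverse x * x = 1" "x * inverse x = 1"
      using n0 by (simp_all add: inverse_quat_def)
  qed
  show "inverse (0::quat) = 0" by (simp add: inverse_quat_def quat_eq_iff)
qed (auto simp: quat_eq_iff algebra_simps sgn_quat_def dist_quat_def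
    uniformity_quat_def open_quat_def divide_quat_def)

end


section \<open>Quaternionic matrices\<close>

definition qadjoint :: "quat mat \<Rightarrow> quat mat" where
  "qadjoint A = mat (dim_col A) (dim_row A) (\<lambda>(i, j). qcnj (A $$ (j, i)))"

definition qunitary :: "nat \<Rightarrow> quat mat \<Rightarrow> bool" where
  "qunitary n U \<longleftrightarrow> U \<in> carrier_mat n n \<and> U * qadjoint U = 1\<^sub>m n \<and> qadjoint U * U = 1\<^sub>m n"

text \<open>The factors are multiplied in the order of the rows, since \<^typ>\<open>quat\<close> is not
  commutative.\<close>

definition qpermanent :: "quat mat \<Rightarrow> quat" where
  "qpermanent A = (\<Sum>p | p permutes {0..<dim_row A}.
     prod_list (map (\<lambda>i. A $$ (i, p i)) [0..<dim_row A]))"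

definition is_qsingular_values :: "quat mat \<Rightarrow> real list \<Rightarrow> bool" where
  "is_qsingular_values A s \<longleftrightarrow>
     length s = dim_row A \<and> (\<forall>x\<in>set s. 0 \<le> x) \<and>
     (\<exists>U V. qunitary (dim_row A) U \<and> qunitary (dim_row A) V \<and>
        A = U * mat_diag (dim_row A) (\<lambda>i. of_real (s ! i)) * qadjoint V)"

text \<open>For a square matrix such a list exists and is unique up to reordering, so the choice does
  not affect the product of its members.\<close>

definition qsingular_values :: "quat mat \<Rightarrow> real list" where
  "qsingular_values A = (SOME s. is_qsingular_values A s)"

definition Sdet :: "quat mat \<Rightarrow> real" where
  "Sdet A = prod_list (qsingular_values A)"


section \<open>Random matrices and the Laplace transform order\<close>

text \<open>Independent entries, each with four independent real coordinates, amount to joint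
  independence of all \<open>4 n\<^sup>2\<close> coordinates. The family of coordinates is indexed by row, column and
  coordinate projection. The second parameter of \<^const>\<open>normal_density\<close> is the standard
  deviation, so the variance is \<open>1/4\<close>.\<close>

definition quat_gaussian_matrix :: "'a measure \<Rightarrow> nat \<Rightarrow> ('a \<Rightarrow> quat mat) \<Rightarrow> bool" where
  "quat_gaussian_matrix M n G \<longleftrightarrow>
     (\<forall>\<omega>\<in>space M. G \<omega> \<in> carrier_mat n n) \<and>
     prob_space.indep_vars M (\<lambda>_. borel) (\<lambda>(i, j, c) \<omega>. c (G \<omega> $$ (i, j)))
       ({0..<n} \<times> {0..<n} \<times> {qRe, qIm1, qIm2, qIm3}) \<and>
     (\<forall>i<n. \<forall>j<n. \<forall>c\<in>{qRe, qIm1, qIm2, qIm3}.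
        distributed M lborel (\<lambda>\<omega>. c (G \<omega> $$ (i, j))) (normal_density 0 (1/2)))"

text \<open>Measurability and nonnegativity are part of the relation because it compares nonnegative
  random variables; this also keeps the Bochner integrals from being the default value \<open>0\<close> of a
  non-integrable function.\<close>

definition laplace_le :: "'a measure \<Rightarrow> ('a \<Rightarrow> real) \<Rightarrow> ('a \<Rightarrow> real) \<Rightarrow> bool" where
  "laplace_le M U V \<longleftrightarrow>
     U \<in> borel_measurable M \<and> V \<in> borel_measurable M \<and>
     (\<forall>\<omega>\<in>space M. 0 \<le> U \<omega> \<and> 0 \<le> V \<omega>) \<and>
     (\<forall>s\<ge>0. (LINT \<omega>|M. exp (- s * V \<omega>)) \<le> (LINT \<omega>|M. exp (- s * U \<omega>)))"

end

theory Submission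
  imports Defs "Jordan_Normal_Form.Determinant"
begin

text \<open>Both Laplace transforms are compared with one function, \<open>Sdet2_laplace n\<close>, built by adding one
Gaussian row at a time: a Gaussian vector \<open>x\<close> of length \<open>m + 1\<close> multiplies the argument \<open>s\<close> by
\<open>|x|\<^sup>2\<close> and the order drops from \<open>m + 1\<close> to \<open>m\<close>. In other words, it is the Laplace transform of a
product of independent squared norms of quaternionic Gaussian vectors of lengths \<open>1, \<dots>, n\<close>.

For the squared Study determinant this is exact (\<open>Sdet2_laplace_eq\<close>). Fix the last row \<open>x\<close>. Unitary
column operations move it to \<open>(0, \<dots>, 0, |x|)\<close>, and they change neither the Study determinant nor the law
of the other rows; so \<open>Sdet\<^sup>2\<close> becomes \<open>|x|\<^sup>2\<close> times the \<open>Sdet\<^sup>2\<close> of a Gaussian matrix of order \<open>m\<close>.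
That \<open>Sdet\<^sup>2\<close> behaves like a determinant is seen on the real representation, after the existence of the
quaternionic singular value decomposition has been proved.

For the permanent it is an upper bound (\<open>row_per_laplace_le\<close>): among all last rows \<open>x\<close> of given norm, the
Laplace transform of \<open>|per|\<^sup>2\<close> at a fixed \<open>s \<ge> 0\<close> is largest when \<open>x\<close> has a single nonzero entry, and then
the permanent is \<open>|x|\<close> times, up to a unit, a permanent of order \<open>m\<close>. Two nonzero entries can be merged as
follows (\<open>last_row_per_laplace_interpolation\<close>). Write
\<open>exp (- s |per|\<^sup>2)\<close> as the mean of \<open>exp (\<i> \<langle>w, per\<rangle>)\<close> over a Gaussian quaternion \<open>w\<close>. As a function of the
two columns \<open>u\<close>, \<open>v\<close> concerned, and with everything else fixed, the exponent is \<open>B u v + k u + l v\<close>, where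
the bilinear form \<open>B\<close> is symmetric because the permanent does not change when columns are exchanged, and where
the linear form \<open>l\<close> comes with one of the two entries of \<open>x\<close> and \<open>k\<close> with the other. For independent Gaussian
columns \<open>u\<close>, \<open>v\<close> the mean of \<open>exp (\<i> (B u v + k u + l v))\<close> is a nonnegative number if \<open>k\<close> or \<open>l\<close> is zero;
and if \<open>k\<close> and \<open>l\<close> are multiplied by \<open>\<surd>(1 - t)\<close> and \<open>\<surd>t\<close>, its modulus is the weighted geometric mean, with
weights \<open>1 - t\<close> and \<open>t\<close>, of its values for \<open>(k, 0)\<close> and \<open>(0, l)\<close>. The inequality between
weighted arithmetic and geometric means then bounds it by a convex combination of the means for two rows in which
one of the two entries has been absorbed into the other (\<open>\<Phi>_interpolation\<close>).

About the Gaussian law of a column, that argument uses only that the joint law of two independent copies is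
invariant under rotations mixing the copies, a property that passes to products and linear images
(\<open>rot_inv_pair\<close>, \<open>rot_inv_PiM\<close>, \<open>rot_inv_distr\<close>). About the row-ordered permanent it uses only that it is
real-linear in each column and symmetric under exchange of columns, both of which hold over the quaternions.\<close>


section \<open>Rotation-invariant distributions\<close>

lemma distr_shear_fst:
  "distr (lborel \<Otimes>\<^sub>M lborel) (lborel \<Otimes>\<^sub>M lborel) (\<lambda>(x, y). (x + t * y, y))
     = (lborel \<Otimes>\<^sub>M lborel :: (real \<times> real) measure)" (is "?D = ?L")
proof (rule measure_eqI)
  fix X assume "X \<in> sets ?D"
  then have X [measurable]: "X \<in> sets ?L" by simp
  have "emeasure ?D X = (\<integral>\<^sup>+z. indicator X z \<partial>?D)" using X by simp
  also have "\<dots> = (\<integral>\<^sup>+z. indicator X (fst z + t * snd z, snd z) \<partial>?L)"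
    by (subst nn_integral_distr) (auto simp: case_prod_beta)
  also have "\<dots> = (\<integral>\<^sup>+y. \<integral>\<^sup>+x. indicator X (x + t * y, y) \<partial>lborel \<partial>lborel)"
    by (subst lborel_pair.nn_integral_snd [symmetric]) auto
  also have "\<dots> = (\<integral>\<^sup>+y. \<integral>\<^sup>+x. indicator X (x, y) \<partial>lborel \<partial>lborel)"
  proof (rule nn_integral_cong)
    fix y :: real
    have "(\<integral>\<^sup>+x. indicator X (x, y) \<partial>lborel) = (\<integral>\<^sup>+x. indicator X (t * y + 1 * x, y) \<partial>lborel)"
      by (subst nn_integral_real_affine [where c = 1 and t = "t * y"]) auto
    then show "(\<integral>\<^sup>+x. indicator X (x + t * y, y) \<partial>lborel) = (\<integral>\<^sup>+x. indicator X (x, y) \<partial>lborel)"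
      by (simp add: add.commute)
  qed
  also have "\<dots> = emeasure ?L X"
    using X by (subst lborel_pair.nn_integral_snd) auto
  finally show "emeasure ?D X = emeasure ?L X" .
qed simp

lemma distr_shear_snd:
  "distr (lborel \<Otimes>\<^sub>M lborel) (lborel \<Otimes>\<^sub>M lborel) (\<lambda>(x, y). (x, y + t * x))
     = (lborel \<Otimes>\<^sub>M lborel :: (real \<times> real) measure)" (is "distr ?L ?L ?T = ?L")
proof -
  let ?swap = "\<lambda>(x, y). (y, x)" and ?S = "\<lambda>(x, y). (x + t * y, y)"
  have swap: "distr ?L ?L ?swap = ?L" by (rule lborel_pair.distr_pair_swap [symmetric])
  have "?T = ?swap \<circ> (?S \<circ> ?swap)" by auto
  then have "distr ?L ?L ?T = distr (distr (distr ?L ?L ?swap) ?L ?S) ?L ?swap"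
    by (simp add: distr_distr comp_assoc)
  then show ?thesis by (simp add: swap distr_shear_fst)
qed

text \<open>A plane rotation with \<open>s \<noteq> 0\<close> is a product of three shears, and shears preserve Lebesgue measure by
translation invariance on lines. If \<open>s = 0\<close>, it is the identity or the square of a quarter turn.\<close>

lemma distr_rotation_lborel:
  fixes c s :: real
  assumes "c\<^sup>2 + s\<^sup>2 = 1"
  shows "distr (lborel \<Otimes>\<^sub>M lborel) (lborel \<Otimes>\<^sub>M lborel) (\<lambda>(x, y). (c * x + - s * y, s * x + c * y))
    = lborel \<Otimes>\<^sub>M lborel" (is "distr ?L ?L ?R = ?L")
proof -
  have main: "distr ?L ?L (\<lambda>(x, y). (c * x + - s * y, s * x + c * y)) = ?L"
    if cs: "c\<^sup>2 + s\<^sup>2 = 1" and s: "s \<noteq> 0" for c s :: real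
  proof -
    \<comment> \<open>the negative of the tangent of half the rotation angle\<close>
    define t where "t = (c - 1) / s"
    have 1: "t * s = c - 1" using s by (simp add: t_def)
    have "t + c * t = (c\<^sup>2 - 1) / s" using s by (simp add: t_def power2_eq_square divide_simps) (simp add: algebra_simps)
    also have "c\<^sup>2 - 1 = - s * s" using cs by (simp add: power2_eq_square)
    finally have 2: "t + c * t = - s" using s by simp
    let ?S = "\<lambda>(x, y). (x + t * y, y)" and ?T = "\<lambda>(x, y). (x, y + s * x)"
    have "?S (?T (?S (x, y))) = (c * x + - s * y, s * x + c * y)" for x y
    proof -
      have c: "c = 1 + t * s" using 1 by simp
      have "- s = 2 * t + t * t * s" using 2 c by (simp add: algebra_simps)
      then show ?thesis using c by (simp add: algebra_simps)
    qed
    then have "(\<lambda>(x, y). (c * x + - s * y, s * x + c * y)) = ?S \<circ> (?T \<circ> ?S)"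
      by (intro ext) (simp only: comp_apply split_paired_all prod.case)
    then have "distr ?L ?L (\<lambda>(x, y). (c * x + - s * y, s * x + c * y))
      = distr (distr (distr ?L ?L ?S) ?L ?T) ?L ?S"
      by (simp add: distr_distr comp_assoc)
    then show ?thesis
      by (simp add: distr_shear_fst distr_shear_snd)
  qed
  show ?thesis
  proof (cases "s = 0")
    case False
    then show ?thesis using main assms by blast
  next
    case True
    then have "c = 1 \<or> c = -1" using assms by (simp add: power2_eq_1_iff)
    then show ?thesis
    proof
      assume "c = 1"
      then have "?R = (\<lambda>z. z)" using True by auto
      then show ?thesis by (simp only: distr_id)
    next
      assume c: "c = -1"
      let ?Q = "\<lambda>(x, y). (0 * x + - 1 * y, 1 * x + 0 * y)"
      have "?R = ?Q \<circ> ?Q" using c True by (auto simp: fun_eq_iff)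
      then have "distr ?L ?L ?R = distr (distr ?L ?L ?Q) ?L ?Q"
        by (subst distr_distr) auto
      then show ?thesis using main [of 0 1] by simp
    qed
  qed
qed

text \<open>\<open>comb a u b v\<close> plays the role of the linear combination \<open>a u + b v\<close>. It is a parameter because the
measures in question live on spaces such as \<open>PiM\<close>, and the extensional functions that are their points are not
closed under pointwise addition.\<close>

definition rot_inv :: "'v measure \<Rightarrow> (real \<Rightarrow> 'v \<Rightarrow> real \<Rightarrow> 'v \<Rightarrow> 'v) \<Rightarrow> bool" where
  "rot_inv \<nu> comb \<longleftrightarrow> prob_space \<nu> \<and>
     (\<forall>a b. (\<lambda>(u, v). comb a u b v) \<in> measurable (\<nu> \<Otimes>\<^sub>M \<nu>) \<nu>) \<and>
     (\<forall>c s. c\<^sup>2 + s\<^sup>2 = 1 \<longrightarrow>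
        distr (\<nu> \<Otimes>\<^sub>M \<nu>) (\<nu> \<Otimes>\<^sub>M \<nu>) (\<lambda>(u, v). (comb c u (- s) v, comb s u c v)) = \<nu> \<Otimes>\<^sub>M \<nu>)"

lemma rot_invD:
  "rot_inv \<nu> comb \<Longrightarrow> c\<^sup>2 + s\<^sup>2 = 1 \<Longrightarrow>
     distr (\<nu> \<Otimes>\<^sub>M \<nu>) (\<nu> \<Otimes>\<^sub>M \<nu>) (\<lambda>(u, v). (comb c u (- s) v, comb s u c v)) = \<nu> \<Otimes>\<^sub>M \<nu>"
  by (simp add: rot_inv_def)

abbreviation gauss :: "real measure" where
  "gauss \<equiv> density lborel (normal_density 0 (1/2))"

lemma prob_space_gauss: "prob_space gauss"
  by (rule prob_space_normal_density) simp

lemma rot_inv_gauss: "rot_inv gauss (\<lambda>a u b v. a * u + b * v)"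
  unfolding rot_inv_def
proof (intro conjI allI impI)
  show "prob_space gauss" by (rule prob_space_gauss)
  fix c s :: real assume cs: "c\<^sup>2 + s\<^sup>2 = 1"
  let ?R = "\<lambda>(u, v). (c * u + - s * v, s * u + c * v)"
  let ?L = "lborel \<Otimes>\<^sub>M lborel :: (real \<times> real) measure"
  define g where "g = (\<lambda>(x, y). ennreal (normal_density 0 (1/2) x) * ennreal (normal_density 0 (1/2) y))"
  have [measurable]: "g \<in> borel_measurable ?L" unfolding g_def by measurable
  interpret gs: prob_space gauss by (rule prob_space_gauss)
  have eq: "gauss \<Otimes>\<^sub>M gauss = density ?L g"
    unfolding g_def
    by (rule pair_measure_density) (auto intro: gs.sigma_finite_measure lborel.sigma_finite_measure_axioms)
  have gR: "g (?R z) = g z" for z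
  proof -
    obtain x y where z: "z = (x, y)" by (cases z)
    have "(c * x + - s * y)\<^sup>2 + (s * x + c * y)\<^sup>2 = (c\<^sup>2 + s\<^sup>2) * (x\<^sup>2 + y\<^sup>2)"
      by (simp add: power2_eq_square algebra_simps)
    then have e: "(c * x + - s * y)\<^sup>2 + (s * x + c * y)\<^sup>2 = x\<^sup>2 + y\<^sup>2" using cs by simp
    have "normal_density 0 (1/2) a * normal_density 0 (1/2) b = 2 / pi * exp (- 2 * (a\<^sup>2 + b\<^sup>2))" for a b :: real
      by (simp add: normal_density_def exp_add [symmetric] power2_eq_square real_sqrt_mult field_simps
          flip: real_sqrt_mult)
    then show ?thesis
      using e by (simp add: z g_def flip: ennreal_mult)
  qed
  have "distr (density ?L g) ?L ?R = distr (density ?L (\<lambda>z. g (?R z))) ?L ?R"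
    by (simp only: gR)
  also have "\<dots> = density (distr ?L ?L ?R) g"
    by (rule density_distr [symmetric]) auto
  also have "\<dots> = density ?L g"
    using distr_rotation_lborel [OF cs] by simp
  finally show "distr (gauss \<Otimes>\<^sub>M gauss) (gauss \<Otimes>\<^sub>M gauss) ?R = gauss \<Otimes>\<^sub>M gauss"
    unfolding eq by (simp cong: distr_cong)
qed measurable

lemma rot_inv_distr:
  assumes inv: "rot_inv \<nu> comb" and \<phi> [measurable]: "\<phi> \<in> measurable \<nu> \<nu>'"
    and comb': "\<And>a b. (\<lambda>(u, v). comb' a u b v) \<in> measurable (\<nu>' \<Otimes>\<^sub>M \<nu>') \<nu>'"
    and hom: "\<And>a u b v. u \<in> space \<nu> \<Longrightarrow> v \<in> space \<nu> \<Longrightarrow> \<phi> (comb a u b v) = comb' a (\<phi> u) b (\<phi> v)"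
  shows "rot_inv (distr \<nu> \<nu>' \<phi>) comb'"
  unfolding rot_inv_def
proof (intro conjI allI impI)
  interpret prob_space \<nu> using inv by (simp add: rot_inv_def)
  show "prob_space (distr \<nu> \<nu>' \<phi>)" by (rule prob_space_distr) simp
  then interpret d: prob_space "distr \<nu> \<nu>' \<phi>" .
  show "(\<lambda>(u, v). comb' a u b v) \<in> measurable (distr \<nu> \<nu>' \<phi> \<Otimes>\<^sub>M distr \<nu> \<nu>' \<phi>) (distr \<nu> \<nu>' \<phi>)" for a b
    using comb' by simp
  fix c s :: real assume cs: "c\<^sup>2 + s\<^sup>2 = 1"
  have m [measurable]: "(\<lambda>z. comb a (fst z) b (snd z)) \<in> measurable (\<nu> \<Otimes>\<^sub>M \<nu>) \<nu>" for a b
    using inv by (simp add: rot_inv_def case_prod_beta')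
  have m' [measurable]: "(\<lambda>z. comb' a (fst z) b (snd z)) \<in> measurable (\<nu>' \<Otimes>\<^sub>M \<nu>') \<nu>'" for a b
    using comb' by (simp add: case_prod_beta')
  let ?R = "\<lambda>(u, v). (comb c u (- s) v, comb s u c v)"
  let ?R' = "\<lambda>(u, v). (comb' c u (- s) v, comb' s u c v)"
  let ?F = "\<lambda>(u, v). (\<phi> u, \<phi> v)"
  have D: "distr \<nu> \<nu>' \<phi> \<Otimes>\<^sub>M distr \<nu> \<nu>' \<phi> = distr (\<nu> \<Otimes>\<^sub>M \<nu>) (\<nu>' \<Otimes>\<^sub>M \<nu>') ?F"
    by (rule pair_measure_distr) (auto intro: d.sigma_finite_measure)
  have "distr (distr (\<nu> \<Otimes>\<^sub>M \<nu>) (\<nu>' \<Otimes>\<^sub>M \<nu>') ?F) (\<nu>' \<Otimes>\<^sub>M \<nu>') ?R' = distr (\<nu> \<Otimes>\<^sub>M \<nu>) (\<nu>' \<Otimes>\<^sub>M \<nu>') (?R' \<circ> ?F)"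
    by (rule distr_distr) (auto simp: case_prod_beta')
  also have "\<dots> = distr (\<nu> \<Otimes>\<^sub>M \<nu>) (\<nu>' \<Otimes>\<^sub>M \<nu>') (?F \<circ> ?R)"
    by (rule distr_cong) (auto simp: hom space_pair_measure)
  also have "\<dots> = distr (distr (\<nu> \<Otimes>\<^sub>M \<nu>) (\<nu> \<Otimes>\<^sub>M \<nu>) ?R) (\<nu>' \<Otimes>\<^sub>M \<nu>') ?F"
    by (rule distr_distr [symmetric]) (auto simp: case_prod_beta')
  also have "distr (\<nu> \<Otimes>\<^sub>M \<nu>) (\<nu> \<Otimes>\<^sub>M \<nu>) ?R = \<nu> \<Otimes>\<^sub>M \<nu>"
    using inv cs by (simp add: rot_inv_def)
  finally show "distr (distr \<nu> \<nu>' \<phi> \<Otimes>\<^sub>M distr \<nu> \<nu>' \<phi>) (distr \<nu> \<nu>' \<phi> \<Otimes>\<^sub>M distr \<nu> \<nu>' \<phi>) ?R'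
     = distr \<nu> \<nu>' \<phi> \<Otimes>\<^sub>M distr \<nu> \<nu>' \<phi>"
    unfolding D by (simp cong: distr_cong)
qed

text \<open>Rotating two copies of a pair acts on the two components separately once the four factors have been regrouped;
this lemma does the regrouping for \<open>rot_inv_pair\<close>.\<close>

lemma distr_pair_interchange:
  assumes "sigma_finite_measure A" "sigma_finite_measure B" "sigma_finite_measure C" "sigma_finite_measure D"
  shows "distr ((A \<Otimes>\<^sub>M C) \<Otimes>\<^sub>M (B \<Otimes>\<^sub>M D)) ((A \<Otimes>\<^sub>M B) \<Otimes>\<^sub>M (C \<Otimes>\<^sub>M D))
     (\<lambda>p. ((fst (fst p), fst (snd p)), (snd (fst p), snd (snd p)))) = (A \<Otimes>\<^sub>M B) \<Otimes>\<^sub>M (C \<Otimes>\<^sub>M D)" (is "distr ?P ?Q ?f = ?Q")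
proof (rule measure_eqI)
  interpret A: sigma_finite_measure A by fact
  interpret B: sigma_finite_measure B by fact
  interpret C: sigma_finite_measure C by fact
  interpret D: sigma_finite_measure D by fact
  interpret AC: pair_sigma_finite A C ..
  interpret BD: pair_sigma_finite B D ..
  interpret AB: pair_sigma_finite A B ..
  interpret CD: pair_sigma_finite C D ..
  interpret CB: pair_sigma_finite C B ..
  have [measurable]: "?f \<in> measurable ?P ?Q" by measurable
  fix X assume "X \<in> sets (distr ?P ?Q ?f)"
  then have X [measurable]: "X \<in> sets ?Q" by simp
  have "emeasure (distr ?P ?Q ?f) X = (\<integral>\<^sup>+z. indicator X z \<partial>distr ?P ?Q ?f)" using X by simp
  also have "\<dots> = (\<integral>\<^sup>+z. indicator X (?f z) \<partial>?P)"
    by (subst nn_integral_distr) auto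
  also have "\<dots> = (\<integral>\<^sup>+p. \<integral>\<^sup>+q. indicator X (?f (p, q)) \<partial>(B \<Otimes>\<^sub>M D) \<partial>(A \<Otimes>\<^sub>M C))"
    by (subst sigma_finite_measure.nn_integral_fst [OF BD.sigma_finite_measure_axioms, symmetric]) auto
  also have "\<dots> = (\<integral>\<^sup>+p. \<integral>\<^sup>+b. \<integral>\<^sup>+d. indicator X (?f (p, b, d)) \<partial>D \<partial>B \<partial>(A \<Otimes>\<^sub>M C))"
    by (intro nn_integral_cong, subst D.nn_integral_fst [symmetric]) (auto simp: space_pair_measure)
  also have "\<dots> = (\<integral>\<^sup>+a. \<integral>\<^sup>+c. \<integral>\<^sup>+b. \<integral>\<^sup>+d. indicator X ((a, b), (c, d)) \<partial>D \<partial>B \<partial>C \<partial>A)"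
    by (subst C.nn_integral_fst [symmetric]) auto
  also have "\<dots> = (\<integral>\<^sup>+a. \<integral>\<^sup>+b. \<integral>\<^sup>+c. \<integral>\<^sup>+d. indicator X ((a, b), (c, d)) \<partial>D \<partial>C \<partial>B \<partial>A)"
    by (intro nn_integral_cong CB.Fubini' [symmetric]) auto
  also have "\<dots> = (\<integral>\<^sup>+a. \<integral>\<^sup>+b. \<integral>\<^sup>+q. indicator X ((a, b), q) \<partial>(C \<Otimes>\<^sub>M D) \<partial>B \<partial>A)"
    by (intro nn_integral_cong) (subst D.nn_integral_fst [symmetric], auto)
  also have "\<dots> = (\<integral>\<^sup>+p. \<integral>\<^sup>+q. indicator X (p, q) \<partial>(C \<Otimes>\<^sub>M D) \<partial>(A \<Otimes>\<^sub>M B))"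
    by (subst B.nn_integral_fst [symmetric]) auto
  also have "\<dots> = emeasure ?Q X"
    using X by (subst sigma_finite_measure.nn_integral_fst [OF CD.sigma_finite_measure_axioms]) auto
  finally show "emeasure (distr ?P ?Q ?f) X = emeasure ?Q X" .
qed simp

lemma rot_inv_pair:
  assumes A: "rot_inv A ca" and B: "rot_inv B cb"
  shows "rot_inv (A \<Otimes>\<^sub>M B) (\<lambda>a u b v. (ca a (fst u) b (fst v), cb a (snd u) b (snd v)))"
  unfolding rot_inv_def
proof (intro conjI allI impI)
  interpret a: prob_space A using A by (simp add: rot_inv_def)
  interpret b: prob_space B using B by (simp add: rot_inv_def)
  interpret aa: pair_prob_space A A ..
  interpret bb: pair_prob_space B B ..
  interpret ab: pair_prob_space A B ..
  show "prob_space (A \<Otimes>\<^sub>M B)" by (rule ab.prob_space_axioms)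
  have mA: "(\<lambda>z. ca a (fst z) b (snd z)) \<in> measurable (A \<Otimes>\<^sub>M A) A" for a b
    using A by (simp add: rot_inv_def case_prod_beta')
  have mB: "(\<lambda>z. cb a (fst z) b (snd z)) \<in> measurable (B \<Otimes>\<^sub>M B) B" for a b
    using B by (simp add: rot_inv_def case_prod_beta')
  note [measurable] = mA mB measurable_compose [OF _ mA, of "\<lambda>z. (f z, g z)" for f g, simplified]
     measurable_compose [OF _ mB, of "\<lambda>z. (f z, g z)" for f g, simplified]
  show "(\<lambda>(u, v). (ca a (fst u) b (fst v), cb a (snd u) b (snd v))) \<in> measurable ((A \<Otimes>\<^sub>M B) \<Otimes>\<^sub>M (A \<Otimes>\<^sub>M B)) (A \<Otimes>\<^sub>M B)" for a b
    by (auto simp: case_prod_beta')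
  fix c s :: real assume cs: "c\<^sup>2 + s\<^sup>2 = 1"
  let ?P = "(A \<Otimes>\<^sub>M A) \<Otimes>\<^sub>M (B \<Otimes>\<^sub>M B)" and ?Q = "(A \<Otimes>\<^sub>M B) \<Otimes>\<^sub>M (A \<Otimes>\<^sub>M B)"
  let ?f = "\<lambda>p. ((fst (fst p), fst (snd p)), (snd (fst p), snd (snd p)))"
  let ?RA = "\<lambda>(u, v). (ca c u (- s) v, ca s u c v)"
  let ?RB = "\<lambda>(u, v). (cb c u (- s) v, cb s u c v)"
  let ?R = "\<lambda>(u, v). ((ca c (fst u) (- s) (fst v), cb c (snd u) (- s) (snd v)),
      (ca s (fst u) c (fst v), cb s (snd u) c (snd v)))"
  have f [measurable]: "?f \<in> measurable ?P ?Q" by measurable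
  have R [measurable]: "?R \<in> measurable ?Q ?Q" by (auto simp: case_prod_beta')
  have RA [measurable]: "?RA \<in> measurable (A \<Otimes>\<^sub>M A) (A \<Otimes>\<^sub>M A)" by (auto simp: case_prod_beta')
  have RB [measurable]: "?RB \<in> measurable (B \<Otimes>\<^sub>M B) (B \<Otimes>\<^sub>M B)" by (auto simp: case_prod_beta')
  have RAB: "(\<lambda>(x, y). (?RA x, ?RB y)) \<in> measurable ?P ?P" by measurable
  have eq: "distr ?P ?Q ?f = ?Q"
    by (rule distr_pair_interchange) (rule a.sigma_finite_measure_axioms b.sigma_finite_measure_axioms)+
  have dA: "distr (A \<Otimes>\<^sub>M A) (A \<Otimes>\<^sub>M A) ?RA = A \<Otimes>\<^sub>M A" using A cs by (simp add: rot_inv_def)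
  have dB: "distr (B \<Otimes>\<^sub>M B) (B \<Otimes>\<^sub>M B) ?RB = B \<Otimes>\<^sub>M B" using B cs by (simp add: rot_inv_def)
  have dAB: "distr ?P ?P (\<lambda>(x, y). (?RA x, ?RB y)) = ?P"
    using pair_measure_distr [OF RA RB] dA dB bb.sigma_finite_measure_axioms by simp
  have "distr ?Q ?Q ?R = distr (distr ?P ?Q ?f) ?Q ?R" by (simp add: eq)
  also have "\<dots> = distr ?P ?Q (?R \<circ> ?f)"
    by (rule distr_distr) (fact R f)+
  also have "?R \<circ> ?f = ?f \<circ> (\<lambda>(x, y). (?RA x, ?RB y))"
    by (auto simp: fun_eq_iff)
  also have "distr ?P ?Q \<dots> = distr (distr ?P ?P (\<lambda>(x, y). (?RA x, ?RB y))) ?Q ?f"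
    by (rule distr_distr [symmetric]) (fact RAB f)+
  also have "\<dots> = ?Q" by (simp add: dAB eq)
  finally show "distr ?Q ?Q ?R = ?Q" .
qed

lemma rot_inv_PiM:
  fixes I :: "'i set"
  assumes "finite I" and \<gamma>: "rot_inv \<gamma> comb"
  shows "rot_inv (PiM I (\<lambda>_. \<gamma>)) (\<lambda>a u b v. \<lambda>i\<in>I. comb a (u i) b (v i))"
  using \<open>finite I\<close>
proof (induction I rule: finite_induct)
  case empty
  let ?P = "PiM ({} :: 'i set) (\<lambda>_. \<gamma>)"
  interpret P: prob_space ?P by (rule prob_space_PiM) (use \<gamma> in \<open>auto simp: rot_inv_def\<close>)
  have "distr (?P \<Otimes>\<^sub>M ?P) (?P \<Otimes>\<^sub>M ?P) f = ?P \<Otimes>\<^sub>M ?P"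
    if "f = (\<lambda>z. (\<lambda>_. undefined, \<lambda>_. undefined))" for f
  proof -
    have "distr (?P \<Otimes>\<^sub>M ?P) (?P \<Otimes>\<^sub>M ?P) f = distr (?P \<Otimes>\<^sub>M ?P) (?P \<Otimes>\<^sub>M ?P) (\<lambda>z. z)"
      by (rule distr_cong) (auto simp: that space_pair_measure space_PiM)
    then show ?thesis by simp
  qed
  then show ?case
    unfolding rot_inv_def by (auto simp: restrict_def case_prod_beta' P.prob_space_axioms)
next
  case (insert i I)
  have p: "prob_space \<gamma>" using \<gamma> by (simp add: rot_inv_def)
  let ?Q = "PiM (insert i I) (\<lambda>_. \<gamma>)"
  let ?\<phi> = "\<lambda>(x, X). X(i := x)"
  have comb: "(\<lambda>z. comb a (fst z) b (snd z)) \<in> measurable (\<gamma> \<Otimes>\<^sub>M \<gamma>) \<gamma>" for a b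
    using \<gamma> by (simp add: rot_inv_def case_prod_beta')
  have "rot_inv (distr (\<gamma> \<Otimes>\<^sub>M PiM I (\<lambda>_. \<gamma>)) ?Q ?\<phi>)
      (\<lambda>a u b v. \<lambda>j\<in>insert i I. comb a (u j) b (v j))"
  proof (rule rot_inv_distr [OF rot_inv_pair [OF \<gamma> insert.IH]])
    show "?\<phi> \<in> measurable (\<gamma> \<Otimes>\<^sub>M PiM I (\<lambda>_. \<gamma>)) ?Q"
      by measurable
    show "(\<lambda>(u, v). \<lambda>j\<in>insert i I. comb a (u j) b (v j)) \<in> measurable (?Q \<Otimes>\<^sub>M ?Q) ?Q" for a b
      unfolding case_prod_beta'
    proof (rule measurable_restrict)
      fix j assume j: "j \<in> insert i I"
      then have "(\<lambda>x. (fst x j, snd x j)) \<in> measurable (?Q \<Otimes>\<^sub>M ?Q) (\<gamma> \<Otimes>\<^sub>M \<gamma>)"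
        by measurable
      from measurable_compose [OF this comb]
      show "(\<lambda>x. comb a (fst x j) b (snd x j)) \<in> measurable (?Q \<Otimes>\<^sub>M ?Q) \<gamma>" by simp
    qed
  qed (use insert.hyps in \<open>auto simp: fun_eq_iff\<close>)
  also have "distr (\<gamma> \<Otimes>\<^sub>M PiM I (\<lambda>_. \<gamma>)) ?Q ?\<phi> = ?Q"
    by (rule distr_pair_PiM_eq_PiM) (rule p)+
  finally show ?case .
qed


section \<open>The quaternions as a Euclidean space\<close>

instantiation quat :: real_inner
begin

definition inner_quat :: "quat \<Rightarrow> quat \<Rightarrow> real" where
  "inner_quat x y = qRe x * qRe y + qIm1 x * qIm1 y + qIm2 x * qIm2 y + qIm3 x * qIm3 y"

instance
proof
  fix x y z :: quat and r :: real
  show "inner x x = 0 \<longleftrightarrow> x = 0"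
    by (auto simp: inner_quat_def quat_eq_iff add_nonneg_eq_0_iff)
qed (auto simp: inner_quat_def algebra_simps norm_quat_def power2_eq_square)

end

instantiation quat :: euclidean_space
begin

definition Basis_quat :: "quat set" where
  "Basis_quat = {Quat 1 0 0 0, Quat 0 1 0 0, Quat 0 0 1 0, Quat 0 0 0 1}"

instance
proof
  show "(Basis :: quat set) \<noteq> {}"
    unfolding Basis_quat_def by (rule insert_not_empty)
  show "finite (Basis :: quat set)"
    unfolding Basis_quat_def by (rule finite.insertI finite.emptyI)+
  show "inner u v = (if u = v then 1 else 0)" if "u \<in> Basis" "v \<in> Basis" for u v :: quat
    using that unfolding Basis_quat_def by (elim insertE emptyE) (simp_all add: inner_quat_def)
  show "(\<forall>u\<in>Basis. inner x u = 0) \<longleftrightarrow> x = 0" for x :: quat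
    unfolding Basis_quat_def by (simp add: inner_quat_def quat_eq_iff [of x])
qed

end

lemma bounded_linear_quat_coordinates:
  "bounded_linear qRe" "bounded_linear qIm1" "bounded_linear qIm2" "bounded_linear qIm3"
proof -
  have "qRe = (\<lambda>x. inner x (Quat 1 0 0 0))" "qIm1 = (\<lambda>x. inner x (Quat 0 1 0 0))"
    "qIm2 = (\<lambda>x. inner x (Quat 0 0 1 0))" "qIm3 = (\<lambda>x. inner x (Quat 0 0 0 1))"
    by (auto simp: inner_quat_def)
  then show "bounded_linear qRe" "bounded_linear qIm1" "bounded_linear qIm2" "bounded_linear qIm3"
    by (metis bounded_linear_inner_left)+
qed

lemma borel_measurable_quat_coordinates [measurable]:
  "qRe \<in> borel_measurable borel" "qIm1 \<in> borel_measurable borel"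
  "qIm2 \<in> borel_measurable borel" "qIm3 \<in> borel_measurable borel"
  using bounded_linear_quat_coordinates by (auto intro: borel_measurable_continuous_onI linear_continuous_on)

lemma borel_measurable_Quat [measurable (raw)]:
  assumes [measurable]: "a \<in> borel_measurable M" "b \<in> borel_measurable M" "c \<in> borel_measurable M" "d \<in> borel_measurable M"
  shows "(\<lambda>x. Quat (a x) (b x) (c x) (d x)) \<in> borel_measurable M"
proof -
  have "(\<lambda>x. Quat (a x) (b x) (c x) (d x)) =
      (\<lambda>x. a x *\<^sub>R Quat 1 0 0 0 + b x *\<^sub>R Quat 0 1 0 0 + c x *\<^sub>R Quat 0 0 1 0 + d x *\<^sub>R Quat 0 0 0 1)"
    by (simp add: quat_eq_iff fun_eq_iff)
  then show ?thesis by simp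
qed

lemma quat_of_real: "of_real r = Quat r 0 0 0"
  unfolding of_real_def by (simp add: quat_eq_iff)

lemma qcnj_mult_self: "qcnj x * x = of_real ((norm x)\<^sup>2)" "x * qcnj x = of_real ((norm x)\<^sup>2)"
  unfolding quat_of_real norm_quat_squared by (simp_all add: quat_eq_iff power2_eq_square)

lemma qcnj_add [simp]: "qcnj (x + y) = qcnj x + qcnj y" by (simp add: quat_eq_iff)
lemma qcnj_0 [simp]: "qcnj 0 = 0" by (simp add: quat_eq_iff)
lemma qcnj_1 [simp]: "qcnj 1 = 1" by (simp add: quat_eq_iff)
lemma qcnj_minus [simp]: "qcnj (- x) = - qcnj x" by (simp add: quat_eq_iff)
lemma qcnj_of_real [simp]: "qcnj (of_real r) = of_real r" by (simp add: quat_eq_iff quat_of_real)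
lemma qcnj_qcnj [simp]: "qcnj (qcnj x) = x" by (simp add: quat_eq_iff)
lemma norm_qcnj [simp]: "norm (qcnj x) = norm x" by (simp add: norm_quat_def)
lemma qcnj_sum: "qcnj (sum f A) = (\<Sum>i\<in>A. qcnj (f i))"
  by (induction A rule: infinite_finite_induct) auto

lemma inner_quat_mult_left: "inner (x * y) z = inner y (qcnj x * (z :: quat))"
  by (simp add: inner_quat_def algebra_simps)


section \<open>The quaternionic Gaussian distribution\<close>

text \<open>Grouping the first two and the last two coordinates corresponds to writing a quaternion as
\<open>z\<^sub>1 + z\<^sub>2 j\<close> with complex \<open>z\<^sub>1\<close>, \<open>z\<^sub>2\<close>, which is the form in which right multiplication by
a unit is analysed below.\<close>

definition qgauss :: "quat measure" where
  "qgauss = distr ((gauss \<Otimes>\<^sub>M gauss) \<Otimes>\<^sub>M (gauss \<Otimes>\<^sub>M gauss)) borel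
     (\<lambda>p. Quat (fst (fst p)) (snd (fst p)) (fst (snd p)) (snd (snd p)))"

lemma sets_qgauss [simp, measurable_cong]: "sets qgauss = sets borel"
  and space_qgauss [simp]: "space qgauss = UNIV"
  by (simp_all add: qgauss_def)

lemma rot_inv_qgauss: "rot_inv qgauss (\<lambda>a u b v. a *\<^sub>R u + b *\<^sub>R v)"
  unfolding qgauss_def
  by (rule rot_inv_distr [OF rot_inv_pair [OF rot_inv_pair [OF rot_inv_gauss rot_inv_gauss]
        rot_inv_pair [OF rot_inv_gauss rot_inv_gauss]]])
    (auto simp: quat_eq_iff case_prod_beta')

lemma prob_space_qgauss: "prob_space qgauss"
  using rot_inv_qgauss by (simp add: rot_inv_def)

lemma distr_qgauss_mult_trans:
  assumes "distr qgauss qgauss (\<lambda>x. x * u) = qgauss" "distr qgauss qgauss (\<lambda>x. x * v) = qgauss"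
  shows "distr qgauss qgauss (\<lambda>x. x * (u * v)) = qgauss"
proof -
  have "(\<lambda>x. x * (u * v)) = (\<lambda>x. x * v) \<circ> (\<lambda>x. x * u)" by (auto simp: mult.assoc)
  moreover have "distr (distr qgauss qgauss (\<lambda>x. x * u)) qgauss (\<lambda>x. x * v)
    = distr qgauss qgauss ((\<lambda>x. x * v) \<circ> (\<lambda>x. x * u))"
    by (rule distr_distr) auto
  ultimately show ?thesis using assms by simp
qed

abbreviation gauss4 :: "((real \<times> real) \<times> (real \<times> real)) measure" where
  "gauss4 \<equiv> (gauss \<Otimes>\<^sub>M gauss) \<Otimes>\<^sub>M (gauss \<Otimes>\<^sub>M gauss)"

abbreviation quat_of_pairs :: "(real \<times> real) \<times> (real \<times> real) \<Rightarrow> quat" where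
  "quat_of_pairs p \<equiv> Quat (fst (fst p)) (snd (fst p)) (fst (snd p)) (snd (snd p))"

lemma distr_qgauss_mult_lift:
  assumes T [measurable]: "T \<in> measurable gauss4 gauss4" and D: "distr gauss4 gauss4 T = gauss4"
    and eq: "\<And>p. quat_of_pairs (T p) = quat_of_pairs p * u"
  shows "distr qgauss qgauss (\<lambda>x. x * u) = qgauss"
proof -
  have m: "quat_of_pairs \<in> measurable gauss4 qgauss" by measurable
  have "distr (distr gauss4 qgauss quat_of_pairs) qgauss (\<lambda>x. x * u)
     = distr gauss4 qgauss ((\<lambda>x. x * u) \<circ> quat_of_pairs)"
    by (rule distr_distr) (use m in auto)
  also have "(\<lambda>x. x * u) \<circ> quat_of_pairs = quat_of_pairs \<circ> T" using eq by auto
  also have "distr gauss4 qgauss (quat_of_pairs \<circ> T) = distr (distr gauss4 gauss4 T) qgauss quat_of_pairs"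
    by (rule distr_distr [symmetric, OF m T])
  also have "\<dots> = distr gauss4 qgauss quat_of_pairs" by (simp only: D)
  also have "\<dots> = qgauss" unfolding qgauss_def by (rule distr_cong) auto
  finally have *: "distr (distr gauss4 qgauss quat_of_pairs) qgauss (\<lambda>x. x * u) = qgauss" .
  have "distr gauss4 qgauss quat_of_pairs = qgauss" unfolding qgauss_def by (rule distr_cong) auto
  then show ?thesis using * by simp
qed

text \<open>On \<open>z\<^sub>1 + z\<^sub>2 j\<close>, right multiplication by the complex unit \<open>a + b i\<close> multiplies \<open>z\<^sub>1\<close> by \<open>a + b i\<close> and
\<open>z\<^sub>2\<close> by its conjugate, because \<open>j\<close> conjugates complex numbers: it is a rotation in each of the two planes.\<close>

lemma distr_qgauss_mult_complex_unit:
  assumes "a\<^sup>2 + b\<^sup>2 = 1"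
  shows "distr qgauss qgauss (\<lambda>x. x * Quat a b 0 0) = qgauss"
proof -
  let ?R = "\<lambda>b (x, y). (a * x + - b * y, b * x + a * y)"
  have D: "distr (gauss \<Otimes>\<^sub>M gauss) (gauss \<Otimes>\<^sub>M gauss) (?R c) = gauss \<Otimes>\<^sub>M gauss" if "a\<^sup>2 + c\<^sup>2 = 1" for c
    by (rule rot_invD [OF rot_inv_gauss that])
  have m: "?R c \<in> measurable (gauss \<Otimes>\<^sub>M gauss) (gauss \<Otimes>\<^sub>M gauss)" for c
    by measurable
  interpret g: prob_space gauss by (rule prob_space_gauss)
  interpret gg: pair_prob_space gauss gauss ..
  have dd: "distr (gauss \<Otimes>\<^sub>M gauss) (gauss \<Otimes>\<^sub>M gauss) (?R b) = gauss \<Otimes>\<^sub>M gauss"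
    "distr (gauss \<Otimes>\<^sub>M gauss) (gauss \<Otimes>\<^sub>M gauss) (?R (- b)) = gauss \<Otimes>\<^sub>M gauss"
    using assms by (intro D; simp)+
  have "gauss4 = distr gauss4 gauss4 (\<lambda>(p, q). (?R b p, ?R (- b) q))"
    using pair_measure_distr [OF m [of b] m [of "- b"]] gg.sigma_finite_measure_axioms
    by (simp only: dd)
  note D4 = this [symmetric]
  show ?thesis
    by (rule distr_qgauss_mult_lift [OF _ D4]) (auto simp: quat_eq_iff algebra_simps)
qed

text \<open>Right multiplication by \<open>a + b j\<close> is the real rotation with coefficients \<open>a\<close>, \<open>b\<close> of the pair
\<open>(z\<^sub>1, z\<^sub>2)\<close>, that is, of two independent copies of a plane Gaussian vector.\<close>

lemma distr_qgauss_mult_j_unit: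
  assumes "a\<^sup>2 + b\<^sup>2 = 1"
  shows "distr qgauss qgauss (\<lambda>x. x * Quat a 0 b 0) = qgauss"
proof -
  let ?R = "\<lambda>(u, v). ((a * fst u + - b * fst v, a * snd u + - b * snd v), (b * fst u + a * fst v, b * snd u + a * snd v))"
  have D: "distr gauss4 gauss4 ?R = gauss4"
    using rot_invD [OF rot_inv_pair [OF rot_inv_gauss rot_inv_gauss] assms] by (simp only: fst_conv snd_conv)
  show ?thesis
    by (rule distr_qgauss_mult_lift [OF _ D]) (auto simp: quat_eq_iff algebra_simps)
qed

text \<open>If \<open>u = r e\<^sup>i\<^sup>\<alpha> + s e\<^sup>i\<^sup>\<beta> j\<close>, then \<open>u = e\<^sup>i\<^sup>a (r + s j) e\<^sup>i\<^sup>b\<close> with \<open>a + b = \<alpha>\<close> and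
\<open>a - b = \<beta>\<close>, since \<open>j e\<^sup>i\<^sup>b = e\<^sup>-\<^sup>i\<^sup>b j\<close>.\<close>

lemma quat_unit_Euler:
  assumes "norm (u :: quat) = 1"
  obtains a b r s where "u = Quat (cos a) (sin a) 0 0 * Quat r 0 s 0 * Quat (cos b) (sin b) 0 0" "r\<^sup>2 + s\<^sup>2 = 1"
proof -
  obtain r \<alpha> where 1: "qRe u = r * cos \<alpha>" "qIm1 u = r * sin \<alpha>" using polar_Ex by blast
  obtain s \<beta> where 2: "qIm2 u = s * cos \<beta>" "qIm3 u = s * sin \<beta>" using polar_Ex by blast
  have "(norm u)\<^sup>2 = r\<^sup>2 * ((cos \<alpha>)\<^sup>2 + (sin \<alpha>)\<^sup>2) + s\<^sup>2 * ((cos \<beta>)\<^sup>2 + (sin \<beta>)\<^sup>2)"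
    unfolding norm_quat_squared 1 2 by (simp add: power_mult_distrib algebra_simps del: sin_cos_squared_add2 sin_cos_squared_add)
  then have "r\<^sup>2 + s\<^sup>2 = 1" using assms by simp
  moreover
  define a where "a = (\<alpha> + \<beta>) / 2"
  define b where "b = (\<alpha> - \<beta>) / 2"
  have "\<alpha> = a + b" "\<beta> = a - b" by (simp_all add: a_def b_def field_simps)
  then have "u = Quat (cos a) (sin a) 0 0 * Quat r 0 s 0 * Quat (cos b) (sin b) 0 0"
    using 1 2 by (simp add: quat_eq_iff cos_add sin_add cos_diff sin_diff) (simp add: algebra_simps)
  ultimately show ?thesis using that by blast
qed

lemma distr_qgauss_mult_unit:
  assumes "norm u = 1"
  shows "distr qgauss qgauss (\<lambda>x. x * u) = qgauss"
proof -
  obtain a b r s where u: "u = Quat (cos a) (sin a) 0 0 * Quat r 0 s 0 * Quat (cos b) (sin b) 0 0"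
    and rs: "r\<^sup>2 + s\<^sup>2 = 1" using quat_unit_Euler [OF assms] .
  show ?thesis unfolding u
    by (intro distr_qgauss_mult_trans distr_qgauss_mult_complex_unit distr_qgauss_mult_j_unit rs) simp_all
qed

lemma char_gauss: "(\<integral>x. iexp (t * x) \<partial>gauss) = of_real (exp (- t\<^sup>2 / 8))"
proof -
  have h: "sqrt (2 * pi * (1 / 2)\<^sup>2) = sqrt (2 * pi) / 2"
    by (simp add: real_sqrt_mult)
  have dens: "normal_density 0 (1 / 2) (x / 2) = 2 * std_normal_density x" for x :: real
    unfolding normal_density_def h by (simp add: power2_eq_square)
  have "(\<integral>x. iexp (t * x) \<partial>gauss) = (\<integral>x. normal_density 0 (1/2) x *\<^sub>R iexp (t * x) \<partial>lborel)"
    by (subst integral_density) auto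
  also have "\<dots> = \<bar>1/2\<bar> *\<^sub>R (\<integral>x. normal_density 0 (1/2) (0 + 1/2 * x) *\<^sub>R iexp (t * (0 + 1/2 * x)) \<partial>lborel)"
    by (rule lborel_integral_real_affine) simp
  also have "\<dots> = (\<integral>x. std_normal_density x *\<^sub>R iexp (t / 2 * x) \<partial>lborel)"
    by (subst integral_scaleR_right [symmetric], rule Bochner_Integration.integral_cong) (auto simp: dens)
  also have "\<dots> = char std_normal_distribution (t / 2)"
    unfolding char_def by (subst integral_density) auto
  also have "\<dots> = of_real (exp (- t\<^sup>2 / 8))"
    by (simp add: char_std_normal_distribution power_divide)
  finally show ?thesis .
qed

text \<open>With \<open>u\<close> the conjugate of \<open>p / |p|\<close>, \<open>\<langle>w, p\<rangle>\<close> is \<open>|p|\<close> times the real part of \<open>w u\<close>, and \<open>w u\<close> has the law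
of \<open>w\<close>. So the integral is a one-dimensional characteristic function.\<close>

lemma char_qgauss: "(\<integral>w. iexp (k * inner w p) \<partial>qgauss) = of_real (exp (- k\<^sup>2 * (norm p)\<^sup>2 / 8))"
proof (cases "p = 0")
  case True
  interpret prob_space qgauss by (rule prob_space_qgauss)
  show ?thesis using True prob_space by simp
next
  case False
  define u where "u = qcnj (p /\<^sub>R norm p)"
  have u: "norm u = 1" using False by (simp add: u_def)
  have inner: "inner w p = norm p * qRe (w * u)" for w
    using False by (simp add: u_def inner_quat_def algebra_simps)
  interpret g: prob_space gauss by (rule prob_space_gauss)
  interpret gg: pair_prob_space gauss gauss ..
  have "(\<integral>w. iexp (k * inner w p) \<partial>qgauss) = (\<integral>w. iexp (k * norm p * qRe (w * u)) \<partial>qgauss)"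
    by (simp add: inner mult.assoc)
  also have "\<dots> = (\<integral>w. iexp (k * norm p * qRe w) \<partial>distr qgauss qgauss (\<lambda>x. x * u))"
    by (subst integral_distr) auto
  also have "\<dots> = (\<integral>w. iexp (k * norm p * qRe w) \<partial>qgauss)"
    by (simp add: distr_qgauss_mult_unit [OF u])
  also have "\<dots> = (\<integral>q. iexp (k * norm p * fst (fst q)) \<partial>gauss4)"
    unfolding qgauss_def by (subst integral_distr) auto
  also have "\<dots> = (\<integral>q. iexp (k * norm p * fst q) \<partial>distr gauss4 (gauss \<Otimes>\<^sub>M gauss) fst)"
    by (subst integral_distr) auto
  also have "\<dots> = (\<integral>q. iexp (k * norm p * fst q) \<partial>(gauss \<Otimes>\<^sub>M gauss))"
    by (simp only: gg.distr_pair_fst)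
  also have "\<dots> = (\<integral>q. iexp (k * norm p * q) \<partial>distr (gauss \<Otimes>\<^sub>M gauss) gauss fst)"
    by (subst integral_distr) auto
  also have "\<dots> = (\<integral>q. iexp (k * norm p * q) \<partial>gauss)"
    by (simp only: g.distr_pair_fst)
  also have "\<dots> = of_real (exp (- k\<^sup>2 * (norm p)\<^sup>2 / 8))"
    using char_gauss [of "k * norm p"] by (simp add: power_mult_distrib mult.assoc)
  finally show ?thesis .
qed


section \<open>Bounded multiplicative functions on the half-line\<close>

lemma power_bounded_imp_le_1:
  fixes r :: real
  assumes "0 \<le> r" "\<And>n. r ^ n \<le> K"
  shows "r \<le> 1"
proof (rule ccontr)
  assume "\<not> r \<le> 1"
  then obtain n where "K < r ^ n" using real_arch_pow [of r K] by auto
  then show False using assms(2) [of n] by simp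
qed

text \<open>Cauchy's functional equation, with boundedness in place of continuity: a bounded multiplicative function is at
most \<open>1\<close>, hence decreasing, hence determined by its values at rational points. The point \<open>x = 0\<close> is
excluded because \<open>0 powr 0 = 0\<close> when \<open>r 1 = 0\<close>.\<close>

lemma powr_if_multiplicative:
  fixes r :: "real \<Rightarrow> real"
  assumes nn: "\<And>x. 0 \<le> x \<Longrightarrow> 0 \<le> r x" and bd: "\<And>x. 0 \<le> x \<Longrightarrow> r x \<le> K"
    and mult: "\<And>x y. 0 \<le> x \<Longrightarrow> 0 \<le> y \<Longrightarrow> r (x + y) = r x * r y" and r0: "r 0 = 1"
    and x: "0 < x"
  shows "r x = r 1 powr x"
proof -
  have pow: "r (real n * y) = r y ^ n" if "0 \<le> y" for n y
    by (induction n) (use that in \<open>auto simp: r0 mult algebra_simps\<close>)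
  have le1: "r y \<le> 1" if y: "0 \<le> y" for y
    by (rule power_bounded_imp_le_1 [where K = K]) (use y in \<open>auto simp: nn bd simp flip: pow\<close>)
  have anti: "r z \<le> r y" if "0 \<le> y" "y \<le> z" for y z
  proof -
    have "r z = r y * r (z - y)" using mult [of y "z - y"] that by simp
    also have "\<dots> \<le> r y * 1" using that by (intro mult_left_mono le1 nn) auto
    finally show ?thesis by simp
  qed
  show ?thesis
  proof (cases "r 1 = 0")
    case True
    obtain n where n: "1 < real n * x" using x reals_Archimedean3 by blast
    have "r x ^ n = r (real n * x)" using x by (simp add: pow)
    also have "\<dots> \<le> r 1" using n by (intro anti) auto
    finally have "r x ^ n \<le> 0" using True by simp
    moreover have "0 \<le> r x ^ n" using nn x by simp
    ultimately have "r x ^ n = 0" by simp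
    then show ?thesis using True by simp
  next
    case False
    then have r1: "0 < r 1" using nn [of 1] by simp
    have root: "r (1 / real n) = r 1 powr (1 / real n)" if "n > 0" for n
    proof -
      have "r (1 / real n) ^ n = r 1" using that pow [of "1 / real n" n] by simp
      moreover from this have "0 < r (1 / real n)"
        using nn [of "1 / real n"] r1 that by (cases "r (1 / real n) = 0") (auto simp: zero_power)
      then have "r (1 / real n) = (r (1 / real n) ^ n) powr (1 / real n)"
        using that by (simp add: powr_powr flip: powr_realpow)
      ultimately show ?thesis by simp
    qed
    have frac: "r (real k / real n) = r 1 powr (real k / real n)" if "n > 0" for k n
    proof -
      have "r (real k / real n) = r (1 / real n) ^ k" using pow [of "1 / real n" k] by simp
      then show ?thesis using r1 by (simp add: root [OF that] powr_power)
    qed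
    \<comment> \<open>\<open>k n / n\<close> and \<open>(k n + 1) / n\<close> enclose \<open>x\<close>\<close>
    define k where "k n = nat \<lfloor>real n * x\<rfloor>" for n
    have k: "real (k n) \<le> real n * x" "real n * x < real (k n) + 1" for n
    proof -
      have "0 \<le> real n * x" using x by simp
      then have "real (k n) = of_int \<lfloor>real n * x\<rfloor>" by (simp add: k_def)
      then show "real (k n) \<le> real n * x" "real n * x < real (k n) + 1" by linarith+
    qed
    have kb: "x \<le> (real (k N) + 1) / real N" "real (k N) / real N \<le> x"
        "x - 1 / real N \<le> real (k N) / real N" "(real (k N) + 1) / real N \<le> x + 1 / real N"
      if "N > 0" for N
    proof -
      show 1: "x \<le> (real (k N) + 1) / real N" and 2: "real (k N) / real N \<le> x"
        using k [of N] that by (simp_all add: pos_le_divide_eq pos_divide_le_eq mult.commute)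
      show "x - 1 / real N \<le> real (k N) / real N" "(real (k N) + 1) / real N \<le> x + 1 / real N"
        using 1 2 by (simp_all add: add_divide_distrib)
    qed
    have up: "r x \<le> r 1 powr (x - 1 / real (Suc n))" for n
    proof -
      have "r x \<le> r (real (k (Suc n)) / real (Suc n))"
        using kb [of "Suc n"] by (intro anti) (auto simp del: of_nat_Suc)
      also have "\<dots> = r 1 powr (real (k (Suc n)) / real (Suc n))" by (rule frac) simp
      also have "\<dots> \<le> r 1 powr (x - 1 / real (Suc n))"
        using kb [of "Suc n"] r1 le1 [of 1] by (intro powr_mono') (auto simp del: of_nat_Suc)
      finally show ?thesis .
    qed
    have low: "r 1 powr (x + 1 / real (Suc n)) \<le> r x" for n
    proof -
      have "r 1 powr (x + 1 / real (Suc n)) \<le> r 1 powr ((real (k (Suc n)) + 1) / real (Suc n))"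
        using kb [of "Suc n"] r1 le1 [of 1] by (intro powr_mono') (auto simp del: of_nat_Suc)
      also have "\<dots> = r ((real (k (Suc n)) + 1) / real (Suc n))"
        using frac [of "Suc n" "k (Suc n) + 1"] by (simp add: add.commute)
      also have "\<dots> \<le> r x"
        using kb [of "Suc n"] x by (intro anti) (auto simp del: of_nat_Suc)
      finally show ?thesis .
    qed
    have inv: "(\<lambda>n. 1 / real (Suc n)) \<longlonglongrightarrow> 0" by (rule LIMSEQ_Suc [OF lim_1_over_n])
    have "(\<lambda>n. r 1 powr (x - 1 / real (Suc n))) \<longlonglongrightarrow> r 1 powr (x - 0)"
      using r1 by (intro tendsto_intros inv) auto
    then have "r x \<le> r 1 powr x"
      using LIMSEQ_le_const [of _ "r 1 powr (x - 0)" "r x"] up by auto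
    moreover have "(\<lambda>n. r 1 powr (x + 1 / real (Suc n))) \<longlonglongrightarrow> r 1 powr (x + 0)"
      using r1 by (intro tendsto_intros inv) auto
    then have "r 1 powr x \<le> r x"
      using LIMSEQ_le_const2 [of _ "r 1 powr (x + 0)" "r x"] low by auto
    ultimately show ?thesis by simp
  qed
qed


section \<open>Oscillatory integrals in two rotation-invariant vectors\<close>

lemma borel_measurable_cnj [measurable]: "cnj \<in> borel_measurable borel"
  by (intro borel_measurable_continuous_onI linear_continuous_on bounded_linear_cnj)

locale rot_invariant =
  fixes \<nu> :: "'v measure" and comb :: "real \<Rightarrow> 'v \<Rightarrow> real \<Rightarrow> 'v \<Rightarrow> 'v"
  assumes rot: "rot_inv \<nu> comb"
begin

sublocale prob_space \<nu> using rot by (simp add: rot_inv_def)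

sublocale pair: pair_prob_space \<nu> \<nu> ..

lemma measurable_comb: "(\<lambda>z. comb a (fst z) b (snd z)) \<in> measurable (\<nu> \<Otimes>\<^sub>M \<nu>) \<nu>"
  using rot by (simp add: rot_inv_def case_prod_beta')

lemma measurable_comb' [measurable (raw)]:
  assumes "f \<in> measurable M \<nu>" "g \<in> measurable M \<nu>"
  shows "(\<lambda>x. comb a (f x) b (g x)) \<in> measurable M \<nu>"
  using measurable_compose [OF measurable_Pair [OF assms] measurable_comb] by simp

lemma comb_space: "u \<in> space \<nu> \<Longrightarrow> v \<in> space \<nu> \<Longrightarrow> comb a u b v \<in> space \<nu>"
  using measurable_space [OF measurable_comb [of a b], of "(u, v)"] by (simp add: space_pair_measure)

lemma integral_rotate:
  fixes f :: "_ \<Rightarrow> _ :: {banach, second_countable_topology}"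
  assumes [measurable]: "f \<in> borel_measurable (\<nu> \<Otimes>\<^sub>M \<nu>)" and "c\<^sup>2 + s\<^sup>2 = 1"
  shows "(\<integral>z. f z \<partial>(\<nu> \<Otimes>\<^sub>M \<nu>)) =
    (\<integral>z. f (comb c (fst z) (- s) (snd z), comb s (fst z) c (snd z)) \<partial>(\<nu> \<Otimes>\<^sub>M \<nu>))"
proof -
  have "(\<integral>z. f z \<partial>(\<nu> \<Otimes>\<^sub>M \<nu>)) =
    (\<integral>z. f z \<partial>distr (\<nu> \<Otimes>\<^sub>M \<nu>) (\<nu> \<Otimes>\<^sub>M \<nu>) (\<lambda>(u, v). (comb c u (- s) v, comb s u c v)))"
    by (simp only: rot_invD [OF rot assms(2)])
  also have "\<dots> = (\<integral>z. f (comb c (fst z) (- s) (snd z), comb s (fst z) c (snd z)) \<partial>(\<nu> \<Otimes>\<^sub>M \<nu>))"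
    by (subst integral_distr) (auto simp: case_prod_beta')
  finally show ?thesis .
qed

end

lemma (in pair_prob_space) integral_mult_pair:
  fixes f g :: "_ \<Rightarrow> complex"
  assumes f: "f \<in> borel_measurable M1" "\<And>x. norm (f x) \<le> 1"
    and g: "g \<in> borel_measurable M2" "\<And>x. norm (g x) \<le> 1"
  shows "(\<integral>z. f (fst z) * g (snd z) \<partial>(M1 \<Otimes>\<^sub>M M2)) = (\<integral>x. f x \<partial>M1) * (\<integral>y. g y \<partial>M2)"
proof -
  note [measurable] = f(1) g(1)
  have "integrable (M1 \<Otimes>\<^sub>M M2) (\<lambda>z. f (fst z) * g (snd z))"
    by (rule P.integrable_const_bound [where B = 1])
      (auto simp: norm_mult intro!: mult_le_one f g)
  then have "(\<integral>z. f (fst z) * g (snd z) \<partial>(M1 \<Otimes>\<^sub>M M2)) = (\<integral>x. \<integral>y. f x * g y \<partial>M2 \<partial>M1)"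
    using integral_fst' [of "\<lambda>z. f (fst z) * g (snd z)"] by simp
  then show ?thesis by simp
qed

text \<open>In the application \<open>\<nu>\<close> is the law of one Gaussian column and \<open>B\<close> collects the terms of the permanent in
which the last row uses neither of the two columns.\<close>

locale two_columns = rot_invariant +
  fixes B :: "'a \<Rightarrow> 'a \<Rightarrow> real"
  assumes B_meas: "(\<lambda>z. B (fst z) (snd z)) \<in> borel_measurable (\<nu> \<Otimes>\<^sub>M \<nu>)"
    and B_sym: "\<And>u v. u \<in> space \<nu> \<Longrightarrow> v \<in> space \<nu> \<Longrightarrow> B u v = B v u"
    and B_lin: "\<And>a b u v w. u \<in> space \<nu> \<Longrightarrow> v \<in> space \<nu> \<Longrightarrow> w \<in> space \<nu> \<Longrightarrow>
       B (comb a u b v) w = a * B u w + b * B v w"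
begin

definition linear_fun :: "('a \<Rightarrow> real) \<Rightarrow> bool" where
  "linear_fun l \<longleftrightarrow> l \<in> borel_measurable \<nu> \<and>
     (\<forall>a b. \<forall>u\<in>space \<nu>. \<forall>v\<in>space \<nu>. l (comb a u b v) = a * l u + b * l v)"

text \<open>\<open>\<Phi> k l\<close> is the mean to be estimated and \<open>\<Psi>\<close> its one-vector analogue. By \<open>\<Phi>_eq_\<Psi>\<close> the function \<open>g\<close> is
\<open>\<Phi>\<close> with one of the two linear forms equal to zero.\<close>

definition \<Phi> :: "('a \<Rightarrow> real) \<Rightarrow> ('a \<Rightarrow> real) \<Rightarrow> complex" where
  "\<Phi> k l = (\<integral>z. iexp (B (fst z) (snd z) + k (fst z) + l (snd z)) \<partial>(\<nu> \<Otimes>\<^sub>M \<nu>))"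

definition \<Psi> :: "('a \<Rightarrow> real) \<Rightarrow> complex" where
  "\<Psi> l = (\<integral>u. iexp (B u u / 2 + l u) \<partial>\<nu>)"

definition g :: "('a \<Rightarrow> real) \<Rightarrow> real" where
  "g l = (cmod (\<Psi> (\<lambda>u. l u / sqrt 2)))\<^sup>2"

lemma linear_funD:
  assumes "linear_fun l"
  shows "l \<in> borel_measurable \<nu>"
    "u \<in> space \<nu> \<Longrightarrow> v \<in> space \<nu> \<Longrightarrow> l (comb a u b v) = a * l u + b * l v"
  using assms by (auto simp: linear_fun_def)

lemma linear_fun_combine:
  assumes "linear_fun k" "linear_fun l"
  shows "linear_fun (\<lambda>u. a * k u + b * l u)"
  using assms by (auto simp: linear_fun_def algebra_simps)

lemma linear_fun_scale: "linear_fun l \<Longrightarrow> linear_fun (\<lambda>u. a * l u)"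
  using linear_fun_combine [of l l a 0] by simp

lemma B_lin2: "u \<in> space \<nu> \<Longrightarrow> v \<in> space \<nu> \<Longrightarrow> w \<in> space \<nu> \<Longrightarrow>
    B w (comb a u b v) = a * B w u + b * B w v"
  using B_lin [of u v w a b] B_sym comb_space by metis

lemma B_meas' [measurable (raw)]:
  assumes "f \<in> measurable M \<nu>" "h \<in> measurable M \<nu>"
  shows "(\<lambda>x. B (f x) (h x)) \<in> borel_measurable M"
  using measurable_compose [OF measurable_Pair [OF assms] B_meas] by simp

text \<open>In the coordinates \<open>(u - v) / \<surd>2\<close> and \<open>(u + v) / \<surd>2\<close> the symmetric form \<open>B u v\<close> becomes
\<open>(B u u - B v v) / 2\<close>, so that the integral splits into a product; the minus sign turns the second factor
into a complex conjugate.\<close>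

lemma \<Phi>_eq_\<Psi>:
  assumes k: "linear_fun k" and l: "linear_fun l"
  shows "\<Phi> k l = \<Psi> (\<lambda>u. (k u + l u) / sqrt 2) * cnj (\<Psi> (\<lambda>u. (k u - l u) / sqrt 2))"
proof -
  note [measurable] = linear_funD(1) [OF k] linear_funD(1) [OF l]
  define c where "c = 1 / sqrt 2"
  have cc: "c * c = 1 / 2" by (simp add: c_def)
  then have cs: "c\<^sup>2 + c\<^sup>2 = 1" by (simp add: power2_eq_square)
  let ?f = "\<lambda>u. iexp (B u u / 2 + (k u + l u) / sqrt 2)"
  let ?g = "\<lambda>u. iexp (B u u / 2 + (k u - l u) / sqrt 2)"
  have "\<Phi> k l = (\<integral>z. ?f (fst z) * cnj (?g (snd z)) \<partial>(\<nu> \<Otimes>\<^sub>M \<nu>))"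
    unfolding \<Phi>_def
  proof (subst integral_rotate [OF _ cs], measurable, rule Bochner_Integration.integral_cong [OF refl])
    fix z assume "z \<in> space (\<nu> \<Otimes>\<^sub>M \<nu>)"
    then obtain u v where z: "z = (u, v)" and uv: "u \<in> space \<nu>" "v \<in> space \<nu>"
      by (auto simp: space_pair_measure)
    have "B (comb c u (- c) v) (comb c u c v) = c * c * B u u - c * c * B v v"
      using uv by (simp add: B_lin B_lin2 comb_space B_sym [of v u] algebra_simps)
    then have *: "B (comb c u (- c) v) (comb c u c v) + k (comb c u (- c) v) + l (comb c u c v)
      = (B u u / 2 + (k u + l u) / sqrt 2) + - (B v v / 2 + (k v - l v) / sqrt 2)"
      using uv by (simp add: cc linear_funD(2) [OF k] linear_funD(2) [OF l])
        (simp add: c_def add_divide_distrib diff_divide_distrib)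
    show "iexp (B (fst (comb c (fst z) (- c) (snd z), comb c (fst z) c (snd z)))
              (snd (comb c (fst z) (- c) (snd z), comb c (fst z) c (snd z))) +
             k (fst (comb c (fst z) (- c) (snd z), comb c (fst z) c (snd z))) +
             l (snd (comb c (fst z) (- c) (snd z), comb c (fst z) c (snd z))))
        = ?f (fst z) * cnj (?g (snd z))"
      unfolding z fst_conv snd_conv * by (simp only: exp_cnj exp_add [symmetric] complex_cnj_mult complex_cnj_i complex_cnj_complex_of_real)
        (simp add: add_divide_distrib diff_divide_distrib algebra_simps)
  qed
  also have "\<dots> = (\<integral>u. ?f u \<partial>\<nu>) * (\<integral>v. cnj (?g v) \<partial>\<nu>)"
    by (rule pair.integral_mult_pair) auto
  also have "\<dots> = \<Psi> (\<lambda>u. (k u + l u) / sqrt 2) * cnj (\<Psi> (\<lambda>u. (k u - l u) / sqrt 2))"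
    by (simp add: \<Psi>_def)
  finally show ?thesis .
qed

lemma g_nonneg: "0 \<le> g l" by (simp add: g_def)

lemma linear_fun_0: "linear_fun (\<lambda>_. 0)" by (simp add: linear_fun_def)

lemma \<Phi>_zero_right: "linear_fun l \<Longrightarrow> \<Phi> l (\<lambda>_. 0) = of_real (g l)"
  by (simp add: \<Phi>_eq_\<Psi> linear_fun_0 g_def complex_norm_square [symmetric])

lemma \<Phi>_swap:
  assumes k: "linear_fun k" and l: "linear_fun l"
  shows "\<Phi> k l = \<Phi> l k"
proof -
  note [measurable] = linear_funD(1) [OF k] linear_funD(1) [OF l]
  have "\<Phi> k l = (\<integral>z. iexp (B (snd z) (fst z) + k (snd z) + l (fst z)) \<partial>(\<nu> \<Otimes>\<^sub>M \<nu>))"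
    unfolding \<Phi>_def by (subst pair.integral_product_swap [symmetric]) (auto simp: case_prod_beta')
  also have "\<dots> = \<Phi> l k"
    unfolding \<Phi>_def by (intro Bochner_Integration.integral_cong)
      (auto simp: space_pair_measure B_sym algebra_simps)
  finally show ?thesis .
qed

lemma norm_\<Phi>_square:
  assumes k: "linear_fun k" and l: "linear_fun l"
  shows "(cmod (\<Phi> k l))\<^sup>2 = g (\<lambda>u. k u + l u) * g (\<lambda>u. k u - l u)"
  by (simp add: \<Phi>_eq_\<Psi> [OF k l] g_def norm_mult power_mult_distrib)

lemma g_le_1:
  assumes l: "linear_fun l"
  shows "g l \<le> 1"
proof -
  note [measurable] = linear_funD(1) [OF l]
  have "cmod (\<Phi> l (\<lambda>_. 0)) \<le> (\<integral>z. cmod (iexp (B (fst z) (snd z) + l (fst z) + 0)) \<partial>(\<nu> \<Otimes>\<^sub>M \<nu>))"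
    unfolding \<Phi>_def by (rule integral_norm_bound)
  also have "\<dots> = 1" by (simp only: norm_exp_i_times) (simp add: pair.prob_space)
  finally show ?thesis by (simp add: \<Phi>_zero_right [OF l] g_nonneg)
qed

text \<open>The product \<open>g k * g l\<close> is an integral over two independent pairs. Rotating one pair against the other
leaves the sum of the two values of \<open>B\<close> unchanged and rotates \<open>k\<close> and \<open>l\<close>. For a Gaussian law this expresses that
\<open>ln g\<close> is, up to a constant, a quadratic form.\<close>

lemma g_rotate:
  assumes k: "linear_fun k" and l: "linear_fun l" and cs: "c\<^sup>2 + s\<^sup>2 = 1"
  shows "g k * g l = g (\<lambda>u. c * k u + s * l u) * g (\<lambda>u. c * l u - s * k u)"
proof -
  note [measurable] = linear_funD(1) [OF k] linear_funD(1) [OF l]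
  interpret pp: rot_invariant "\<nu> \<Otimes>\<^sub>M \<nu>" "\<lambda>a u b v. (comb a (fst u) b (fst v), comb a (snd u) b (snd v))"
    using rot_inv_pair [OF rot rot] by unfold_locales
  let ?q = "\<lambda>z. B (fst z) (snd z)"
  have prod: "of_real (g k * g l) =
     (\<integral>w. iexp (?q (fst w) + ?q (snd w) + k (fst (fst w)) + l (fst (snd w))) \<partial>((\<nu> \<Otimes>\<^sub>M \<nu>) \<Otimes>\<^sub>M (\<nu> \<Otimes>\<^sub>M \<nu>)))"
    if k: "linear_fun k" and l: "linear_fun l" for k l
  proof -
    note [measurable] = linear_funD(1) [OF k] linear_funD(1) [OF l]
    have "of_real (g k * g l) = \<Phi> k (\<lambda>_. 0) * \<Phi> l (\<lambda>_. 0)"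
      by (simp add: \<Phi>_zero_right k l)
    also have "\<dots> = (\<integral>w. iexp (?q (fst w) + k (fst (fst w)) + 0) * iexp (?q (snd w) + l (fst (snd w)) + 0)
        \<partial>((\<nu> \<Otimes>\<^sub>M \<nu>) \<Otimes>\<^sub>M (\<nu> \<Otimes>\<^sub>M \<nu>)))"
      unfolding \<Phi>_def by (rule pp.pair.integral_mult_pair [symmetric]) auto
    also have "\<dots> = (\<integral>w. iexp (?q (fst w) + ?q (snd w) + k (fst (fst w)) + l (fst (snd w)))
        \<partial>((\<nu> \<Otimes>\<^sub>M \<nu>) \<Otimes>\<^sub>M (\<nu> \<Otimes>\<^sub>M \<nu>)))"
      by (intro Bochner_Integration.integral_cong) (auto simp: exp_add [symmetric] algebra_simps)
    finally show ?thesis .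
  qed
  have "of_real (g k * g l) = complex_of_real (g (\<lambda>u. c * k u + s * l u) * g (\<lambda>u. c * l u + (- s) * k u))"
    unfolding prod [OF k l] prod [OF linear_fun_combine [OF k l] linear_fun_combine [OF l k]]
  proof (subst pp.integral_rotate [OF _ cs], measurable, rule Bochner_Integration.integral_cong [OF refl])
    fix w assume "w \<in> space ((\<nu> \<Otimes>\<^sub>M \<nu>) \<Otimes>\<^sub>M (\<nu> \<Otimes>\<^sub>M \<nu>))"
    then obtain u v x y where w: "w = ((u, v), (x, y))"
      and sp: "u \<in> space \<nu>" "v \<in> space \<nu>" "x \<in> space \<nu>" "y \<in> space \<nu>"
      by (auto simp: space_pair_measure)
    have "B (comb c u (- s) x) (comb c v (- s) y) + B (comb s u c x) (comb s v c y)
       = (c * c + s * s) * (B u v + B x y)"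
      using sp by (simp add: B_lin B_lin2 comb_space) (simp add: algebra_simps)
    then have "B (comb c u (- s) x) (comb c v (- s) y) + B (comb s u c x) (comb s v c y) = B u v + B x y"
      using cs by (simp add: power2_eq_square)
    then show "iexp (?q (fst ((comb c (fst (fst w)) (- s) (fst (snd w)), comb c (snd (fst w)) (- s) (snd (snd w))),
           (comb s (fst (fst w)) c (fst (snd w)), comb s (snd (fst w)) c (snd (snd w))))) +
         ?q (snd ((comb c (fst (fst w)) (- s) (fst (snd w)), comb c (snd (fst w)) (- s) (snd (snd w))),
           (comb s (fst (fst w)) c (fst (snd w)), comb s (snd (fst w)) c (snd (snd w))))) +
         k (fst (fst ((comb c (fst (fst w)) (- s) (fst (snd w)), comb c (snd (fst w)) (- s) (snd (snd w))),
           (comb s (fst (fst w)) c (fst (snd w)), comb s (snd (fst w)) c (snd (snd w)))))) +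
         l (fst (snd ((comb c (fst (fst w)) (- s) (fst (snd w)), comb c (snd (fst w)) (- s) (snd (snd w))),
           (comb s (fst (fst w)) c (fst (snd w)), comb s (snd (fst w)) c (snd (snd w))))))) =
       iexp (?q (fst w) + ?q (snd w) + (c * k (fst (fst w)) + s * l (fst (fst w))) +
         (c * l (fst (snd w)) + - s * k (fst (snd w))))"
      unfolding w fst_conv snd_conv
      using sp by (simp only: linear_funD(2) [OF k] linear_funD(2) [OF l]) (simp add: algebra_simps)
  qed
  then show ?thesis by (simp flip: of_real_mult)
qed

text \<open>By \<open>g_rotate\<close>, \<open>x \<mapsto> g (\<surd>x m) / g 0\<close> is multiplicative, hence equal to \<open>(g m / g 0)\<^sup>x\<close>. Therefore the
modulus of the left-hand mean is \<open>g k\<^sup>1\<^sup>-\<^sup>t g l\<^sup>t\<close>, and the inequality of weighted means applies. When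
\<open>g 0 = 0\<close> the same relation forces the left-hand mean to vanish.\<close>

lemma \<Phi>_interpolation:
  assumes k: "linear_fun k" and l: "linear_fun l" and t: "0 < t" "t < 1"
  shows "Re (\<Phi> (\<lambda>u. sqrt (1 - t) * k u) (\<lambda>u. sqrt t * l u))
    \<le> (1 - t) * Re (\<Phi> k (\<lambda>_. 0)) + t * Re (\<Phi> (\<lambda>_. 0) l)"
proof -
  define h where "h m x = g (\<lambda>u. sqrt x * m u)" for m x
  let ?\<Phi> = "\<Phi> (\<lambda>u. sqrt (1 - t) * k u) (\<lambda>u. sqrt t * l u)"
  define g0 where "g0 = g (\<lambda>_. 0)"
  have h0: "h m 0 = g0" for m by (simp add: h_def g0_def)
  have h1: "h m 1 = g m" for m by (simp add: h_def)
  have hmult: "h m x * h m y = h m (x + y) * g0" if m: "linear_fun m" and xy: "0 \<le> x" "0 \<le> y" for m x y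
  proof (cases "x + y = 0")
    case True
    then have "x = 0" "y = 0" using xy by auto
    then show ?thesis by (simp add: h0)
  next
    case False
    \<comment> \<open>the rotation that takes \<open>(\<surd>x m, \<surd>y m)\<close> to \<open>(\<surd>(x + y) m, 0)\<close>\<close>
    define c s where "c = sqrt x / sqrt (x + y)" and "s = sqrt y / sqrt (x + y)"
    have cs: "c\<^sup>2 + s\<^sup>2 = 1"
      using xy False by (simp add: c_def s_def power_divide add_divide_distrib [symmetric])
    have "h m x * h m y = g (\<lambda>u. c * (sqrt x * m u) + s * (sqrt y * m u)) *
        g (\<lambda>u. c * (sqrt y * m u) - s * (sqrt x * m u))"
      unfolding h_def using m by (intro g_rotate cs linear_fun_scale)
    also have "(\<lambda>u. c * (sqrt x * m u) + s * (sqrt y * m u)) = (\<lambda>u. sqrt (x + y) * m u)"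
    proof
      fix u
      have "c * (sqrt x * m u) + s * (sqrt y * m u) = (c * sqrt x + s * sqrt y) * m u"
        by (simp add: algebra_simps)
      also have "c * sqrt x + s * sqrt y = (x + y) / sqrt (x + y)"
        using xy by (simp add: c_def s_def add_divide_distrib)
      also have "\<dots> = sqrt (x + y)" using xy by (simp add: real_div_sqrt)
      finally show "c * (sqrt x * m u) + s * (sqrt y * m u) = sqrt (x + y) * m u" .
    qed
    also have "(\<lambda>u. c * (sqrt y * m u) - s * (sqrt x * m u)) = (\<lambda>_. 0)"
      by (simp add: c_def s_def)
    finally show ?thesis by (simp add: h_def g0_def)
  qed
  have hb: "0 \<le> h m x" "linear_fun m \<Longrightarrow> h m x \<le> 1" for m x
    by (simp_all add: h_def g_nonneg g_le_1 linear_fun_scale)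
  have "(cmod ?\<Phi>)\<^sup>2 = g (\<lambda>u. sqrt (1 - t) * k u + sqrt t * l u) * g (\<lambda>u. sqrt (1 - t) * k u - sqrt t * l u)"
    by (rule norm_\<Phi>_square) (intro linear_fun_scale k l)+
  also have "\<dots> = h l (2 * t) * h k (2 * (1 - t))"
  proof -
    \<comment> \<open>the rotation that takes \<open>(a + b, a - b)\<close> to \<open>(\<surd>2 b, \<surd>2 a)\<close>\<close>
    define c where "c = 1 / sqrt 2"
    have cs: "c\<^sup>2 + (- c)\<^sup>2 = 1" by (simp add: c_def power_divide)
    have c2: "2 * c = sqrt 2" by (simp add: c_def real_div_sqrt)
    let ?a = "\<lambda>u. sqrt (1 - t) * k u + sqrt t * l u" and ?b = "\<lambda>u. sqrt (1 - t) * k u + (- sqrt t) * l u"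
    have "g ?a * g ?b = g (\<lambda>u. c * ?a u + - c * ?b u) * g (\<lambda>u. c * ?b u - - c * ?a u)"
      by (rule g_rotate [OF _ _ cs]) (intro linear_fun_combine k l)+
    also have "(\<lambda>u. c * ?a u + - c * ?b u) = (\<lambda>u. sqrt (2 * t) * l u)"
      by (simp add: fun_eq_iff real_sqrt_mult c2 [symmetric] algebra_simps)
    also have "(\<lambda>u. c * ?b u - - c * ?a u) = (\<lambda>u. sqrt (2 * (1 - t)) * k u)"
      by (simp only: fun_eq_iff real_sqrt_mult c2 [symmetric]) (simp add: algebra_simps)
    finally show ?thesis by (simp add: h_def)
  qed
  finally have sq: "(cmod ?\<Phi>)\<^sup>2 = h l (2 * t) * h k (2 * (1 - t))" .
  have "cmod ?\<Phi> \<le> (1 - t) * g k + t * g l"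
  proof (cases "g0 = 0")
    case True
    have "h l (2 * t) * h l (2 * t) = 0" using hmult [OF l, of "2 * t" "2 * t"] t True by simp
    then have "cmod ?\<Phi> = 0" using sq by simp
    then show ?thesis using t g_nonneg by (simp add: add_nonneg_nonneg)
  next
    case False
    then have g0: "0 < g0" using g_nonneg unfolding g0_def by (simp add: less_le)
    have pw: "h m x = g0 * (g m / g0) powr x" if m: "linear_fun m" and x: "0 < x" for m x
    proof -
      have "h m x / g0 = (h m 1 / g0) powr x"
      proof (rule powr_if_multiplicative [where r = "\<lambda>x. h m x / g0" and K = "1 / g0"])
        show "h m (x + y) / g0 = h m x / g0 * (h m y / g0)" if "0 \<le> x" "0 \<le> y" for x y
          using hmult [OF m that] g0 by (simp add: field_simps)
      qed (use g0 hb m x in \<open>auto simp: h0 divide_right_mono\<close>)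
      then show ?thesis using g0 by (simp add: h1 field_simps)
    qed
    define a b where "a = g k / g0" and "b = g l / g0"
    have ab: "0 \<le> a" "0 \<le> b" using g0 g_nonneg by (auto simp: a_def b_def)
    have pp: "z powr (2 * x) = (z powr x)\<^sup>2" for z x :: real
      by (simp add: power2_eq_square powr_add [symmetric])
    have "h l (2 * t) = g0 * (b powr t)\<^sup>2" "h k (2 * (1 - t)) = g0 * (a powr (1 - t))\<^sup>2"
      using pw [OF l, of "2 * t"] pw [OF k, of "2 * (1 - t)"] t by (simp_all only: pp a_def b_def) simp_all
    then have "(cmod ?\<Phi>)\<^sup>2 = (g0 * (a powr (1 - t) * b powr t))\<^sup>2"
      unfolding sq by (simp add: power2_eq_square)
    then have "cmod ?\<Phi> = g0 * (a powr (1 - t) * b powr t)"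
      by (rule power2_eq_imp_eq) (use g0 in simp_all)
    also have "\<dots> \<le> g0 * ((1 - t) * a + t * b)"
    proof (rule mult_left_mono)
      show "a powr (1 - t) * b powr t \<le> (1 - t) * a + t * b"
      proof (cases "a = 0 \<or> b = 0")
        case True
        then show ?thesis using ab t by auto
      next
        case False
        then show ?thesis using ab t by (intro Youngs_inequality_0) auto
      qed
    qed (use g0 in simp)
    also have "\<dots> = (1 - t) * g k + t * g l"
      using g0 by (simp add: a_def b_def field_simps)
    finally show ?thesis .
  qed
  moreover have "\<Phi> (\<lambda>_. 0) l = of_real (g l)" using \<Phi>_swap \<Phi>_zero_right l linear_fun_0 by simp
  ultimately show ?thesis
    using complex_Re_le_cmod [of ?\<Phi>] by (simp add: \<Phi>_zero_right k)
qed

end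


section \<open>Row-ordered permanents\<close>

text \<open>The row-ordered permanent of the rows \<open>0, \<dots>, m - 1\<close> and the columns in \<open>C\<close>, expanded along its last row. The
last row is the last factor of every product, so no factor has to be moved past another. Keeping the
column set as an argument avoids renumbering the columns of minors.\<close>

fun row_per :: "nat \<Rightarrow> nat set \<Rightarrow> (nat \<times> nat \<Rightarrow> quat) \<Rightarrow> quat" where
  "row_per 0 C a = 1"
| "row_per (Suc m) C a = (\<Sum>j\<in>C. row_per m (C - {j}) a * a (m, j))"

definition last_row_per :: "nat \<Rightarrow> nat set \<Rightarrow> (nat \<Rightarrow> quat) \<Rightarrow> (nat \<times> nat \<Rightarrow> quat) \<Rightarrow> quat" where
  "last_row_per m C x a = (\<Sum>j\<in>C. row_per m (C - {j}) a * x j)"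

definition set_col :: "nat \<Rightarrow> (nat \<Rightarrow> quat) \<Rightarrow> (nat \<times> nat \<Rightarrow> quat) \<Rightarrow> nat \<times> nat \<Rightarrow> quat" where
  "set_col p u a = (\<lambda>(i, j). if j = p then u i else a (i, j))"

definition set_row :: "nat \<Rightarrow> (nat \<Rightarrow> quat) \<Rightarrow> (nat \<times> nat \<Rightarrow> quat) \<Rightarrow> nat \<times> nat \<Rightarrow> quat" where
  "set_row m x a = (\<lambda>(i, j). if i = m then x j else a (i, j))"

lemma row_per_cong:
  "(\<And>i j. i < m \<Longrightarrow> j \<in> C \<Longrightarrow> a (i, j) = b (i, j)) \<Longrightarrow> row_per m C a = row_per m C b"
proof (induction m arbitrary: C)
  case (Suc m)
  have "row_per m (C - {j}) a = row_per m (C - {j}) b" for j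
    by (rule Suc.IH) (use Suc.prems in auto)
  then show ?case using Suc.prems by (auto intro!: sum.cong)
qed simp

lemma row_per_linear_col:
  assumes "finite C" "card C = m" "p \<in> C"
  shows "row_per m C (set_col p (\<lambda>i. c *\<^sub>R u i + d *\<^sub>R v i) a)
     = c *\<^sub>R row_per m C (set_col p u a) + d *\<^sub>R row_per m C (set_col p v a)"
  using assms
proof (induction m arbitrary: C)
  case 0
  then show ?case by simp
next
  case (Suc m)
  define w where "w = (\<lambda>i. c *\<^sub>R u i + d *\<^sub>R v i)"
  define T where "T z j = row_per m (C - {j}) (set_col p z a) * set_col p z a (m, j)" for z j
  have T: "T w j = c *\<^sub>R T u j + d *\<^sub>R T v j" if j: "j \<in> C" for j
  proof (cases "j = p")
    case True
    have "row_per m (C - {p}) (set_col p z a) = row_per m (C - {p}) a" for z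
      by (rule row_per_cong) (auto simp: set_col_def)
    then show ?thesis
      by (simp add: T_def True set_col_def w_def distrib_left)
  next
    case False
    have "row_per m (C - {j}) (set_col p w a)
       = c *\<^sub>R row_per m (C - {j}) (set_col p u a) + d *\<^sub>R row_per m (C - {j}) (set_col p v a)"
      unfolding w_def by (rule Suc.IH) (use Suc.prems j False in auto)
    then show ?thesis using False
      by (simp add: T_def set_col_def distrib_right)
  qed
  have "row_per (Suc m) C (set_col p z a) = (\<Sum>j\<in>C. T z j)" for z by (simp add: T_def)
  then show ?case
    using T unfolding w_def [symmetric] by (simp add: sum.distrib scaleR_sum_right)
qed

text \<open>With \<open>\<pi>\<close> the transposition of two members of \<open>C\<close> this is the symmetry of the permanent under exchange of two
columns.\<close>

lemma row_per_relabel: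
  assumes "inj_on \<pi> C"
  shows "row_per m C (\<lambda>(i, j). a (i, \<pi> j)) = row_per m (\<pi> ` C) a"
  using assms
proof (induction m arbitrary: C)
  case (Suc m)
  have "row_per m (C - {j}) (\<lambda>(i, j). a (i, \<pi> j)) = row_per m (\<pi> ` C - {\<pi> j}) a" if "j \<in> C" for j
  proof -
    have "\<pi> ` (C - {j}) = \<pi> ` C - {\<pi> j}"
      using Suc.prems that by (auto simp: inj_on_def)
    moreover have "inj_on \<pi> (C - {j})" using Suc.prems by (rule inj_on_diff)
    ultimately show ?thesis using Suc.IH by simp
  qed
  then show ?case using Suc.prems by (simp add: sum.reindex)
qed simp

lemma measurable_row_per:
  assumes "finite C" "\<And>i j. i < m \<Longrightarrow> j \<in> C \<Longrightarrow> (\<lambda>x. A x (i, j)) \<in> borel_measurable M"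
  shows "(\<lambda>x. row_per m C (A x)) \<in> borel_measurable M"
  using assms
proof (induction m arbitrary: C)
  case (Suc m)
  then show ?case
    by (auto intro!: borel_measurable_sum borel_measurable_times)
qed simp

lemma measurable_last_row_per:
  assumes "finite C" "\<And>i j. i < m \<Longrightarrow> j \<in> C \<Longrightarrow> (\<lambda>x. A x (i, j)) \<in> borel_measurable M"
    "\<And>j. j \<in> C \<Longrightarrow> (\<lambda>x. X x j) \<in> borel_measurable M"
  shows "(\<lambda>x. last_row_per m C (X x) (A x)) \<in> borel_measurable M"
  unfolding last_row_per_def using assms
  by (auto intro!: borel_measurable_sum borel_measurable_times measurable_row_per)


section \<open>Gaussian matrices\<close>

definition qginibre :: "nat \<Rightarrow> nat set \<Rightarrow> (nat \<times> nat \<Rightarrow> quat) measure" where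
  "qginibre m C = PiM ({..<m} \<times> C) (\<lambda>_. qgauss)"

abbreviation qvec :: "nat set \<Rightarrow> (nat \<Rightarrow> quat) measure" where
  "qvec I \<equiv> PiM I (\<lambda>_. qgauss)"

lemma product_sigma_finite_qgauss: "product_sigma_finite (\<lambda>_. qgauss)"
  by (intro product_sigma_finite.intro prob_space_imp_sigma_finite prob_space_qgauss)

lemma prob_space_qvec: "prob_space (PiM I (\<lambda>_. qgauss))"
  by (intro prob_space_PiM prob_space_qgauss)

lemma prob_space_qginibre: "prob_space (qginibre m C)"
  unfolding qginibre_def by (rule prob_space_qvec)

lemma measurable_qginibre_entry:
  "i < m \<Longrightarrow> j \<in> C \<Longrightarrow> f \<in> measurable M (qginibre m C) \<Longrightarrow> (\<lambda>x. f x (i, j)) \<in> borel_measurable M"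
  unfolding qginibre_def
  using measurable_compose [OF _ measurable_component_singleton [of "(i, j)" "{..<m} \<times> C" "\<lambda>_. qgauss"], of f M]
  by (simp cong: measurable_cong_sets)

lemma measurable_qvec_entry:
  "i \<in> I \<Longrightarrow> f \<in> measurable M (qvec I) \<Longrightarrow> (\<lambda>x. f x i) \<in> borel_measurable M"
  using measurable_compose [OF _ measurable_component_singleton [of i I "\<lambda>_. qgauss"], of f M]
  by (simp cong: measurable_cong_sets)

lemma integral_qvec_reindex:
  fixes f :: "_ \<Rightarrow> _ :: {banach, second_countable_topology}"
  assumes "inj_on \<pi> I" "\<pi> ` I \<subseteq> K" "f \<in> borel_measurable (PiM I (\<lambda>_. qgauss))"
  shows "(\<integral>y. f y \<partial>PiM I (\<lambda>_. qgauss)) = (\<integral>x. f (\<lambda>n\<in>I. x (\<pi> n)) \<partial>PiM K (\<lambda>_. qgauss))"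
proof -
  have "PiM I (\<lambda>_. qgauss) = distr (PiM K (\<lambda>_. qgauss)) (PiM I (\<lambda>_. qgauss)) (\<lambda>x. \<lambda>n\<in>I. x (\<pi> n))"
    by (rule distr_PiM_reindex [symmetric]) (use assms in \<open>auto simp: prob_space_qgauss\<close>)
  then have "(\<integral>y. f y \<partial>PiM I (\<lambda>_. qgauss))
    = (\<integral>y. f y \<partial>distr (PiM K (\<lambda>_. qgauss)) (PiM I (\<lambda>_. qgauss)) (\<lambda>x. \<lambda>n\<in>I. x (\<pi> n)))"
    by simp
  also have "\<dots> = (\<integral>x. f (\<lambda>n\<in>I. x (\<pi> n)) \<partial>PiM K (\<lambda>_. qgauss))"
    using assms by (intro integral_distr measurable_restrict measurable_component_singleton) auto
  finally show ?thesis .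
qed

lemma integral_split_col:
  fixes f :: "_ \<Rightarrow> _ :: {banach, second_countable_topology}"
  assumes C: "finite C" "p \<notin> C" and f: "integrable (qginibre m (insert p C)) f"
  shows "(\<integral>a. f a \<partial>qginibre m (insert p C)) = (\<integral>a. \<integral>u. f (set_col p u a) \<partial>qvec {..<m} \<partial>qginibre m C)"
proof -
  let ?I = "{..<m} \<times> C" and ?J = "{..<m} \<times> {p}"
  have U: "{..<m} \<times> insert p C = ?I \<union> ?J" by auto
  have "(\<integral>a. f a \<partial>qginibre m (insert p C)) = (\<integral>a. \<integral>y. f (merge ?I ?J (a, y)) \<partial>PiM ?J (\<lambda>_. qgauss) \<partial>PiM ?I (\<lambda>_. qgauss))"
    using C f unfolding qginibre_def U by (intro product_sigma_finite.product_integral_fold [OF product_sigma_finite_qgauss]) auto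
  also have "\<dots> = (\<integral>a. \<integral>u. f (set_col p u a) \<partial>qvec {..<m} \<partial>PiM ?I (\<lambda>_. qgauss))"
  proof (rule Bochner_Integration.integral_cong [OF refl])
    fix a assume a: "a \<in> space (PiM ?I (\<lambda>_. qgauss))"
    have fm: "f \<in> borel_measurable (PiM (?I \<union> ?J) (\<lambda>_. qgauss))"
      using f unfolding qginibre_def U by auto
    have "(\<integral>y. f (merge ?I ?J (a, y)) \<partial>PiM ?J (\<lambda>_. qgauss))
      = (\<integral>u. f (merge ?I ?J (a, \<lambda>n\<in>?J. u (fst n))) \<partial>qvec {..<m})"
    proof (rule integral_qvec_reindex)
      have "(\<lambda>y. merge ?I ?J (a, y)) \<in> measurable (PiM ?J (\<lambda>_. qgauss)) (PiM (?I \<union> ?J) (\<lambda>_. qgauss))"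
        using a by measurable
      from measurable_compose [OF this fm]
      show "(\<lambda>y. f (merge ?I ?J (a, y))) \<in> borel_measurable (PiM ?J (\<lambda>_. qgauss))" .
    qed (auto simp: inj_on_def)
    also have "\<dots> = (\<integral>u. f (set_col p u a) \<partial>qvec {..<m})"
    proof (rule Bochner_Integration.integral_cong [OF refl])
      fix u assume "u \<in> space (qvec {..<m})"
      then have "merge ?I ?J (a, \<lambda>n\<in>?J. u (fst n)) = set_col p u a"
        using a C by (auto simp: merge_def set_col_def fun_eq_iff space_PiM PiE_def extensional_def)
      then show "f (merge ?I ?J (a, \<lambda>n\<in>?J. u (fst n))) = f (set_col p u a)" by simp
    qed
    finally show "(\<integral>y. f (merge ?I ?J (a, y)) \<partial>PiM ?J (\<lambda>_. qgauss)) = (\<integral>u. f (set_col p u a) \<partial>qvec {..<m})" .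
  qed
  finally show ?thesis by (simp add: qginibre_def)
qed

lemma integral_split_row:
  fixes f :: "_ \<Rightarrow> _ :: {banach, second_countable_topology}"
  assumes C: "finite C" and f: "integrable (qginibre (Suc m) C) f"
  shows "(\<integral>a. f a \<partial>qginibre (Suc m) C) = (\<integral>x. \<integral>a. f (set_row m x a) \<partial>qginibre m C \<partial>qvec C)"
proof -
  let ?J = "{..<m} \<times> C" and ?I = "{m} \<times> C"
  have U: "{..<Suc m} \<times> C = ?I \<union> ?J" by auto
  have fm: "f \<in> borel_measurable (PiM (?I \<union> ?J) (\<lambda>_. qgauss))"
    using f unfolding qginibre_def U by auto
  have "(\<integral>a. f a \<partial>qginibre (Suc m) C) = (\<integral>y. \<integral>a. f (merge ?I ?J (y, a)) \<partial>PiM ?J (\<lambda>_. qgauss) \<partial>PiM ?I (\<lambda>_. qgauss))"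
    using C f unfolding qginibre_def U by (intro product_sigma_finite.product_integral_fold [OF product_sigma_finite_qgauss]) auto
  also have "\<dots> = (\<integral>x. \<integral>a. f (merge ?I ?J (\<lambda>n\<in>?I. x (snd n), a)) \<partial>PiM ?J (\<lambda>_. qgauss) \<partial>qvec C)"
  proof (rule integral_qvec_reindex)
    interpret J: prob_space "PiM ?J (\<lambda>_. qgauss)" by (rule prob_space_qvec)
    have "(\<lambda>z. f (merge ?I ?J z)) \<in> borel_measurable (PiM ?I (\<lambda>_. qgauss) \<Otimes>\<^sub>M PiM ?J (\<lambda>_. qgauss))"
      by (rule measurable_compose [OF measurable_merge fm])
    then show "(\<lambda>y. \<integral>a. f (merge ?I ?J (y, a)) \<partial>PiM ?J (\<lambda>_. qgauss)) \<in> borel_measurable (PiM ?I (\<lambda>_. qgauss))"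
      by (intro J.borel_measurable_lebesgue_integral) (simp add: case_prod_beta')
  qed (auto simp: inj_on_def)
  also have "\<dots> = (\<integral>x. \<integral>a. f (set_row m x a) \<partial>PiM ?J (\<lambda>_. qgauss) \<partial>qvec C)"
  proof (intro Bochner_Integration.integral_cong refl)
    fix x a assume "x \<in> space (qvec C)" "a \<in> space (PiM ?J (\<lambda>_. qgauss))"
    then have "merge ?I ?J (\<lambda>n\<in>?I. x (snd n), a) = set_row m x a"
      by (auto simp: merge_def set_row_def fun_eq_iff space_PiM PiE_def extensional_def)
    then show "f (merge ?I ?J (\<lambda>n\<in>?I. x (snd n), a)) = f (set_row m x a)" by simp
  qed
  finally show ?thesis by (simp add: qginibre_def)
qed


text \<open>A point of the product space is extensional, and \<open>set_col\<close> respects this: a column drawn from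
\<open>qvec {..<m}\<close> is \<open>undefined\<close> outside its rows.\<close>

lemma measurable_set_col:
  assumes f: "f \<in> measurable N (qvec {..<m})" and h: "h \<in> measurable N (qginibre m C)"
  shows "(\<lambda>z. set_col p (f z) (h z)) \<in> measurable N (qginibre m (insert p C))"
proof -
  let ?I = "{..<m} \<times> insert p C"
  have "(\<lambda>z. \<lambda>ij\<in>?I. set_col p (f z) (h z) ij) \<in> measurable N (PiM ?I (\<lambda>_. qgauss))"
  proof (rule measurable_restrict)
    fix ij assume "ij \<in> ?I"
    then show "(\<lambda>z. set_col p (f z) (h z) ij) \<in> measurable N qgauss"
      using measurable_qvec_entry [OF _ f] measurable_qginibre_entry [OF _ _ h]
      by (auto simp: set_col_def cong: measurable_cong_sets)
  qed
  also have "?this \<longleftrightarrow> (\<lambda>z. set_col p (f z) (h z)) \<in> measurable N (PiM ?I (\<lambda>_. qgauss))"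
  proof (rule measurable_cong)
    fix z assume "z \<in> space N"
    then have "f z \<in> space (qvec {..<m})" "h z \<in> space (qginibre m C)"
      using f h by (auto dest: measurable_space)
    then show "(\<lambda>ij\<in>?I. set_col p (f z) (h z) ij) = set_col p (f z) (h z)"
      by (auto simp: fun_eq_iff set_col_def qginibre_def space_PiM PiE_def extensional_def)
  qed
  finally show ?thesis by (simp add: qginibre_def)
qed

lemma integral_split_two_cols:
  fixes f :: "_ \<Rightarrow> _ :: {banach, second_countable_topology}"
  assumes C: "finite C" "p \<in> C" "q \<in> C" "p \<noteq> q"
    and f: "f \<in> borel_measurable (qginibre m C)" "\<And>a. norm (f a) \<le> 1"
  shows "(\<integral>a. f a \<partial>qginibre m C) = (\<integral>a. \<integral>c. f (set_col p (fst c) (set_col q (snd c) a))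
     \<partial>(qvec {..<m} \<Otimes>\<^sub>M qvec {..<m}) \<partial>qginibre m (C - {p, q}))"
proof -
  let ?\<nu> = "qvec {..<m}"
  define D where "D = C - {p, q}"
  have CD: "C = insert p (insert q D)" "p \<notin> insert q D" "q \<notin> D" "finite (insert q D)" "finite D"
    using C by (auto simp: D_def)
  interpret G: prob_space "qginibre m C" by (rule prob_space_qginibre)
  interpret G1: prob_space "qginibre m (insert q D)" by (rule prob_space_qginibre)
  interpret v: prob_space ?\<nu> by (rule prob_space_qvec)
  interpret vv: pair_prob_space ?\<nu> ?\<nu> ..
  have f1: "f \<in> borel_measurable (qginibre m (insert p (insert q D)))" using f(1) CD(1) by simp
  have int: "integrable (qginibre m (insert p (insert q D))) f"
    unfolding CD(1) [symmetric] by (rule G.integrable_const_bound [where B = 1]) (auto simp: f)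
  have "(\<integral>a. f a \<partial>qginibre m C) = (\<integral>a. (\<integral>u. f (set_col p u a) \<partial>?\<nu>) \<partial>qginibre m (insert q D))"
    by (subst CD(1)) (rule integral_split_col [OF CD(4) CD(2) int])
  also have "\<dots> = (\<integral>a. (\<integral>v. (\<integral>u. f (set_col p u (set_col q v a)) \<partial>?\<nu>) \<partial>?\<nu>) \<partial>qginibre m D)"
  proof (rule integral_split_col [OF CD(5) CD(3)], rule G1.integrable_const_bound [where B = 1])
    have "norm (\<integral>u. f (set_col p u a) \<partial>?\<nu>) \<le> (\<integral>u. norm (f (set_col p u a)) \<partial>?\<nu>)" for a
      by (rule integral_norm_bound)
    moreover have "(\<integral>u. norm (f (set_col p u a)) \<partial>?\<nu>) \<le> 1" for a
      by (cases "integrable ?\<nu> (\<lambda>u. norm (f (set_col p u a)))")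
        (auto intro!: v.integral_le_const f(2) simp: not_integrable_integral_eq)
    ultimately show "AE a in qginibre m (insert q D). norm (\<integral>u. f (set_col p u a) \<partial>?\<nu>) \<le> 1"
      by (intro AE_I2) (rule order_trans)
    have "(\<lambda>z. f (set_col p (snd z) (fst z))) \<in> borel_measurable (qginibre m (insert q D) \<Otimes>\<^sub>M ?\<nu>)"
      by (rule measurable_compose [OF measurable_set_col f1]) measurable
    then show "(\<lambda>a. \<integral>u. f (set_col p u a) \<partial>?\<nu>) \<in> borel_measurable (qginibre m (insert q D))"
      by (intro v.borel_measurable_lebesgue_integral) (simp add: case_prod_beta')
  qed
  also have "\<dots> = (\<integral>a. (\<integral>c. f (set_col p (fst c) (set_col q (snd c) a)) \<partial>(?\<nu> \<Otimes>\<^sub>M ?\<nu>)) \<partial>qginibre m D)"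
  proof (intro Bochner_Integration.integral_cong refl)
    fix a assume a: "a \<in> space (qginibre m D)"
    have "(\<lambda>c. f (set_col p (fst c) (set_col q (snd c) a))) \<in> borel_measurable (?\<nu> \<Otimes>\<^sub>M ?\<nu>)"
      by (rule measurable_compose [OF measurable_set_col [OF _ measurable_set_col] f1]) (use a in measurable)
    then have "integrable (?\<nu> \<Otimes>\<^sub>M ?\<nu>) (\<lambda>(u, v). f (set_col p u (set_col q v a)))"
      by (intro vv.P.integrable_const_bound [where B = 1]) (auto simp: f case_prod_beta')
    from vv.integral_snd [OF this]
    show "(\<integral>v. (\<integral>u. f (set_col p u (set_col q v a)) \<partial>?\<nu>) \<partial>?\<nu>) = (\<integral>c. f (set_col p (fst c) (set_col q (snd c) a)) \<partial>(?\<nu> \<Otimes>\<^sub>M ?\<nu>))"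
      by (simp add: case_prod_beta')
  qed
  finally show ?thesis by (simp add: D_def)
qed


section \<open>The Laplace transform of the permanent\<close>

text \<open>The merging of two entries of the last row \<open>x\<close>, for a fixed test quaternion \<open>w\<close> and fixed remaining columns.
The terms of the expansion along the last row are sorted according to the column that it uses: column \<open>p\<close>
leaves a minor that depends on the column \<open>v\<close> at \<open>q\<close> only, column \<open>q\<close> one that depends on the column \<open>u\<close> at
\<open>p\<close> only, and by exchange of columns both minors are values of the same map \<open>\<Lambda>\<close>. The other terms form \<open>B\<close>.\<close>

lemma last_row_per_interpolation_pointwise:
  fixes w :: quat and k :: real
  assumes C: "finite C" "card C = Suc m" "p \<in> C" "q \<in> C" "p \<noteq> q"
    and t: "0 < t" "t < 1" and xp: "x p = sqrt t *\<^sub>R y" and xq: "x q = sqrt (1 - t) *\<^sub>R z"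
    and J: "\<And>x. J x = (\<integral>c. iexp (k * inner w (last_row_per m C x (set_col p (fst c) (set_col q (snd c) a))))
              \<partial>(qvec {..<m} \<Otimes>\<^sub>M qvec {..<m}))"
  shows "Re (J x) \<le> t * Re (J (x(p := y, q := 0))) + (1 - t) * Re (J (x(p := 0, q := z)))"
proof -
  let ?\<nu> = "qvec {..<m}"
  define comb where "comb = (\<lambda>c u d v. \<lambda>i\<in>{..<m}. c *\<^sub>R u i + d *\<^sub>R (v i :: quat))"
  define D where "D = C - {p, q}"
  define \<Lambda> where "\<Lambda> u = row_per m (C - {p}) (set_col q u a)" for u
  define L where "L y u = k * inner w (\<Lambda> u * y)" for y u
  define R where "R j u v = row_per m (C - {j}) (set_col p u (set_col q v a))" for j u v
  define B where "B u v = k * inner w (\<Sum>j\<in>D. R j u v * x j)" for u v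
  have cardp: "card (C - {j}) = m" if "j \<in> C" for j using C that by simp
  have transp: "Transposition.transpose p q ` (C - {j}) = C - {j}" "Transposition.transpose p q ` (C - {q}) = C - {p}" if "j \<in> D" for j
    using C that by (auto simp: D_def Transposition.transpose_def image_iff split: if_splits)
  have transq: "Transposition.transpose p q ` (C - {q}) = C - {p}"
  proof -
    have "Transposition.transpose p q ` C = C" using C by (auto simp: Transposition.transpose_def image_iff)
    then show ?thesis using C by (subst image_set_diff) (auto simp: Transposition.transpose_def)
  qed
  have R_q: "R q u v = \<Lambda> u" for u v
  proof -
    have "R q u v = row_per m (C - {q}) (\<lambda>(i, j). set_col q u a (i, Transposition.transpose p q j))"
      unfolding R_def using C by (intro row_per_cong) (auto simp: set_col_def Transposition.transpose_def)
    also have "\<dots> = \<Lambda> u"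
      unfolding \<Lambda>_def transq [symmetric] by (rule row_per_relabel) (rule inj_on_transpose)
    finally show ?thesis .
  qed
  have R_p: "R p u v = \<Lambda> v" for u v
    unfolding R_def \<Lambda>_def by (rule row_per_cong) (auto simp: set_col_def)
  have R_sym: "R j u v = R j v u" if "j \<in> D" for j u v
  proof -
    have "R j u v = row_per m (C - {j}) (\<lambda>(i, n). set_col p v (set_col q u a) (i, Transposition.transpose p q n))"
      unfolding R_def using C by (intro row_per_cong) (auto simp: set_col_def Transposition.transpose_def)
    also have "\<dots> = row_per m (Transposition.transpose p q ` (C - {j})) (set_col p v (set_col q u a))"
      by (rule row_per_relabel) (rule inj_on_transpose)
    finally show ?thesis using transp that by (simp add: R_def)
  qed
  have R_lin: "R j (comb c u d v) v' = c *\<^sub>R R j u v' + d *\<^sub>R R j v v'" if "j \<in> D" for j c u d v v'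
  proof -
    have "R j (comb c u d v) v' = row_per m (C - {j}) (set_col p (\<lambda>i. c *\<^sub>R u i + d *\<^sub>R v i) (set_col q v' a))"
      unfolding R_def by (rule row_per_cong) (auto simp: set_col_def comb_def)
    also have "\<dots> = c *\<^sub>R R j u v' + d *\<^sub>R R j v v'"
      unfolding R_def using that C by (intro row_per_linear_col cardp) (auto simp: D_def)
    finally show ?thesis .
  qed
  have \<Lambda>_lin: "\<Lambda> (comb c u d v) = c *\<^sub>R \<Lambda> u + d *\<^sub>R \<Lambda> v" for c u d v
  proof -
    have "\<Lambda> (comb c u d v) = row_per m (C - {p}) (set_col q (\<lambda>i. c *\<^sub>R u i + d *\<^sub>R v i) a)"
      unfolding \<Lambda>_def by (rule row_per_cong) (auto simp: set_col_def comb_def)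
    also have "\<dots> = c *\<^sub>R \<Lambda> u + d *\<^sub>R \<Lambda> v"
      unfolding \<Lambda>_def using C by (intro row_per_linear_col cardp) auto
    finally show ?thesis .
  qed
  have R_meas: "(\<lambda>z. R j (fst z) (snd z)) \<in> borel_measurable (?\<nu> \<Otimes>\<^sub>M ?\<nu>)" for j
    unfolding R_def
  proof (rule measurable_row_per)
    fix i l assume i: "i < m"
    show "(\<lambda>z. set_col p (fst z) (set_col q (snd z) a) (i, l)) \<in> borel_measurable (?\<nu> \<Otimes>\<^sub>M ?\<nu>)"
      using i by (cases "l = p"; cases "l = q") (auto simp: set_col_def)
  qed (use C in simp)
  have \<Lambda>_meas: "\<Lambda> \<in> borel_measurable ?\<nu>"
    unfolding \<Lambda>_def
  proof (rule measurable_row_per)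
    fix i l assume i: "i < m"
    show "(\<lambda>u. set_col q u a (i, l)) \<in> borel_measurable ?\<nu>"
      using i by (cases "l = q")
        (auto simp: set_col_def intro!: measurable_qvec_entry [OF _ measurable_ident_sets [OF refl]])
  qed (use C in simp)
  interpret two_columns ?\<nu> comb B
  proof
    show "rot_inv ?\<nu> comb"
      unfolding comb_def by (rule rot_inv_PiM [OF _ rot_inv_qgauss]) simp
    show "(\<lambda>z. B (fst z) (snd z)) \<in> borel_measurable (?\<nu> \<Otimes>\<^sub>M ?\<nu>)"
      unfolding B_def using R_meas by simp
    show "B u v = B v u" for u v
      unfolding B_def by (simp add: R_sym cong: sum.cong_simp)
    show "B (comb c u d v) v' = c * B u v' + d * B v v'" for c d u v v'
      unfolding B_def
      by (simp add: R_lin inner_sum_right inner_add_right distrib_right sum.distrib sum_distrib_left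
          algebra_simps cong: sum.cong_simp)
  qed
  have L_lin: "linear_fun (L y)" for y
    unfolding linear_fun_def L_def using \<Lambda>_meas
    by (auto simp: \<Lambda>_lin distrib_right inner_add_right algebra_simps)
  have expand: "k * inner w (last_row_per m C X (set_col p u (set_col q v a))) = B u v + L (X q) u + L (X p) v"
    if X: "\<And>j. j \<in> D \<Longrightarrow> X j = x j" for X u v
  proof -
    have "last_row_per m C X (set_col p u (set_col q v a)) = (\<Sum>j\<in>C. R j u v * X j)"
      by (simp add: last_row_per_def R_def)
    also have "\<dots> = (\<Sum>j\<in>insert p (insert q D). R j u v * X j)"
      by (rule sum.cong) (use C in \<open>auto simp: D_def\<close>)
    also have "\<dots> = \<Lambda> v * X p + (\<Lambda> u * X q + (\<Sum>j\<in>D. R j u v * x j))"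
      using C X by (subst sum.insert, simp add: D_def, simp add: D_def, subst sum.insert)
        (auto simp: D_def R_p R_q)
    finally show ?thesis by (simp add: B_def L_def inner_add_right algebra_simps)
  qed
  have J_\<Phi>: "J X = \<Phi> (L (X q)) (L (X p))" if "\<And>j. j \<in> D \<Longrightarrow> X j = x j" for X
    unfolding J \<Phi>_def by (simp add: expand [OF that])
  have L0: "L 0 = (\<lambda>_. 0)" by (simp add: L_def fun_eq_iff)
  have Ls: "L (c *\<^sub>R y) = (\<lambda>u. c * L y u)" for c y by (simp add: L_def fun_eq_iff)
  have "Re (J x) = Re (\<Phi> (\<lambda>u. sqrt (1 - t) * L z u) (\<lambda>u. sqrt t * L y u))"
    by (simp add: J_\<Phi> xp xq Ls)
  also have "\<dots> \<le> (1 - t) * Re (\<Phi> (L z) (\<lambda>_. 0)) + t * Re (\<Phi> (\<lambda>_. 0) (L y))"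
    by (rule \<Phi>_interpolation [OF L_lin L_lin t])
  also have "\<Phi> (L z) (\<lambda>_. 0) = J (x(p := 0, q := z))"
    using C by (subst J_\<Phi>) (auto simp: D_def L0)
  also have "\<Phi> (\<lambda>_. 0) (L y) = J (x(p := y, q := 0))"
    using C by (subst J_\<Phi>) (auto simp: D_def L0)
  finally show ?thesis by (simp only: add.commute)
qed

definition last_row_per_laplace :: "nat \<Rightarrow> nat set \<Rightarrow> real \<Rightarrow> (nat \<Rightarrow> quat) \<Rightarrow> real" where
  "last_row_per_laplace m C s x = (\<integral>a. exp (- s * (norm (last_row_per m C x a))\<^sup>2) \<partial>qginibre m C)"

lemma measurable_last_row_per_qginibre:
  assumes "finite C" "f \<in> measurable N (qginibre m C)"
  shows "(\<lambda>z. last_row_per m C x (f z)) \<in> borel_measurable N"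
proof (rule measurable_last_row_per [OF assms(1)])
  show "(\<lambda>z. f z (i, j)) \<in> borel_measurable N" if "i < m" "j \<in> C" for i j
    using that assms(2) by (rule measurable_qginibre_entry)
qed simp

lemma measurable_last_row_per_set_cols:
  assumes C: "finite C" "p \<in> C" "q \<in> C"
    and f: "f \<in> measurable N (qvec {..<m})" and g: "g \<in> measurable N (qvec {..<m})"
    and h: "h \<in> measurable N (qginibre m (C - {p, q}))"
  shows "(\<lambda>z. last_row_per m C x (set_col p (f z) (set_col q (g z) (h z)))) \<in> borel_measurable N"
proof (rule measurable_last_row_per_qginibre [OF C(1)])
  have "insert p (insert q (C - {p, q})) = C" using C by auto
  then show "(\<lambda>z. set_col p (f z) (set_col q (g z) (h z))) \<in> measurable N (qginibre m C)"
    using measurable_set_col [OF f measurable_set_col [OF g h], of p q] by simp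
qed

text \<open>The factor \<open>\<surd>(8 s)\<close> makes the characteristic function of \<^const>\<open>qgauss\<close> at the permanent equal to
\<open>exp (- s |per|\<^sup>2)\<close>.\<close>

lemma last_row_per_laplace_as_char:
  assumes C: "finite C" "p \<in> C" "q \<in> C" "p \<noteq> q" and s: "0 \<le> s"
  shows "complex_of_real (last_row_per_laplace m C s x) =
    (\<integral>y. \<integral>c. iexp (sqrt (8 * s) * inner (fst y) (last_row_per m C x (set_col p (fst c) (set_col q (snd c) (snd y)))))
       \<partial>(qvec {..<m} \<Otimes>\<^sub>M qvec {..<m}) \<partial>(qgauss \<Otimes>\<^sub>M qginibre m (C - {p, q})))"
proof -
  define k where "k = sqrt (8 * s)"
  have k: "k\<^sup>2 = 8 * s" using s by (simp add: k_def)
  let ?\<nu> = "qvec {..<m}"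
  define D where "D = C - {p, q}"
  interpret q: prob_space qgauss by (rule prob_space_qgauss)
  interpret G: prob_space "qginibre m C" by (rule prob_space_qginibre)
  interpret G2: prob_space "qginibre m D" by (rule prob_space_qginibre)
  interpret v: prob_space ?\<nu> by (rule prob_space_qvec)
  interpret qG: pair_prob_space "qginibre m C" qgauss ..
  interpret qG2: pair_prob_space qgauss "qginibre m D" ..
  interpret vv: pair_prob_space ?\<nu> ?\<nu> ..
  define f where "f w a = iexp (k * inner w (last_row_per m C x a))" for w a
  have fn: "norm (f w a) \<le> 1" for w a by (simp add: f_def)
  have m0: "(\<lambda>z. last_row_per m C x (snd z)) \<in> borel_measurable (qgauss \<Otimes>\<^sub>M qginibre m C)"
       "(\<lambda>z. last_row_per m C x (fst z)) \<in> borel_measurable (qginibre m C \<Otimes>\<^sub>M qgauss)"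
       "(\<lambda>z. last_row_per m C x z) \<in> borel_measurable (qginibre m C)"
    by (rule measurable_last_row_per_qginibre [OF C(1) measurable_snd] measurable_last_row_per_qginibre [OF C(1) measurable_fst]
        measurable_last_row_per_qginibre [OF C(1) measurable_ident_sets [OF refl]])+
  note [measurable] = m0
    measurable_last_row_per_set_cols [OF C(1-3), of _ _ m _ _ x, folded D_def]
  have "complex_of_real (last_row_per_laplace m C s x) = (\<integral>a. complex_of_real (exp (- s * (norm (last_row_per m C x a))\<^sup>2)) \<partial>qginibre m C)"
    unfolding last_row_per_laplace_def by (rule integral_complex_of_real [symmetric])
  also have "\<dots> = (\<integral>a. (\<integral>w. f w a \<partial>qgauss) \<partial>qginibre m C)"
    unfolding f_def char_qgauss by (simp add: k)
  also have "\<dots> = (\<integral>w. (\<integral>a. f w a \<partial>qginibre m C) \<partial>qgauss)"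
    by (rule qG.Fubini_integral [symmetric], rule qG.P.integrable_const_bound [where B = 1])
      (auto simp: fn f_def case_prod_beta')
  also have "\<dots> = (\<integral>w. (\<integral>a. (\<integral>c. f w (set_col p (fst c) (set_col q (snd c) a)) \<partial>(?\<nu> \<Otimes>\<^sub>M ?\<nu>)) \<partial>qginibre m D) \<partial>qgauss)"
    unfolding D_def
    by (intro Bochner_Integration.integral_cong refl integral_split_two_cols C fn) (auto simp: f_def [abs_def])
  also have "\<dots> = (\<integral>y. (\<integral>c. f (fst y) (set_col p (fst c) (set_col q (snd c) (snd y))) \<partial>(?\<nu> \<Otimes>\<^sub>M ?\<nu>)) \<partial>(qgauss \<Otimes>\<^sub>M qginibre m D))"
  proof (subst qG2.integral_fst' [symmetric])
    show "integrable (qgauss \<Otimes>\<^sub>M qginibre m D) (\<lambda>y. \<integral>c. f (fst y) (set_col p (fst c) (set_col q (snd c) (snd y))) \<partial>(?\<nu> \<Otimes>\<^sub>M ?\<nu>))"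
    proof (rule qG2.P.integrable_const_bound [where B = 1])
      show "AE y in qgauss \<Otimes>\<^sub>M qginibre m D. norm (\<integral>c. f (fst y) (set_col p (fst c) (set_col q (snd c) (snd y))) \<partial>(?\<nu> \<Otimes>\<^sub>M ?\<nu>)) \<le> 1"
        by (intro AE_I2 order_trans [OF integral_norm_bound]) (simp add: f_def vv.P.prob_space)
      show "(\<lambda>y. \<integral>c. f (fst y) (set_col p (fst c) (set_col q (snd c) (snd y))) \<partial>(?\<nu> \<Otimes>\<^sub>M ?\<nu>)) \<in> borel_measurable (qgauss \<Otimes>\<^sub>M qginibre m D)"
        unfolding f_def by measurable
    qed
  qed simp
  finally show ?thesis by (simp add: f_def D_def k_def)
qed


text \<open>If \<open>y\<close> and \<open>z\<close> both have norm \<open>r\<close>, then \<open>r\<^sup>2 = |x p|\<^sup>2 + |x q|\<^sup>2\<close>, so that both rows on the right have the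
norm of \<open>x\<close> and one more zero entry.\<close>

lemma last_row_per_laplace_interpolation:
  assumes C: "finite C" "card C = Suc m" "p \<in> C" "q \<in> C" "p \<noteq> q" and s: "0 \<le> s"
    and t: "0 < t" "t < 1" and x: "x p = sqrt t *\<^sub>R y" "x q = sqrt (1 - t) *\<^sub>R z"
  shows "last_row_per_laplace m C s x \<le>
    t * last_row_per_laplace m C s (x(p := y, q := 0)) + (1 - t) * last_row_per_laplace m C s (x(p := 0, q := z))"
proof -
  let ?\<nu> = "qvec {..<m}"
  let ?W = "qgauss \<Otimes>\<^sub>M qginibre m (C - {p, q})"
  define J where "J x y = (\<integral>c. iexp (sqrt (8 * s) * inner (fst y)
      (last_row_per m C x (set_col p (fst c) (set_col q (snd c) (snd y))))) \<partial>(?\<nu> \<Otimes>\<^sub>M ?\<nu>))" for x y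
  interpret q: prob_space qgauss by (rule prob_space_qgauss)
  interpret G: prob_space "qginibre m (C - {p, q})" by (rule prob_space_qginibre)
  interpret v: prob_space ?\<nu> by (rule prob_space_qvec)
  interpret qG: pair_prob_space qgauss "qginibre m (C - {p, q})" ..
  interpret vv: pair_prob_space ?\<nu> ?\<nu> ..
  note [measurable] = measurable_last_row_per_set_cols [OF C(1,3,4), of _ _ m _ _]
  have J: "integrable ?W (J x)" for x
  proof (rule qG.P.integrable_const_bound [where B = 1])
    show "AE y in ?W. norm (J x y) \<le> 1"
      unfolding J_def by (intro AE_I2 order_trans [OF integral_norm_bound]) (simp add: vv.P.prob_space)
    show "J x \<in> borel_measurable ?W"
      unfolding J_def [abs_def] by measurable
  qed
  have F: "last_row_per_laplace m C s x = (\<integral>y. Re (J x y) \<partial>?W)" for x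
  proof -
    have "complex_of_real (last_row_per_laplace m C s x) = (\<integral>y. J x y \<partial>?W)"
      unfolding J_def by (rule last_row_per_laplace_as_char) (use C s in auto)
    then have "last_row_per_laplace m C s x = Re (\<integral>y. J x y \<partial>?W)" by (metis Re_complex_of_real)
    then show ?thesis using integral_Re [OF J] by simp
  qed
  have "last_row_per_laplace m C s x \<le> (\<integral>y'. t * Re (J (x(p := y, q := 0)) y') + (1 - t) * Re (J (x(p := 0, q := z)) y') \<partial>?W)"
    unfolding F [of x]
  proof (rule integral_mono)
    fix w
    show "Re (J x w) \<le> t * Re (J (x(p := y, q := 0)) w) + (1 - t) * Re (J (x(p := 0, q := z)) w)"
      by (rule last_row_per_interpolation_pointwise [where J = "\<lambda>x. J x w", OF C t x]) (simp add: J_def)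
  qed (auto intro!: integrable_add integrable_mult_right integrable_Re J)
  also have "\<dots> = t * last_row_per_laplace m C s (x(p := y, q := 0)) + (1 - t) * last_row_per_laplace m C s (x(p := 0, q := z))"
    unfolding F by (subst Bochner_Integration.integral_add) (auto intro!: integrable_mult_right integrable_Re J)
  finally show ?thesis .
qed

text \<open>By induction on the number of nonzero entries of \<open>x\<close>. With at most one nonzero entry, say in column \<open>p\<close>,
the permanent is a permanent of order \<open>m\<close> times \<open>x p\<close>, and the column \<open>p\<close> can be integrated out.\<close>

lemma last_row_per_laplace_le:
  assumes C: "finite C" "card C = Suc m" and s: "0 \<le> s"
    and D: "\<And>C' s. finite C' \<Longrightarrow> card C' = m \<Longrightarrow> 0 \<le> s \<Longrightarrow>
      (\<integral>a. exp (- s * (norm (row_per m C' a))\<^sup>2) \<partial>qginibre m C') \<le> D s"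
  shows "last_row_per_laplace m C s x \<le> D (s * (\<Sum>j\<in>C. (norm (x j))\<^sup>2))"
proof (induction "card {j\<in>C. x j \<noteq> 0}" arbitrary: x rule: less_induct)
  case less
  show ?case
  proof (cases "\<exists>p\<in>C. \<exists>q\<in>C. p \<noteq> q \<and> x p \<noteq> 0 \<and> x q \<noteq> 0")
    case True
    then obtain p q where pq: "p \<in> C" "q \<in> C" "p \<noteq> q" "x p \<noteq> 0" "x q \<noteq> 0" by blast
    define r where "r = (norm (x p))\<^sup>2 + (norm (x q))\<^sup>2"
    \<comment> \<open>the shares of the two entries in \<open>r\<close> are the weights of the convex combination\<close>
    define t where "t = (norm (x p))\<^sup>2 / r"
    have r: "0 < r" using pq by (simp add: r_def add_pos_pos)
    have t: "0 < t" "t < 1" using pq r by (auto simp: t_def r_def)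
    have t': "1 - t = (norm (x q))\<^sup>2 / r" using r by (simp add: t_def divide_simps) (simp add: r_def)
    \<comment> \<open>the entries of norm \<open>\<surd>r\<close> in the directions of \<open>x p\<close> and \<open>x q\<close>\<close>
    define y z where "y = x p /\<^sub>R sqrt t" and "z = x q /\<^sub>R sqrt (1 - t)"
    have ny: "(norm y)\<^sup>2 = r"
      using t pq r by (simp add: y_def power_mult_distrib power_inverse) (simp add: t_def)
    have nz: "(norm z)\<^sup>2 = r"
      using t pq r by (simp add: z_def power_mult_distrib power_inverse) (simp add: t')
    have xyz: "x p = sqrt t *\<^sub>R y" "x q = sqrt (1 - t) *\<^sub>R z"
      using t by (simp_all add: y_def z_def)
    have sum_eq: "(\<Sum>j\<in>C. (norm ((x(p := a, q := b)) j))\<^sup>2) = (\<Sum>j\<in>C. (norm (x j))\<^sup>2)"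
      if "(norm a)\<^sup>2 + (norm b)\<^sup>2 = r" for a b
    proof -
      have "(\<Sum>j\<in>C. (norm (f j))\<^sup>2) = (norm (f p))\<^sup>2 + ((norm (f q))\<^sup>2 + (\<Sum>j\<in>C - {p} - {q}. (norm (f j))\<^sup>2))" for f :: "nat \<Rightarrow> quat"
        using C pq by (simp add: sum.remove [of C p] sum.remove [of "C - {p}" q])
      note this [of "x(p := a, q := b)"] this [of x]
      moreover have "(\<Sum>j\<in>C - {p} - {q}. (norm ((x(p := a, q := b)) j))\<^sup>2) = (\<Sum>j\<in>C - {p} - {q}. (norm (x j))\<^sup>2)"
        by (rule sum.cong) auto
      ultimately show ?thesis using that pq by (simp add: r_def)
    qed
    have small: "card {j\<in>C. (x(p := a, q := b)) j \<noteq> 0} < card {j\<in>C. x j \<noteq> 0}" if "a = 0 \<or> b = 0" for a b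
      by (rule psubset_card_mono) (use that pq C in \<open>auto split: if_splits\<close>)
    have "last_row_per_laplace m C s x \<le>
        t * last_row_per_laplace m C s (x(p := y, q := 0)) + (1 - t) * last_row_per_laplace m C s (x(p := 0, q := z))"
      by (rule last_row_per_laplace_interpolation [OF C pq(1-3) s t xyz])
    also have "\<dots> \<le> t * D (s * (\<Sum>j\<in>C. (norm (x j))\<^sup>2)) + (1 - t) * D (s * (\<Sum>j\<in>C. (norm (x j))\<^sup>2))"
    proof (intro add_mono mult_left_mono)
      show "last_row_per_laplace m C s (x(p := y, q := 0)) \<le> D (s * (\<Sum>j\<in>C. (norm (x j))\<^sup>2))"
      proof -
        have e: "(\<Sum>j\<in>C. (norm ((x(p := y, q := 0)) j))\<^sup>2) = (\<Sum>j\<in>C. (norm (x j))\<^sup>2)"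
          by (rule sum_eq) (simp add: ny)
        have "card {j\<in>C. (x(p := y, q := 0)) j \<noteq> 0} < card {j\<in>C. x j \<noteq> 0}"
          by (rule small) simp
        from less [OF this] show ?thesis unfolding e .
      qed
      show "last_row_per_laplace m C s (x(p := 0, q := z)) \<le> D (s * (\<Sum>j\<in>C. (norm (x j))\<^sup>2))"
      proof -
        have e: "(\<Sum>j\<in>C. (norm ((x(p := 0, q := z)) j))\<^sup>2) = (\<Sum>j\<in>C. (norm (x j))\<^sup>2)"
          by (rule sum_eq) (simp add: nz)
        have "card {j\<in>C. (x(p := 0, q := z)) j \<noteq> 0} < card {j\<in>C. x j \<noteq> 0}"
          by (rule small) simp
        from less [OF this] show ?thesis unfolding e .
      qed
    qed (use t in auto)
    also have "\<dots> = D (s * (\<Sum>j\<in>C. (norm (x j))\<^sup>2))" by (simp add: algebra_simps)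
    finally show ?thesis .
  next
    case False
    have "C \<noteq> {}" using C by auto
    then obtain p where p: "p \<in> C" and zero: "\<And>j. j \<in> C \<Longrightarrow> j \<noteq> p \<Longrightarrow> x j = 0"
      using False by (metis ex_in_conv)
    have C': "finite (C - {p})" "card (C - {p}) = m" "insert p (C - {p}) = C" using C p by auto
    interpret G: prob_space "qginibre m C" by (rule prob_space_qginibre)
    interpret v: prob_space "qvec {..<m}" by (rule prob_space_qvec)
    have lp: "last_row_per m C x a = row_per m (C - {p}) a * x p" for a
      unfolding last_row_per_def using C p zero by (subst sum.remove [of C p]) auto
    have "last_row_per_laplace m C s x = (\<integral>a. exp (- (s * (norm (x p))\<^sup>2) * (norm (row_per m (C - {p}) a))\<^sup>2) \<partial>qginibre m (insert p (C - {p})))"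
      unfolding last_row_per_laplace_def lp C'(3) by (simp add: norm_mult power_mult_distrib algebra_simps)
    also have "\<dots> = (\<integral>a. \<integral>u. exp (- (s * (norm (x p))\<^sup>2) * (norm (row_per m (C - {p}) (set_col p u a)))\<^sup>2)
        \<partial>qvec {..<m} \<partial>qginibre m (C - {p}))"
    proof (rule integral_split_col)
      have "(\<lambda>a. row_per m (C - {p}) a) \<in> borel_measurable (qginibre m C)"
        by (rule measurable_row_per) (use C' in \<open>auto intro!: measurable_qginibre_entry [OF _ _ measurable_ident_sets [OF refl]]\<close>)
      then show "integrable (qginibre m (insert p (C - {p}))) (\<lambda>a. exp (- (s * (norm (x p))\<^sup>2) * (norm (row_per m (C - {p}) a))\<^sup>2))"
        unfolding C'(3) using s by (intro G.integrable_const_bound [where B = 1]) auto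
    qed (use C' in auto)
    also have "\<dots> = (\<integral>a. exp (- (s * (norm (x p))\<^sup>2) * (norm (row_per m (C - {p}) a))\<^sup>2) \<partial>qginibre m (C - {p}))"
    proof (rule Bochner_Integration.integral_cong [OF refl])
      fix a
      have "row_per m (C - {p}) (set_col p u a) = row_per m (C - {p}) a" for u
        by (rule row_per_cong) (auto simp: set_col_def)
      then show "(\<integral>u. exp (- (s * (norm (x p))\<^sup>2) * (norm (row_per m (C - {p}) (set_col p u a)))\<^sup>2) \<partial>qvec {..<m})
          = exp (- (s * (norm (x p))\<^sup>2) * (norm (row_per m (C - {p}) a))\<^sup>2)"
        by (simp add: v.prob_space)
    qed
    also have "\<dots> \<le> D (s * (norm (x p))\<^sup>2)"
      by (rule D) (use C' s in auto)
    also have "(norm (x p))\<^sup>2 = (\<Sum>j\<in>C. (norm (x j))\<^sup>2)"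
      using C p zero by (subst sum.remove [of C p]) auto
    finally show ?thesis .
  qed
qed

text \<open>The Laplace transform of the product of independent \<open>|x\<^sub>1|\<^sup>2 \<cdots> |x\<^sub>m|\<^sup>2\<close>, where \<open>x\<^sub>k\<close> is a Gaussian vector of
length \<open>k\<close>. For \<open>s \<ge> 0\<close> it is the Laplace transform of the squared Study determinant of a Gaussian matrix
(\<open>Sdet2_laplace_eq\<close> below).\<close>

fun Sdet2_laplace :: "nat \<Rightarrow> real \<Rightarrow> real" where
  "Sdet2_laplace 0 s = exp (- s)"
| "Sdet2_laplace (Suc m) s = (\<integral>x. Sdet2_laplace m (s * (\<Sum>j<Suc m. (norm (x j))\<^sup>2)) \<partial>qvec {..<Suc m})"

lemma measurable_Sdet2_laplace [measurable]: "Sdet2_laplace m \<in> borel_measurable borel"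
proof (induction m)
  case 0
  have "Sdet2_laplace 0 = (\<lambda>s. exp (- s))" by auto
  then show ?case by simp
next
  case (Suc m)
  interpret v: prob_space "qvec {..<Suc m}" by (rule prob_space_qvec)
  note [measurable] = Suc
  have "Sdet2_laplace (Suc m) = (\<lambda>s. \<integral>x. Sdet2_laplace m (s * (\<Sum>j<Suc m. (norm (x j))\<^sup>2)) \<partial>qvec {..<Suc m})"
    by auto
  then show ?case by simp
qed

lemma Sdet2_laplace_bounds: "0 \<le> s \<Longrightarrow> 0 \<le> Sdet2_laplace m s \<and> Sdet2_laplace m s \<le> 1"
proof (induction m arbitrary: s)
  case (Suc m)
  interpret v: prob_space "qvec {..<Suc m}" by (rule prob_space_qvec)
  have "0 \<le> s * (\<Sum>j<Suc m. (norm (x j))\<^sup>2)" for x :: "nat \<Rightarrow> quat"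
    by (intro mult_nonneg_nonneg sum_nonneg Suc.prems zero_le_power2)
  note b = conjunct1 [OF Suc.IH [OF this]] conjunct2 [OF Suc.IH [OF this]]
  have "(\<lambda>x. Sdet2_laplace m (s * (\<Sum>j<Suc m. (norm (x j))\<^sup>2))) \<in> borel_measurable (qvec {..<Suc m})"
    by measurable
  then have "integrable (qvec {..<Suc m}) (\<lambda>x. Sdet2_laplace m (s * (\<Sum>j<Suc m. (norm (x j))\<^sup>2)))"
    by (intro v.integrable_const_bound [where B = 1] AE_I2) (simp_all only: real_norm_def abs_of_nonneg b)
  then show ?case
    unfolding Sdet2_laplace.simps
    by (intro conjI Bochner_Integration.integral_nonneg v.integral_le_const AE_I2 b)
qed simp

lemma integral_Sdet2_laplace_row:
  assumes C: "finite C" "card C = Suc m"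
  shows "(\<integral>x. Sdet2_laplace m (s * (\<Sum>j\<in>C. (norm (x j))\<^sup>2)) \<partial>qvec C) = Sdet2_laplace (Suc m) s"
proof -
  obtain \<pi> where \<pi>: "bij_betw \<pi> {..<Suc m} C"
    using C ex_bij_betw_nat_finite [of C] by (auto simp: lessThan_atLeast0)
  have "Sdet2_laplace (Suc m) s = (\<integral>x. Sdet2_laplace m (s * (\<Sum>j<Suc m. (norm ((\<lambda>n\<in>{..<Suc m}. x (\<pi> n)) j))\<^sup>2)) \<partial>qvec C)"
    unfolding Sdet2_laplace.simps
  proof (rule integral_qvec_reindex)
    show "(\<lambda>y. Sdet2_laplace m (s * (\<Sum>j<Suc m. (norm (y j))\<^sup>2))) \<in> borel_measurable (qvec {..<Suc m})"
      by measurable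
  qed (use \<pi> in \<open>auto simp: bij_betw_def\<close>)
  also have "\<dots> = (\<integral>x. Sdet2_laplace m (s * (\<Sum>j\<in>C. (norm (x j))\<^sup>2)) \<partial>qvec C)"
  proof (rule Bochner_Integration.integral_cong [OF refl])
    fix x :: "nat \<Rightarrow> quat"
    have "(\<Sum>j<Suc m. (norm ((\<lambda>n\<in>{..<Suc m}. x (\<pi> n)) j))\<^sup>2) = (\<Sum>j<Suc m. (norm (x (\<pi> j)))\<^sup>2)"
      by (rule sum.cong) auto
    also have "\<dots> = (\<Sum>j\<in>C. (norm (x j))\<^sup>2)" by (rule sum.reindex_bij_betw [OF \<pi>])
    finally show "Sdet2_laplace m (s * (\<Sum>j<Suc m. (norm ((\<lambda>n\<in>{..<Suc m}. x (\<pi> n)) j))\<^sup>2))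
       = Sdet2_laplace m (s * (\<Sum>j\<in>C. (norm (x j))\<^sup>2))" by simp
  qed
  finally show ?thesis by simp
qed

lemma row_per_laplace_le:
  assumes "finite C" "card C = m" "0 \<le> s"
  shows "(\<integral>a. exp (- s * (norm (row_per m C a))\<^sup>2) \<partial>qginibre m C) \<le> Sdet2_laplace m s"
  using assms
proof (induction m arbitrary: C s)
  case 0
  interpret G: prob_space "qginibre 0 C" by (rule prob_space_qginibre)
  show ?case by (simp add: G.prob_space)
next
  case (Suc m)
  interpret G: prob_space "qginibre (Suc m) C" by (rule prob_space_qginibre)
  interpret Gm: prob_space "qginibre m C" by (rule prob_space_qginibre)
  interpret v: prob_space "qvec C" by (rule prob_space_qvec)
  have row: "row_per (Suc m) C (set_row m x a) = last_row_per m C x a" for x a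
  proof -
    have "row_per m (C - {j}) (set_row m x a) = row_per m (C - {j}) a" for j
      by (rule row_per_cong) (auto simp: set_row_def)
    then show ?thesis by (simp add: last_row_per_def) (simp add: set_row_def)
  qed
  have "(\<integral>a. exp (- s * (norm (row_per (Suc m) C a))\<^sup>2) \<partial>qginibre (Suc m) C)
    = (\<integral>x. \<integral>a. exp (- s * (norm (row_per (Suc m) C (set_row m x a)))\<^sup>2) \<partial>qginibre m C \<partial>qvec C)"
  proof (rule integral_split_row)
    have "(\<lambda>a. row_per (Suc m) C a) \<in> borel_measurable (qginibre (Suc m) C)"
      by (rule measurable_row_per) (use Suc.prems in \<open>auto intro!: measurable_qginibre_entry [OF _ _ measurable_ident_sets [OF refl]]\<close>)
    then show "integrable (qginibre (Suc m) C) (\<lambda>a. exp (- s * (norm (row_per (Suc m) C a))\<^sup>2))"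
      using Suc.prems by (intro G.integrable_const_bound [where B = 1]) auto
  qed (use Suc.prems in simp)
  also have "\<dots> = (\<integral>x. last_row_per_laplace m C s x \<partial>qvec C)"
    by (simp only: row last_row_per_laplace_def)
  also have "\<dots> \<le> (\<integral>x. Sdet2_laplace m (s * (\<Sum>j\<in>C. (norm (x j))\<^sup>2)) \<partial>qvec C)"
  proof (rule integral_mono)
    show "last_row_per_laplace m C s x \<le> Sdet2_laplace m (s * (\<Sum>j\<in>C. (norm (x j))\<^sup>2))" for x
      by (rule last_row_per_laplace_le) (use Suc in auto)
    have "(\<lambda>z. last_row_per m C (fst z) (snd z)) \<in> borel_measurable (qvec C \<Otimes>\<^sub>M qginibre m C)"
      by (rule measurable_last_row_per) (use Suc.prems in \<open>auto intro!: measurable_qginibre_entry [OF _ _ measurable_snd] measurable_qvec_entry [OF _ measurable_fst]\<close>)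
    then have "last_row_per_laplace m C s \<in> borel_measurable (qvec C)"
      unfolding last_row_per_laplace_def by (intro Gm.borel_measurable_lebesgue_integral) (simp add: case_prod_beta')
    moreover have "norm (last_row_per_laplace m C s x) \<le> 1" for x
      unfolding last_row_per_laplace_def using Suc.prems
      by (intro order_trans [OF integral_norm_bound] Gm.integral_le_const)
        (auto intro!: Gm.integrable_const_bound [where B = 1] measurable_compose [OF measurable_last_row_per_qginibre [OF _ measurable_ident_sets [OF refl]]])
    ultimately show "integrable (qvec C) (last_row_per_laplace m C s)"
      by (intro v.integrable_const_bound [where B = 1]) auto
    show "integrable (qvec C) (\<lambda>x. Sdet2_laplace m (s * (\<Sum>j\<in>C. (norm (x j))\<^sup>2)))"
    proof (rule v.integrable_const_bound [where B = 1])
      have "0 \<le> s * (\<Sum>j\<in>C. (norm (x j))\<^sup>2)" for x :: "nat \<Rightarrow> quat"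
        using Suc.prems by (auto intro!: mult_nonneg_nonneg sum_nonneg)
      then show "AE x in qvec C. norm (Sdet2_laplace m (s * (\<Sum>j\<in>C. (norm (x j))\<^sup>2))) \<le> 1"
        using Sdet2_laplace_bounds by (auto simp: abs_le_iff intro!: AE_I2 order_trans [of _ 0])
    qed measurable
  qed
  also have "\<dots> = Sdet2_laplace (Suc m) s"
    by (rule integral_Sdet2_laplace_row) (use Suc.prems in auto)
  finally show ?case .
qed


section \<open>Unitary quaternionic matrices\<close>

lemma mat_mult_entry:
  assumes "A \<in> carrier_mat n k" "B \<in> carrier_mat k l" "i < n" "j < l"
  shows "(A * B) $$ (i, j) = (\<Sum>q<k. A $$ (i, q) * B $$ (q, j))"
  using assms by (auto simp: scalar_prod_def lessThan_atLeast0)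

lemma qadjoint_carrier [simp]: "A \<in> carrier_mat n k \<Longrightarrow> qadjoint A \<in> carrier_mat k n"
  by (auto simp: qadjoint_def)

lemma qadjoint_entry [simp]:
  "A \<in> carrier_mat n k \<Longrightarrow> i < k \<Longrightarrow> j < n \<Longrightarrow> qadjoint A $$ (i, j) = qcnj (A $$ (j, i))"
  by (auto simp: qadjoint_def)

lemma qadjoint_qadjoint [simp]: "qadjoint (qadjoint A) = A"
  by (rule eq_matI) (auto simp: qadjoint_def)

lemma qadjoint_mult:
  assumes "A \<in> carrier_mat n k" "B \<in> carrier_mat k l"
  shows "qadjoint (A * B) = qadjoint B * qadjoint A"
proof (rule eq_matI)
  fix i j assume "i < dim_row (qadjoint B * qadjoint A)" "j < dim_col (qadjoint B * qadjoint A)"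
  then have ij: "i < l" "j < n" using assms by (auto simp: qadjoint_def)
  have "qadjoint (A * B) $$ (i, j) = qcnj ((A * B) $$ (j, i))"
    using assms ij by (intro qadjoint_entry [of _ n l]) auto
  also have "\<dots> = (\<Sum>q<k. qadjoint B $$ (i, q) * qadjoint A $$ (q, j))"
    unfolding mat_mult_entry [OF assms ij(2,1)] qcnj_sum qcnj_mult
    using assms ij by (intro sum.cong) auto
  also have "\<dots> = (qadjoint B * qadjoint A) $$ (i, j)"
    using assms ij by (subst mat_mult_entry [of _ l k _ n]) auto
  finally show "qadjoint (A * B) $$ (i, j) = (qadjoint B * qadjoint A) $$ (i, j)" .
qed (use assms in \<open>auto simp: qadjoint_def\<close>)

lemma qunitary_carrier: "qunitary n U \<Longrightarrow> U \<in> carrier_mat n n"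
  by (simp add: qunitary_def)

lemma qunitary_adjoint: "qunitary n U \<Longrightarrow> qunitary n (qadjoint U)"
  by (simp add: qunitary_def)

lemma qunitary_mult:
  assumes U: "qunitary n U" and V: "qunitary n V"
  shows "qunitary n (U * V)"
proof -
  have c [simp]: "U \<in> carrier_mat n n" "V \<in> carrier_mat n n" "qadjoint U \<in> carrier_mat n n" "qadjoint V \<in> carrier_mat n n"
    using U V by (auto simp: qunitary_def)
  have assoc: "X * Y * Z = X * (Y * Z)" if "X \<in> carrier_mat n n" "Y \<in> carrier_mat n n" "Z \<in> carrier_mat n n" for X Y Z :: "quat mat"
    using that by (rule assoc_mult_mat)
  have one: "X * (Y * Z) = Z" if "X * Y = 1\<^sub>m n" "X \<in> carrier_mat n n" "Y \<in> carrier_mat n n" "Z \<in> carrier_mat n n" for X Y Z :: "quat mat"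
    using that assoc [of X Y Z] by (simp add: left_mult_one_mat [of _ n n])
  have "U * V * (qadjoint V * qadjoint U) = U * (V * (qadjoint V * qadjoint U))"
    by (intro assoc c mult_carrier_mat [of _ n n _ n])
  also have "\<dots> = 1\<^sub>m n" using U V by (simp add: one qunitary_def mult_carrier_mat [of _ n n])
  finally have 1: "U * V * (qadjoint V * qadjoint U) = 1\<^sub>m n" .
  have "qadjoint V * qadjoint U * (U * V) = qadjoint V * (qadjoint U * (U * V))"
    by (intro assoc c mult_carrier_mat [of _ n n _ n])
  also have "\<dots> = 1\<^sub>m n" using U V by (simp add: one qunitary_def mult_carrier_mat [of _ n n])
  finally show ?thesis using 1 mult_carrier_mat [of U n n V n]
    by (simp add: qunitary_def qadjoint_mult [of U n n V n])
qed

lemma qunitary_one: "qunitary n (1\<^sub>m n)"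
proof -
  have "qadjoint (1\<^sub>m n) = 1\<^sub>m n" by (rule eq_matI) (auto simp: qadjoint_def)
  then show ?thesis by (simp add: qunitary_def)
qed

definition frob :: "quat mat \<Rightarrow> real" where
  "frob A = (\<Sum>i<dim_row A. \<Sum>j<dim_col A. (norm (A $$ (i, j)))\<^sup>2)"

lemma adjoint_mult_col:
  assumes "v \<in> carrier_mat n 1"
  shows "qadjoint v * v = mat 1 1 (\<lambda>_. of_real (frob v))"
proof (rule eq_matI)
  fix i j assume "i < dim_row (mat 1 1 (\<lambda>_. of_real (frob v) :: quat))" "j < dim_col (mat 1 1 (\<lambda>_. of_real (frob v) :: quat))"
  then have ij: "i = 0" "j = 0" by auto
  have "(qadjoint v * v) $$ (0, 0) = (\<Sum>q<n. qadjoint v $$ (0, q) * v $$ (q, 0))"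
    using assms by (intro mat_mult_entry [of _ 1 n _ 1]) auto
  also have "\<dots> = (\<Sum>q<n. of_real ((norm (v $$ (q, 0)))\<^sup>2))"
    using assms by (intro sum.cong refl) (simp add: qadjoint_entry [of _ n 1] qcnj_mult_self del: of_real_power)
  also have "\<dots> = of_real (frob v)" using assms by (simp add: frob_def)
  finally show "(qadjoint v * v) $$ (i, j) = mat 1 1 (\<lambda>_. of_real (frob v)) $$ (i, j)" by (simp add: ij)
qed (use assms in \<open>auto simp: qadjoint_def\<close>)

lemma frob_unitary:
  assumes U: "qunitary n U" and v: "v \<in> carrier_mat n 1"
  shows "frob (U * v) = frob v"
proof -
  have c [simp]: "U \<in> carrier_mat n n" "qadjoint U \<in> carrier_mat n n" "qadjoint v \<in> carrier_mat 1 n"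
    using U v by (auto simp: qunitary_def)
  have "qadjoint (U * v) * (U * v) = qadjoint v * qadjoint U * (U * v)"
    using v mult_carrier_mat [of U n n v 1] by (subst qadjoint_mult [of U n n v 1]) auto
  also have "\<dots> = qadjoint v * (qadjoint U * (U * v))"
    using v mult_carrier_mat [of U n n v 1] by (intro assoc_mult_mat [of _ 1 n _ n _ 1]) auto
  also have "qadjoint U * (U * v) = qadjoint U * U * v"
    using v mult_carrier_mat [of U n n v 1] by (intro assoc_mult_mat [symmetric, of _ n n _ n _ 1]) auto
  also have "\<dots> = v" using U v by (simp add: qunitary_def)
  finally have "mat 1 1 (\<lambda>_. of_real (frob (U * v))) = (mat 1 1 (\<lambda>_. of_real (frob v)) :: quat mat)"
    using v mult_carrier_mat [of U n n v 1] adjoint_mult_col [of v n] adjoint_mult_col [of "U * v" n] by simp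
  then have "(of_real (frob (U * v)) :: quat) = of_real (frob v)"
    by (metis index_mat(1) less_numeral_extra(1) split_conv)
  then show ?thesis by (simp only: of_real_eq_iff)
qed


section \<open>Reduction of a row by elementary unitary matrices\<close>

definition givens :: "nat \<Rightarrow> nat \<Rightarrow> nat \<Rightarrow> real \<Rightarrow> real \<Rightarrow> quat mat" where
  "givens n p q c s = mat n n (\<lambda>(i, j). if j = p then (if i = p then of_real c else if i = q then of_real (- s) else 0)
     else if j = q then (if i = p then of_real s else if i = q then of_real c else 0)
     else if i = j then 1 else 0)"

lemma givens_carrier [simp]: "givens n p q c s \<in> carrier_mat n n"
  by (simp add: givens_def)

lemma mult_givens:
  assumes A: "A \<in> carrier_mat k n" and pq: "p < n" "q < n" "p \<noteq> q"
  shows "A * givens n p q c s = mat k n (\<lambda>(i, j).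
     if j = p then c *\<^sub>R A $$ (i, p) - s *\<^sub>R A $$ (i, q)
     else if j = q then s *\<^sub>R A $$ (i, p) + c *\<^sub>R A $$ (i, q) else A $$ (i, j))" (is "_ = ?R")
proof (rule eq_matI)
  fix i j assume "i < dim_row ?R" "j < dim_col ?R"
  then have ij: "i < k" "j < n" by auto
  have split: "(\<Sum>l<n. A $$ (i, l) * f l) = A $$ (i, p) * f p + (A $$ (i, q) * f q + (\<Sum>l\<in>{..<n} - {p} - {q}. A $$ (i, l) * f l))" for f
    using pq by (simp add: sum.remove [of "{..<n}" p] sum.remove [of "{..<n} - {p}" q])
  have comm: "x * of_real r = r *\<^sub>R x" for x :: quat and r by (simp add: of_real_def)
  have "(A * givens n p q c s) $$ (i, j) = (\<Sum>l<n. A $$ (i, l) * givens n p q c s $$ (l, j))"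
    by (rule mat_mult_entry [OF A givens_carrier ij])
  also have "\<dots> = (\<Sum>l<n. A $$ (i, l) * (if j = p then (if l = p then of_real c else if l = q then of_real (- s) else 0)
     else if j = q then (if l = p then of_real s else if l = q then of_real c else 0)
     else if l = j then 1 else 0))"
    using ij by (intro sum.cong) (auto simp: givens_def)
  also have "\<dots> = ?R $$ (i, j)"
  proof (cases "j = p \<or> j = q")
    case True
    then show ?thesis using pq ij unfolding split by (auto simp: comm simp del: of_real_minus)
  next
    case False
    then show ?thesis using ij by (simp add: if_distrib [of "\<lambda>x. _ * x"] cong: if_cong)
  qed
  finally show "(A * givens n p q c s) $$ (i, j) = ?R $$ (i, j)" .
qed (use A in \<open>auto simp: givens_def\<close>)

lemma qunitary_if:
  assumes "U \<in> carrier_mat n n" "V \<in> carrier_mat n n" "qadjoint U = V" "U * V = 1\<^sub>m n" "V * U = 1\<^sub>m n"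
  shows "qunitary n U"
  using assms by (simp add: qunitary_def)

lemma qunitary_unit_diag:
  assumes "\<And>j. norm (u j) = 1"
  shows "qunitary n (mat_diag n u)"
proof (rule qunitary_if [where V = "mat_diag n (\<lambda>j. qcnj (u j))"])
  show "qadjoint (mat_diag n u) = mat_diag n (\<lambda>j. qcnj (u j))"
    by (rule eq_matI) (auto simp: qadjoint_def mat_diag_def)
qed (use assms in \<open>auto simp: qcnj_mult_self\<close>)

lemma qunitary_givens:
  assumes pq: "p < n" "q < n" "p \<noteq> q" and cs: "c\<^sup>2 + s\<^sup>2 = 1"
  shows "qunitary n (givens n p q c s)"
proof (rule qunitary_if [where V = "givens n p q c (- s)"])
  show "qadjoint (givens n p q c s) = givens n p q c (- s)"
    using pq by (intro eq_matI) (auto simp: qadjoint_def givens_def)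
  have cs': "c * c + s * s = 1" using cs by (simp add: power2_eq_square)
  have "givens n p q c s * givens n p q c (- s) = 1\<^sub>m n"
    if "c * c + s * s = 1" for s
    unfolding mult_givens [OF givens_carrier pq]
    using pq that by (intro eq_matI) (auto simp: givens_def of_real_def scaleR_add_left [symmetric] scaleR_diff_left [symmetric] add.commute mult.commute)
  from this [of s] this [of "- s"] cs'
  show "givens n p q c s * givens n p q c (- s) = 1\<^sub>m n" "givens n p q c (- s) * givens n p q c s = 1\<^sub>m n"
    by simp_all
qed auto

text \<open>Every row can be brought to the form \<open>(0, \<dots>, 0, r)\<close> with \<open>r \<ge> 0\<close>: units on the right make all entries real
and nonnegative, and real plane rotations then move one entry after the other into the last one. These two
operations are also those under which the law of a Gaussian matrix is visibly invariant, so that the same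
induction serves the singular value decomposition and the computation of the law of the determinant.\<close>

lemma row_reduction_induct:
  assumes unit: "\<And>x u. (\<And>j. norm (u j) = 1) \<Longrightarrow> P (\<lambda>j. x j * u j) \<Longrightarrow> P x"
    and rot: "\<And>x p c s. p < m \<Longrightarrow> c\<^sup>2 + s\<^sup>2 = 1 \<Longrightarrow>
      P (\<lambda>j. if j = p then c *\<^sub>R x p - s *\<^sub>R x m else if j = m then s *\<^sub>R x p + c *\<^sub>R x m else x j) \<Longrightarrow> P x"
    and final: "\<And>x r. 0 \<le> r \<Longrightarrow> (\<And>j. j < m \<Longrightarrow> x j = 0) \<Longrightarrow> x m = of_real r \<Longrightarrow> P x"
  shows "P (x :: nat \<Rightarrow> quat)"
proof -
  have "\<forall>r. (\<forall>j. 0 \<le> r j) \<longrightarrow> (\<forall>j<k. r j = 0) \<longrightarrow> P (\<lambda>j. of_real (r j))" if "k \<le> m" for k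
    using that
  proof (induction k rule: inc_induct)
    case base
    show ?case using final [of "r m" "\<lambda>j. of_real (r j)" for r] by auto
  next
    case (step k)
    show ?case
    proof (intro allI impI)
      fix r :: "nat \<Rightarrow> real" assume r: "\<forall>j. 0 \<le> r j" "\<forall>j<k. r j = 0"
      define R where "R = sqrt ((r k)\<^sup>2 + (r m)\<^sup>2)"
      \<comment> \<open>the rotation that takes \<open>(r k, r m)\<close> to \<open>(0, R)\<close>\<close>
      define c s where "c = (if R = 0 then 1 else r m / R)" and "s = (if R = 0 then 0 else r k / R)"
      have R0: "R = 0 \<Longrightarrow> r k = 0 \<and> r m = 0"
        by (simp add: R_def add_nonneg_eq_0_iff)
      have R2: "R\<^sup>2 = (r k)\<^sup>2 + (r m)\<^sup>2" by (simp add: R_def)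
      have cs: "c\<^sup>2 + s\<^sup>2 = 1"
        using R2 by (auto simp: c_def s_def power_divide add_divide_distrib [symmetric] add.commute)
      have 1: "c * r k - s * r m = 0" by (auto simp: c_def s_def R0)
      have "s * r k + c * r m = (if R = 0 then 0 else R\<^sup>2 / R)"
        unfolding R2 by (auto simp: c_def s_def R0 power2_eq_square add_divide_distrib)
      then have 2: "s * r k + c * r m = R" by (simp add: power2_eq_square)
      let ?r = "r(k := 0, m := R)"
      have "P (\<lambda>j. of_real (?r j))"
        using step.IH r step.hyps by (auto simp: R_def less_Suc_eq)
      also have "(\<lambda>j. of_real (?r j)) = (\<lambda>j. if j = k then c *\<^sub>R of_real (r k) - s *\<^sub>R of_real (r m)
          else if j = m then s *\<^sub>R of_real (r k) + c *\<^sub>R of_real (r m) else (of_real (r j) :: quat))"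
        using 1 2 step.hyps by (auto simp: fun_eq_iff of_real_def scaleR_add_left [symmetric] scaleR_diff_left [symmetric])
      finally show "P (\<lambda>j. of_real (r j))"
        by (rule rot [OF \<open>k < m\<close> cs])
    qed
  qed
  from this [of 0] have *: "P (\<lambda>j. of_real (r j))" if "\<And>j. 0 \<le> r j" for r using that by simp
  define u where "u j = (if x j = 0 then 1 else qcnj (x j) /\<^sub>R norm (x j))" for j
  have "P (\<lambda>j. of_real (norm (x j)))" by (rule *) simp
  also have "(\<lambda>j. of_real (norm (x j))) = (\<lambda>j. x j * u j)"
    by (auto simp: u_def fun_eq_iff qcnj_mult_self of_real_def power2_eq_square)
  finally show "P x" by (rule unit [rotated]) (simp add: u_def)
qed

definition row_mat :: "nat \<Rightarrow> (nat \<Rightarrow> quat) \<Rightarrow> quat mat" where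
  "row_mat n x = mat 1 n (\<lambda>(i, j). x j)"

lemma row_mat_carrier [simp]: "row_mat n x \<in> carrier_mat 1 n"
  by (simp add: row_mat_def)

lemma unitary_row_reduction:
  "\<exists>Q r. qunitary (Suc m) Q \<and> 0 \<le> r \<and>
     row_mat (Suc m) x * Q = row_mat (Suc m) (\<lambda>j. if j = m then of_real r else 0)"
proof -
  let ?P = "\<lambda>x. \<exists>Q r. qunitary (Suc m) Q \<and> 0 \<le> r \<and>
     row_mat (Suc m) x * Q = row_mat (Suc m) (\<lambda>j. if j = m then of_real r else 0)"
  have step: "?P x" if E: "qunitary (Suc m) E" "row_mat (Suc m) x * E = row_mat (Suc m) y" and Q: "?P y" for E x y
  proof -
    obtain Q r where Q: "qunitary (Suc m) Q" "0 \<le> r" "row_mat (Suc m) y * Q = row_mat (Suc m) (\<lambda>j. if j = m then of_real r else 0)"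
      using Q by blast
    have "row_mat (Suc m) x * (E * Q) = row_mat (Suc m) y * Q"
      unfolding E(2) [symmetric] using E(1) Q(1)
      by (intro assoc_mult_mat [symmetric, of _ 1 "Suc m" _ "Suc m" _ "Suc m"]) (auto intro: qunitary_carrier simp del: One_nat_def)
    then show ?thesis using Q qunitary_mult [OF E(1) Q(1)] by metis
  qed
  show ?thesis
  proof (rule row_reduction_induct [where P = ?P and m = m])
    fix x u :: "nat \<Rightarrow> quat" assume "\<And>j. norm (u j) = 1" and *: "?P (\<lambda>j. x j * u j)"
    then show "?P x"
      by (intro step [OF qunitary_unit_diag [of u] _ *])
        (auto simp: mat_diag_mult_right [of _ 1] row_mat_def intro!: eq_matI)
  next
    fix x :: "nat \<Rightarrow> quat" and p and c s :: real
    assume p: "p < m" and cs: "c\<^sup>2 + s\<^sup>2 = 1"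
      and *: "?P (\<lambda>j. if j = p then c *\<^sub>R x p - s *\<^sub>R x m else if j = m then s *\<^sub>R x p + c *\<^sub>R x m else x j)"
    show "?P x"
    proof (rule step [OF qunitary_givens [of p "Suc m" m c s] _ *])
      show "row_mat (Suc m) x * givens (Suc m) p m c s =
        row_mat (Suc m) (\<lambda>j. if j = p then c *\<^sub>R x p - s *\<^sub>R x m else if j = m then s *\<^sub>R x p + c *\<^sub>R x m else x j)"
        using p by (subst mult_givens [of _ 1]) (auto simp: row_mat_def intro!: eq_matI)
    qed (use p cs in auto)
  next
    fix x :: "nat \<Rightarrow> quat" and r :: real
    assume r: "0 \<le> r" "\<And>j. j < m \<Longrightarrow> x j = 0" "x m = of_real r"
    have "row_mat (Suc m) x * 1\<^sub>m (Suc m) = row_mat (Suc m) (\<lambda>j. if j = m then of_real r else 0)"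
      using r by (subst right_mult_one_mat [of _ 1]) (auto simp: row_mat_def less_Suc_eq intro!: eq_matI)
    then show "?P x" using r(1) qunitary_one by blast
  qed
qed


section \<open>Existence of the singular value decomposition\<close>

definition col_mat :: "nat \<Rightarrow> (nat \<Rightarrow> quat) \<Rightarrow> quat mat" where
  "col_mat n x = mat n 1 (\<lambda>(i, j). x i)"

lemma col_mat_carrier [simp]: "col_mat n x \<in> carrier_mat n 1"
  by (simp add: col_mat_def)

lemma col_mat_index: "i < n \<Longrightarrow> col_mat n x $$ (i, 0) = x i"
  by (simp add: col_mat_def)

lemma frob_col_mat: "frob (col_mat n x) = (\<Sum>i<n. (norm (x i))\<^sup>2)"
  by (simp add: frob_def col_mat_def)

lemma mult_col_mat:
  assumes "A \<in> carrier_mat k n"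
  shows "A * col_mat n x = col_mat k (\<lambda>i. \<Sum>j<n. A $$ (i, j) * x j)"
proof (rule eq_matI)
  fix i j assume "i < dim_row (col_mat k (\<lambda>i. \<Sum>j<n. A $$ (i, j) * x j))" "j < dim_col (col_mat k (\<lambda>i. \<Sum>j<n. A $$ (i, j) * x j))"
  then have ij: "i < k" "j < 1" by (auto simp: col_mat_def)
  show "(A * col_mat n x) $$ (i, j) = col_mat k (\<lambda>i. \<Sum>j<n. A $$ (i, j) * x j) $$ (i, j)"
    using ij by (subst mat_mult_entry [OF assms col_mat_carrier ij]) (simp add: col_mat_def)
qed (use assms in \<open>auto simp: col_mat_def\<close>)

lemma col_mat_eta: "v \<in> carrier_mat n 1 \<Longrightarrow> v = col_mat n (\<lambda>i. v $$ (i, 0))"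
  by (rule eq_matI) (auto simp: col_mat_def)

text \<open>For a unit vector \<open>v\<close> this gives \<open>r = 1\<close>, and then \<open>Q\<close> is a unitary matrix whose last column is \<open>v\<close>.\<close>

lemma unitary_col_reduction:
  assumes v: "v \<in> carrier_mat (Suc m) 1"
  shows "\<exists>Q r. qunitary (Suc m) Q \<and> 0 \<le> r \<and> r\<^sup>2 = frob v \<and>
     qadjoint Q * v = col_mat (Suc m) (\<lambda>i. if i = m then of_real r else 0)"
proof -
  define x where "x i = qcnj (v $$ (i, 0))" for i
  obtain Q r where Q: "qunitary (Suc m) Q" "0 \<le> r"
    and eq: "row_mat (Suc m) x * Q = row_mat (Suc m) (\<lambda>j. if j = m then of_real r else 0)"
    using unitary_row_reduction by blast
  have adj: "qadjoint (row_mat (Suc m) y) = col_mat (Suc m) (\<lambda>i. qcnj (y i))" for y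
    by (rule eq_matI) (auto simp: qadjoint_def row_mat_def col_mat_def)
  have "qadjoint Q * v = qadjoint (row_mat (Suc m) x * Q)"
    using qunitary_carrier [OF Q(1)] v
    by (subst qadjoint_mult [of _ 1 "Suc m"]) (auto simp: adj x_def col_mat_eta [symmetric] simp del: One_nat_def)
  also have "\<dots> = col_mat (Suc m) (\<lambda>i. if i = m then of_real r else 0)"
    unfolding eq adj by (simp add: if_distrib cong: if_cong)
  finally have *: "qadjoint Q * v = col_mat (Suc m) (\<lambda>i. if i = m then of_real r else 0)" .
  have "frob v = frob (qadjoint Q * v)"
    by (rule frob_unitary [symmetric, OF qunitary_adjoint [OF Q(1)] v])
  also have "\<dots> = r\<^sup>2" unfolding * frob_col_mat by (simp add: if_distrib [of norm] if_distrib [of "\<lambda>x. x\<^sup>2"] cong: if_cong)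
  finally show ?thesis using Q * by auto
qed

text \<open>The unit sphere is compact as a closed subset of a product of balls, in the product topology on functions. The
maximality is stated homogeneously, for all vectors \<open>w\<close>.\<close>

lemma exists_maximal_column:
  fixes A :: "quat mat"
  assumes n: "0 < n"
  shows "\<exists>v. (\<Sum>j<n. (norm (v j))\<^sup>2) = 1 \<and>
     (\<forall>w. (\<Sum>i<n. (norm (\<Sum>j<n. A $$ (i, j) * w j))\<^sup>2)
        \<le> (\<Sum>i<n. (norm (\<Sum>j<n. A $$ (i, j) * v j))\<^sup>2) * (\<Sum>j<n. (norm (w j))\<^sup>2))"
proof -
  define N :: "(nat \<Rightarrow> quat) \<Rightarrow> real" where "N = (\<lambda>v. \<Sum>j<n. (norm (v j))\<^sup>2)"
  define g where "g = (\<lambda>v. \<Sum>i<n. (norm (\<Sum>j<n. A $$ (i, j) * v j))\<^sup>2)"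
  define K :: "(nat \<Rightarrow> quat) set" where "K = PiE UNIV (\<lambda>i. if i < n then cball 0 1 else {0})"
  have "compactin (product_topology (\<lambda>_::nat. euclidean :: quat topology) UNIV) K"
    unfolding K_def compactin_PiE by auto
  then have "compact K" by (simp add: euclidean_product_topology)
  have contN: "continuous_on UNIV N"
    unfolding N_def by (intro continuous_intros continuous_on_product_coordinates)
  have contg: "continuous_on UNIV g"
    unfolding g_def by (intro continuous_intros continuous_on_product_coordinates)
  have "closed (N -` {1})"
    using contN by (simp add: continuous_on_closed_vimage)
  then have "compact (K \<inter> N -` {1})" using \<open>compact K\<close> by (simp add: compact_Int_closed)
  moreover have "(\<lambda>i. if i = 0 then 1 else 0) \<in> K \<inter> N -` {1}"
    using n by (auto simp: K_def N_def if_distrib [of norm] if_distrib [of "\<lambda>x. x\<^sup>2"] cong: if_cong)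
  ultimately obtain v where v: "v \<in> K \<inter> N -` {1}" and max: "\<And>w. w \<in> K \<inter> N -` {1} \<Longrightarrow> g w \<le> g v"
    using continuous_attains_sup [of "K \<inter> N -` {1}" g] continuous_on_subset [OF contg] by blast
  have "g w \<le> g v * N w" for w
  proof (cases "N w = 0")
    case True
    then have "w j = 0" if "j < n" for j
      using that unfolding N_def by (subst (asm) sum_nonneg_eq_0_iff) auto
    then show ?thesis using True by (simp add: g_def)
  next
    case False
    then have pos: "0 < N w" unfolding N_def by (metis less_le sum_nonneg zero_le_power2)
    define c where "c = inverse (sqrt (N w))"
    have c2: "c\<^sup>2 = inverse (N w)" using pos by (simp add: c_def power_inverse)
    define w' where "w' j = (if j < n then c *\<^sub>R w j else 0)" for j
    have "N w' = (\<Sum>j<n. c\<^sup>2 * (norm (w j))\<^sup>2)"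
      unfolding N_def by (rule sum.cong) (auto simp: w'_def power_mult_distrib)
    also have "\<dots> = c\<^sup>2 * N w" by (simp add: N_def sum_distrib_left)
    finally have N': "N w' = 1" using pos by (simp add: c2)
    have "norm (w' j) \<le> 1" if "j < n" for j
    proof -
      have "(norm (w' j))\<^sup>2 \<le> N w'"
        unfolding N_def using that by (intro member_le_sum) auto
      then show ?thesis using N' by (simp add: abs_square_le_1)
    qed
    then have "w' \<in> K \<inter> N -` {1}" using N' by (auto simp: K_def w'_def)
    then have "g w' \<le> g v" by (rule max)
    moreover have "g w' = (\<Sum>i<n. c\<^sup>2 * (norm (\<Sum>j<n. A $$ (i, j) * w j))\<^sup>2)"
    proof -
      have "(\<Sum>j<n. A $$ (i, j) * w' j) = c *\<^sub>R (\<Sum>j<n. A $$ (i, j) * w j)" for i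
        unfolding scaleR_sum_right by (rule sum.cong) (auto simp: w'_def)
      then show ?thesis by (simp add: g_def power_mult_distrib)
    qed
    then have "g w' = c\<^sup>2 * g w" by (simp add: g_def sum_distrib_left)
    ultimately show ?thesis using pos by (simp add: c2 field_simps)
  qed
  then show ?thesis using v by (auto simp: N_def g_def)
qed

definition bdiag :: "nat \<Rightarrow> quat mat \<Rightarrow> quat \<Rightarrow> quat mat" where
  "bdiag m B x = mat (Suc m) (Suc m)
     (\<lambda>(i, j). if i < m \<and> j < m then B $$ (i, j) else if i = j then x else 0)"

lemma bdiag_carrier [simp]: "bdiag m B x \<in> carrier_mat (Suc m) (Suc m)"
  by (simp add: bdiag_def)

lemma bdiag_mult:
  assumes "B \<in> carrier_mat m m" "C \<in> carrier_mat m m"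
  shows "bdiag m B x * bdiag m C y = bdiag m (B * C) (x * y)" (is "_ = ?R")
proof (rule eq_matI)
  fix i j assume "i < dim_row ?R" "j < dim_col ?R"
  then have ij: "i < Suc m" "j < Suc m" by (auto simp: bdiag_def)
  have "(bdiag m B x * bdiag m C y) $$ (i, j) =
      (\<Sum>q<m. bdiag m B x $$ (i, q) * bdiag m C y $$ (q, j)) + bdiag m B x $$ (i, m) * bdiag m C y $$ (m, j)"
    by (subst mat_mult_entry [OF bdiag_carrier bdiag_carrier ij]) simp
  also have "\<dots> = ?R $$ (i, j)"
  proof (cases "i < m \<and> j < m")
    case True
    then have "?R $$ (i, j) = (\<Sum>q<m. B $$ (i, q) * C $$ (q, j))"
      using assms by (simp add: bdiag_def mat_mult_entry [of B m m C m] del: index_mult_mat)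
    then show ?thesis using True by (simp add: bdiag_def)
  next
    case False
    then have "(\<Sum>q<m. bdiag m B x $$ (i, q) * bdiag m C y $$ (q, j)) = 0"
      using ij by (intro sum.neutral) (auto simp: bdiag_def)
    then show ?thesis using False ij by (auto simp: bdiag_def)
  qed
  finally show "(bdiag m B x * bdiag m C y) $$ (i, j) = ?R $$ (i, j)" .
qed (auto simp: bdiag_def)

lemma qadjoint_bdiag: "B \<in> carrier_mat m m \<Longrightarrow> qadjoint (bdiag m B x) = bdiag m (qadjoint B) (qcnj x)"
  by (rule eq_matI) (auto simp: qadjoint_def bdiag_def)

lemma bdiag_one: "bdiag m (1\<^sub>m m) 1 = 1\<^sub>m (Suc m)"
  by (rule eq_matI) (auto simp: bdiag_def)

lemma qunitary_bdiag: "qunitary m U \<Longrightarrow> qunitary (Suc m) (bdiag m U 1)"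
  by (simp add: qunitary_def qadjoint_bdiag bdiag_mult bdiag_one)

text \<open>Let the unit vector \<open>v\<close> maximise \<open>|A v|\<close>, with maximum \<open>\<sigma>\<close>. In orthonormal bases that end with \<open>v\<close> and with
the direction of \<open>A v\<close>, the last column of the matrix is \<open>(0, \<dots>, 0, \<sigma>)\<close>. Its last row has norm at most
\<open>\<sigma>\<close>, since otherwise the conjugate of that row would be a better vector; as its last entry is already \<open>\<sigma>\<close>,
the other entries vanish. The remaining block is smaller.\<close>

lemma exists_qsingular_values:
  "A \<in> carrier_mat n n \<Longrightarrow> \<exists>s. is_qsingular_values A s"
proof (induction n arbitrary: A)
  case 0
  have "A = 1\<^sub>m 0 * mat_diag 0 (\<lambda>i. of_real ([] ! i)) * qadjoint (1\<^sub>m 0)"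
    using 0 by (intro eq_matI) (auto simp: qadjoint_def)
  then have "is_qsingular_values A []"
    using 0 qunitary_one [of 0] unfolding is_qsingular_values_def by auto
  then show ?case by blast
next
  case (Suc m)
  let ?n = "Suc m"
  let ?e = "col_mat ?n (\<lambda>i. if i = m then 1 else 0)"
  have A [simp]: "A \<in> carrier_mat ?n ?n" by fact
  obtain x where x1: "(\<Sum>j<?n. (norm (x j))\<^sup>2) = 1"
    and max: "\<And>w. (\<Sum>i<?n. (norm (\<Sum>j<?n. A $$ (i, j) * w j))\<^sup>2)
        \<le> (\<Sum>i<?n. (norm (\<Sum>j<?n. A $$ (i, j) * x j))\<^sup>2) * (\<Sum>j<?n. (norm (w j))\<^sup>2)"
    using exists_maximal_column [of ?n A] by auto
  define v where "v = col_mat ?n x"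
  have v [simp]: "v \<in> carrier_mat ?n 1" and v1: "frob v = 1"
    using x1 by (simp_all only: v_def col_mat_carrier frob_col_mat)
  have maxv: "frob (A * w) \<le> frob (A * v) * frob w" if "w \<in> carrier_mat ?n 1" for w
  proof -
    define y where "y i = w $$ (i, 0)" for i
    have w: "w = col_mat ?n y" unfolding y_def by (rule col_mat_eta [OF that])
    show ?thesis unfolding w v_def mult_col_mat [OF A] frob_col_mat by (rule max)
  qed
  obtain Q r where Q: "qunitary ?n Q" "0 \<le> r" "r\<^sup>2 = frob v"
    and Qv: "qadjoint Q * v = col_mat ?n (\<lambda>i. if i = m then of_real r else 0)"
    using unitary_col_reduction [OF v] by blast
  have r: "r = 1" using Q v1 by (simp add: power2_eq_1_iff)
  obtain U \<sigma> where U: "qunitary ?n U" "0 \<le> \<sigma>" "\<sigma>\<^sup>2 = frob (A * v)"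
    and Uv: "qadjoint U * (A * v) = col_mat ?n (\<lambda>i. if i = m then of_real \<sigma> else 0)"
    using unitary_col_reduction [of "A * v" m] mult_carrier_mat [OF A v] by blast
  have c [simp]: "Q \<in> carrier_mat ?n ?n" "U \<in> carrier_mat ?n ?n"
    using Q U by (auto intro: qunitary_carrier)
  have assoc: "X * Y * Z = X * (Y * Z)" if "X \<in> carrier_mat ?n ?n" "Y \<in> carrier_mat ?n ?n" "Z \<in> carrier_mat ?n k" for X Y Z :: "quat mat" and k
    using that by (rule assoc_mult_mat)
  have one: "X * (Y * Z) = Z" if "X * Y = 1\<^sub>m ?n" "X \<in> carrier_mat ?n ?n" "Y \<in> carrier_mat ?n ?n" "Z \<in> carrier_mat ?n k" for X Y Z :: "quat mat" and k
    using that assoc [of X Y Z] by (simp add: left_mult_one_mat [of _ ?n k])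
  have cl [simp]: "X * Y \<in> carrier_mat ?n k" if "X \<in> carrier_mat ?n ?n" "Y \<in> carrier_mat ?n k" for X Y :: "quat mat" and k
    using that by (rule mult_carrier_mat)
  have QQ: "Q * qadjoint Q = 1\<^sub>m ?n" "qadjoint Q * Q = 1\<^sub>m ?n" and UU: "U * qadjoint U = 1\<^sub>m ?n"
    using Q(1) U(1) by (auto simp: qunitary_def)
  have v_eq: "v = Q * ?e"
  proof -
    have "Q * (qadjoint Q * v) = v" by (rule one [OF QQ(1) _ _ v]) auto
    then show ?thesis unfolding Qv r of_real_1 by (rule sym)
  qed
  define B where "B = qadjoint U * (A * Q)"
  have B [simp]: "B \<in> carrier_mat ?n ?n" by (simp add: B_def)
  have Bw: "B * w = qadjoint U * (A * (Q * w))" if "w \<in> carrier_mat ?n 1" for w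
    unfolding B_def using that by (simp add: assoc [where k = 1] del: One_nat_def)
  have "B * ?e = col_mat ?n (\<lambda>i. if i = m then of_real \<sigma> else 0)"
    by (subst Bw [OF col_mat_carrier]) (simp only: v_eq [symmetric] Uv)
  then have "col_mat ?n (\<lambda>i. \<Sum>j<?n. B $$ (i, j) * (if j = m then 1 else 0)) = col_mat ?n (\<lambda>i. if i = m then of_real \<sigma> else 0)"
    by (simp only: mult_col_mat [OF B])
  then have "col_mat ?n (\<lambda>i. B $$ (i, m)) = col_mat ?n (\<lambda>i. if i = m then of_real \<sigma> else 0)"
    by (simp add: if_distrib [of "\<lambda>x. _ * x"] cong: if_cong)
  then have idx: "col_mat ?n (\<lambda>i. B $$ (i, m)) $$ (i, 0) = col_mat ?n (\<lambda>i. if i = m then of_real \<sigma> else 0) $$ (i, 0)" for i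
    by simp
  have Bcol: "B $$ (i, m) = (if i = m then of_real \<sigma> else 0)" if "i < ?n" for i
    using idx [of i] by (simp only: col_mat_index [OF that])
  define \<rho> where "\<rho> = (\<Sum>j<?n. (norm (B $$ (m, j)))\<^sup>2)"
  \<comment> \<open>the vector on which the last row of \<open>B\<close> is tested\<close>
  define z where "z = col_mat ?n (\<lambda>j. qcnj (B $$ (m, j)))"
  have z: "z \<in> carrier_mat ?n 1" by (simp only: z_def col_mat_carrier)
  have "\<rho>\<^sup>2 \<le> frob (B * z)"
  proof -
    have "(\<Sum>j<?n. B $$ (m, j) * qcnj (B $$ (m, j))) = of_real \<rho>"
      unfolding \<rho>_def by (simp only: qcnj_mult_self of_real_sum)
    then have "\<rho>\<^sup>2 = (norm (\<Sum>j<?n. B $$ (m, j) * qcnj (B $$ (m, j))))\<^sup>2"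
      by (simp only: norm_of_real power2_abs)
    also have "\<dots> \<le> frob (B * z)"
      unfolding z_def mult_col_mat [OF B] frob_col_mat
      by (rule member_le_sum [where f = "\<lambda>i. (norm (\<Sum>j<?n. B $$ (i, j) * qcnj (B $$ (m, j))))\<^sup>2"]) auto
    finally show ?thesis .
  qed
  also have "frob (B * z) = frob (A * (Q * z))"
    unfolding Bw [OF z] by (rule frob_unitary [OF qunitary_adjoint [OF U(1)] cl [OF A cl [OF c(1) z]]])
  also have "\<dots> \<le> frob (A * v) * frob (Q * z)"
    by (rule maxv [OF cl [OF c(1) z]])
  also have "\<dots> = \<sigma>\<^sup>2 * \<rho>"
    unfolding U(3) frob_unitary [OF Q(1) z] by (simp add: z_def frob_col_mat \<rho>_def)
  finally have le: "\<rho> * \<rho> \<le> \<sigma>\<^sup>2 * \<rho>" by (simp add: power2_eq_square)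
  define T where "T = (\<Sum>j<m. (norm (B $$ (m, j)))\<^sup>2)"
  have \<rho>: "\<rho> = T + \<sigma>\<^sup>2"
    by (simp add: \<rho>_def T_def Bcol)
  have "0 \<le> T" unfolding T_def by (rule sum_nonneg) simp
  moreover have "T * T + T * \<sigma>\<^sup>2 \<le> 0" using le by (simp add: \<rho> algebra_simps)
  moreover have "0 \<le> T * \<sigma>\<^sup>2" using \<open>0 \<le> T\<close> by simp
  moreover have "0 \<le> T * T" by simp
  ultimately have "T * T = 0" by linarith
  then have "(\<Sum>j<m. (norm (B $$ (m, j)))\<^sup>2) = 0" by (simp add: T_def)
  then have Brow: "B $$ (m, j) = 0" if "j < m" for j
    using that by (subst (asm) sum_nonneg_eq_0_iff) auto
  define B' where "B' = mat m m (\<lambda>(i, j). B $$ (i, j))"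
  have B' [simp]: "B' \<in> carrier_mat m m" by (simp add: B'_def)
  have B_eq: "B = bdiag m B' (of_real \<sigma>)"
    using carrier_matD [OF B] Brow Bcol by (intro eq_matI) (auto simp: bdiag_def B'_def less_Suc_eq)
  obtain s where "is_qsingular_values B' s" using Suc.IH [OF B'] by blast
  then obtain U' V' where s: "length s = m" "\<forall>x\<in>set s. 0 \<le> x" and UV': "qunitary m U'" "qunitary m V'"
    and B'_eq: "B' = U' * mat_diag m (\<lambda>i. of_real (s ! i)) * qadjoint V'"
    unfolding is_qsingular_values_def by (auto simp: B'_def)
  have c' [simp]: "U' \<in> carrier_mat m m" "V' \<in> carrier_mat m m"
    using UV' by (auto intro: qunitary_carrier)
  let ?D = "mat_diag ?n (\<lambda>i. of_real ((s @ [\<sigma>]) ! i)) :: quat mat"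
  have D: "?D = bdiag m (mat_diag m (\<lambda>i. of_real (s ! i))) (of_real \<sigma>)"
    using s by (intro eq_matI) (auto simp: bdiag_def mat_diag_def nth_append less_Suc_eq)
  have "bdiag m U' 1 * ?D * qadjoint (bdiag m V' 1) = B"
    unfolding D B_eq B'_eq by (simp add: qadjoint_bdiag bdiag_mult mult_carrier_mat [of _ m m])
  note BD = this
  have AB: "A = U * (B * qadjoint Q)"
  proof -
    have "B * qadjoint Q = qadjoint U * (A * (Q * qadjoint Q))"
      unfolding B_def by (simp add: assoc [where k = ?n])
    also have "\<dots> = qadjoint U * A" by (simp add: QQ right_mult_one_mat [of _ ?n ?n])
    finally show ?thesis by (simp add: one [OF UU, where k = ?n])
  qed
  have "(U * bdiag m U' 1) * ?D * qadjoint (Q * bdiag m V' 1)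
     = U * (bdiag m U' 1 * ?D * qadjoint (bdiag m V' 1) * qadjoint Q)"
    by (simp add: assoc [where k = ?n] qadjoint_mult [of _ ?n ?n _ ?n] qadjoint_carrier [of _ ?n ?n])
  then have SVD: "A = (U * bdiag m U' 1) * ?D * qadjoint (Q * bdiag m V' 1)"
    by (simp only: BD AB [symmetric])
  have "is_qsingular_values A (s @ [\<sigma>])"
    unfolding is_qsingular_values_def carrier_matD(1) [OF A]
  proof (intro conjI exI)
    show "qunitary ?n (U * bdiag m U' 1)" "qunitary ?n (Q * bdiag m V' 1)"
      using Q U UV' by (auto intro!: qunitary_mult qunitary_bdiag)
    show "A = (U * bdiag m U' 1) * ?D * qadjoint (Q * bdiag m V' 1)" by (rule SVD)
  qed (use s U(2) in auto)
  then show ?case by blast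
qed


section \<open>The real representation and the Study determinant\<close>

definition qbasis :: "nat \<Rightarrow> quat" where
  "qbasis k = (if k = 0 then Quat 1 0 0 0 else if k = 1 then Quat 0 1 0 0
     else if k = 2 then Quat 0 0 1 0 else Quat 0 0 0 1)"

text \<open>The matrix of left multiplication by \<open>A\<close> on real coordinates. The \<open>4 \<times> 4\<close> block of an entry stays together, so
that block triangular quaternionic matrices have block triangular representations.\<close>

definition real_rep :: "quat mat \<Rightarrow> real mat" where
  "real_rep A = mat (dim_row A * 4) (dim_col A * 4)
     (\<lambda>(i, j). inner (qbasis (i mod 4)) (A $$ (i div 4, j div 4) * qbasis (j mod 4)))"

text \<open>The square of the Study determinant, see \<open>Sdet_square\<close>. A singular value \<open>\<sigma>\<close> contributes \<open>\<sigma>\<^sup>4\<close> to the real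
determinant, whence the square root.\<close>

definition Sdet2 :: "quat mat \<Rightarrow> real" where
  "Sdet2 A = sqrt \<bar>Determinant.det (real_rep A)\<bar>"

lemma less_4_cases: "(a :: nat) < 4 \<Longrightarrow> a = 0 \<or> a = 1 \<or> a = 2 \<or> a = 3"
  by auto

lemma sum_less_4: "(\<Sum>c<4. f c) = f 0 + f 1 + f 2 + f (3 :: nat)"
  by (simp add: eval_nat_numeral)

lemma inner_qbasis: "a < 4 \<Longrightarrow> b < 4 \<Longrightarrow> inner (qbasis a) (qbasis b) = (if a = b then 1 else 0)"
  using less_4_cases [of a] less_4_cases [of b] by (auto simp: qbasis_def inner_quat_def)

lemma qbasis_expansion: "(\<Sum>c<4. inner (qbasis c) x *\<^sub>R qbasis c) = x"
  unfolding sum_less_4 by (simp add: qbasis_def inner_quat_def quat_eq_iff)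

lemma real_rep_carrier [simp]: "A \<in> carrier_mat n k \<Longrightarrow> real_rep A \<in> carrier_mat (n * 4) (k * 4)"
  by (auto simp: real_rep_def)

lemma real_rep_entry:
  "A \<in> carrier_mat n k \<Longrightarrow> i < n * 4 \<Longrightarrow> j < k * 4 \<Longrightarrow>
     real_rep A $$ (i, j) = inner (qbasis (i mod 4)) (A $$ (i div 4, j div 4) * qbasis (j mod 4))"
  by (auto simp: real_rep_def)

lemma sum_blocks_4: "(\<Sum>q<n * 4. f q) = (\<Sum>l<n. \<Sum>c<4. f (l * 4 + c :: nat))"
proof -
  have "(\<Sum>q<n * 4. f q) = (\<Sum>l<n. sum f {l * 4..<l * 4 + 4})" by (rule sum.nat_group [symmetric])
  also have "\<dots> = (\<Sum>l<n. \<Sum>c<4. f (l * 4 + c))"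
    using sum.shift_bounds_nat_ivl [of f 0 "l * 4" 4 for l]
    by (simp add: lessThan_atLeast0 add.commute)
  finally show ?thesis .
qed

lemma real_rep_mult:
  assumes A: "A \<in> carrier_mat n k" and B: "B \<in> carrier_mat k l"
  shows "real_rep (A * B) = real_rep A * real_rep B"
proof (rule eq_matI)
  fix i j assume "i < dim_row (real_rep A * real_rep B)" "j < dim_col (real_rep A * real_rep B)"
  then have ij: "i < n * 4" "j < l * 4" using A B by (auto simp: real_rep_def)
  then have ij': "i div 4 < n" "j div 4 < l" by auto
  let ?a = "qbasis (i mod 4)" and ?b = "qbasis (j mod 4)"
  have "(real_rep A * real_rep B) $$ (i, j) = (\<Sum>q<k * 4. real_rep A $$ (i, q) * real_rep B $$ (q, j))"
    using A B ij by (subst index_mult_mat) (auto simp: scalar_prod_def lessThan_atLeast0 real_rep_def)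
  also have "\<dots> = (\<Sum>p<k. \<Sum>c<4. real_rep A $$ (i, p * 4 + c) * real_rep B $$ (p * 4 + c, j))"
    by (rule sum_blocks_4)
  also have "\<dots> = (\<Sum>p<k. inner ?a (A $$ (i div 4, p) * (B $$ (p, j div 4) * ?b)))"
  proof (rule sum.cong [OF refl])
    fix p assume "p \<in> {..<k}"
    then have p: "p * 4 + c < k * 4" if "c < 4" for c using that by auto
    have "(\<Sum>c<4. real_rep A $$ (i, p * 4 + c) * real_rep B $$ (p * 4 + c, j))
       = (\<Sum>c<4. inner ?a (A $$ (i div 4, p) * (inner (qbasis c) (B $$ (p, j div 4) * ?b) *\<^sub>R qbasis c)))"
      using p ij by (intro sum.cong refl) (simp add: real_rep_entry [OF A] real_rep_entry [OF B])
    also have "\<dots> = inner ?a (A $$ (i div 4, p) * (\<Sum>c<4. inner (qbasis c) (B $$ (p, j div 4) * ?b) *\<^sub>R qbasis c))"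
      by (simp only: inner_sum_right sum_distrib_left)
    finally show "(\<Sum>c<4. real_rep A $$ (i, p * 4 + c) * real_rep B $$ (p * 4 + c, j))
       = inner ?a (A $$ (i div 4, p) * (B $$ (p, j div 4) * ?b))"
      unfolding qbasis_expansion .
  qed
  also have "\<dots> = inner ?a ((A * B) $$ (i div 4, j div 4) * ?b)"
    unfolding mat_mult_entry [OF A B ij'] by (simp only: inner_sum_right sum_distrib_right mult.assoc)
  also have "\<dots> = real_rep (A * B) $$ (i, j)"
    using ij A B by (subst real_rep_entry [of _ n l]) auto
  finally show "real_rep (A * B) $$ (i, j) = (real_rep A * real_rep B) $$ (i, j)" by simp
qed (use A B in \<open>auto simp: real_rep_def\<close>)

lemma real_rep_adjoint: "A \<in> carrier_mat n k \<Longrightarrow> real_rep (qadjoint A) = transpose_mat (real_rep A)"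
  by (rule eq_matI)
    (auto simp: real_rep_def qadjoint_def inner_quat_mult_left inner_commute [of "qbasis a" "qcnj x * y" for a x y])

lemma real_rep_scalar:
  "real_rep (mat_diag n (\<lambda>_. of_real r)) = r \<cdot>\<^sub>m 1\<^sub>m (n * 4)"
proof (rule eq_matI)
  fix i j assume "i < dim_row (r \<cdot>\<^sub>m 1\<^sub>m (n * 4))" "j < dim_col (r \<cdot>\<^sub>m 1\<^sub>m (n * 4))"
  then have ij: "i < n * 4" "j < n * 4" by auto
  have eq: "i = j \<longleftrightarrow> i div 4 = j div 4 \<and> i mod 4 = j mod 4"
    by (metis div_mult_mod_eq)
  show "real_rep (mat_diag n (\<lambda>_. of_real r)) $$ (i, j) = (r \<cdot>\<^sub>m 1\<^sub>m (n * 4)) $$ (i, j)"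
    using ij eq by (auto simp: real_rep_def mat_diag_def of_real_def inner_qbasis)
qed (auto simp: real_rep_def mat_diag_def)

lemma Sdet2_mult:
  assumes "A \<in> carrier_mat n n" "B \<in> carrier_mat n n"
  shows "Sdet2 (A * B) = Sdet2 A * Sdet2 B"
  unfolding Sdet2_def real_rep_mult [OF assms]
  by (subst Determinant.det_mult [of _ "n * 4"]) (use assms in \<open>auto simp: abs_mult real_sqrt_mult\<close>)

lemma Sdet2_adjoint: "A \<in> carrier_mat n n \<Longrightarrow> Sdet2 (qadjoint A) = Sdet2 A"
  unfolding Sdet2_def by (simp add: real_rep_adjoint [of A n n] Determinant.det_transpose [of _ "n * 4"])

lemma Sdet2_scalar: "Sdet2 (mat_diag n (\<lambda>_. of_real r)) = \<bar>r\<bar> ^ (n * 2)"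
proof -
  have "\<bar>r\<bar> ^ (n * 4) = (\<bar>r\<bar> ^ (n * 2))\<^sup>2" by (simp only: power_mult [symmetric] mult.assoc) simp
  then show ?thesis by (simp add: Sdet2_def real_rep_scalar power_abs)
qed

lemma Sdet2_nonneg: "0 \<le> Sdet2 A" by (simp add: Sdet2_def)

lemma Sdet2_unitary:
  assumes "qunitary n U"
  shows "Sdet2 U = 1"
proof -
  have c: "U \<in> carrier_mat n n" by (rule qunitary_carrier [OF assms])
  have "Sdet2 U * Sdet2 U = Sdet2 (U * qadjoint U)"
    using c by (simp add: Sdet2_mult [of _ n] Sdet2_adjoint)
  also have "U * qadjoint U = mat_diag n (\<lambda>_. of_real 1)"
    using assms by (simp add: qunitary_def)
  also have "Sdet2 \<dots> = 1" by (simp only: Sdet2_scalar) simp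
  finally show ?thesis using Sdet2_nonneg [of U] by (metis abs_of_nonneg power2_eq_1_iff power2_eq_square abs_minus_cancel abs_one)
qed

text \<open>Multiplying by the adjoint gives the scalar matrix of \<open>|x|\<^sup>2\<close>, whose real representation is a multiple of
the identity.\<close>

lemma Sdet2_1x1: "Sdet2 (mat 1 1 (\<lambda>_. x)) = (norm x)\<^sup>2"
proof -
  let ?X = "mat 1 1 (\<lambda>_. x)"
  have c: "?X \<in> carrier_mat 1 1" by simp
  have "Sdet2 ?X * Sdet2 ?X = Sdet2 (qadjoint ?X * ?X)"
    using c Sdet2_mult [of "qadjoint ?X" 1 ?X] Sdet2_adjoint [OF c] by (simp del: One_nat_def)
  also have "qadjoint ?X * ?X = mat_diag 1 (\<lambda>_. of_real ((norm x)\<^sup>2))"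
    unfolding adjoint_mult_col [OF c] by (rule eq_matI) (auto simp: mat_diag_def frob_def)
  also have "Sdet2 \<dots> = (norm x)\<^sup>2 * (norm x)\<^sup>2"
    by (simp only: Sdet2_scalar) (simp add: power2_eq_square)
  finally have "(Sdet2 ?X)\<^sup>2 = ((norm x)\<^sup>2)\<^sup>2" by (simp only: power2_eq_square)
  then show ?thesis by (rule power2_eq_imp_eq) (auto simp: Sdet2_nonneg)
qed

lemma Sdet2_block:
  assumes A: "A \<in> carrier_mat (Suc m) (Suc m)" and zero: "\<And>j. j < m \<Longrightarrow> A $$ (m, j) = 0"
  shows "Sdet2 A = (norm (A $$ (m, m)))\<^sup>2 * Sdet2 (mat m m (\<lambda>ij. A $$ ij))"
proof -
  let ?B = "mat m m (\<lambda>ij. A $$ ij)" and ?X = "mat 1 1 (\<lambda>_. A $$ (m, m)) :: quat mat"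
  let ?C = "mat (m * 4) 4 (\<lambda>(i, j). real_rep A $$ (i, j + m * 4))"
  have cB: "real_rep ?B \<in> carrier_mat (m * 4) (m * 4)" by (rule real_rep_carrier) simp
  have cX: "real_rep ?X \<in> carrier_mat 4 4" using real_rep_carrier [of ?X 1 1] by simp
  have F: "real_rep A = four_block_mat (real_rep ?B) ?C (0\<^sub>m 4 (m * 4)) (real_rep ?X)" (is "_ = ?F")
  proof (rule eq_matI)
    have dims: "dim_row (real_rep ?B) = m * 4" "dim_col (real_rep ?B) = m * 4" "dim_row (real_rep ?X) = 4" "dim_col (real_rep ?X) = 4"
      by (rule carrier_matD [OF cB] carrier_matD [OF cX])+
    fix i j assume "i < dim_row ?F" "j < dim_col ?F"
    then have ij: "i < m * 4 + 4" "j < m * 4 + 4" by (simp_all add: dims del: One_nat_def)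
    then have ij': "i < Suc m * 4" "j < Suc m * 4" by auto
    have last: "k div 4 = m" "(k - m * 4) div 4 = 0" "(k - m * 4) mod 4 = k mod 4" "k - m * 4 < 4"
      if "\<not> k < m * 4" "k < m * 4 + 4" for k :: nat
    proof -
      obtain c where "k = m * 4 + c" "c < 4" using \<open>\<not> k < m * 4\<close> \<open>k < m * 4 + 4\<close>
        by (metis add_less_cancel_left le_Suc_ex not_less)
      then show "k div 4 = m" "(k - m * 4) div 4 = 0" "(k - m * 4) mod 4 = k mod 4" "k - m * 4 < 4" by auto
    qed
    have first: "k div 4 < m" if "k < m * 4" for k :: nat using that by auto
    have eA: "real_rep A $$ (i, j) = inner (qbasis (i mod 4)) (A $$ (i div 4, j div 4) * qbasis (j mod 4))"
      by (rule real_rep_entry [OF A ij'])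
    show "real_rep A $$ (i, j) = ?F $$ (i, j)"
    proof (cases "i < m * 4"; cases "j < m * 4")
      assume "i < m * 4" "j < m * 4"
      then show ?thesis using ij first by (simp add: dims eA real_rep_entry [of _ m m] del: One_nat_def)
    next
      assume "i < m * 4" "\<not> j < m * 4"
      then show ?thesis using ij by (simp add: dims del: One_nat_def)
    next
      assume "\<not> i < m * 4" "j < m * 4"
      then show ?thesis using ij last [of i] first [of j] by (simp add: dims eA zero del: One_nat_def)
    next
      assume "\<not> i < m * 4" "\<not> j < m * 4"
      then show ?thesis using ij last [of i] last [of j]
        by (simp add: dims eA real_rep_entry [of _ 1 1] del: One_nat_def)
    qed
  qed (use cB cX A in \<open>auto simp: real_rep_def\<close>)
  have "Determinant.det (real_rep A) = Determinant.det (real_rep ?B) * Determinant.det (real_rep ?X)"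
    by (subst F) (rule det_four_block_mat_lower_left_zero [OF cB mat_carrier refl cX])
  then have "Sdet2 A = Sdet2 ?B * Sdet2 ?X"
    by (simp add: Sdet2_def abs_mult real_sqrt_mult)
  then show ?thesis by (simp add: Sdet2_1x1 del: One_nat_def)
qed

lemma Sdet2_diag: "Sdet2 (mat_diag n (\<lambda>i. of_real (f i))) = (\<Prod>i<n. f i)\<^sup>2"
proof (induction n)
  case 0
  have "mat_diag 0 (\<lambda>i. of_real (f i) :: quat) = mat_diag 0 (\<lambda>_. of_real 1)"
    by (rule eq_matI) (auto simp: mat_diag_def)
  then show ?case by (simp only: Sdet2_scalar) simp
next
  case (Suc n)
  have "mat n n (\<lambda>ij. mat_diag (Suc n) (\<lambda>i. of_real (f i) :: quat) $$ ij) = mat_diag n (\<lambda>i. of_real (f i))"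
    by (rule eq_matI) (auto simp: mat_diag_def)
  then show ?case
    using Suc by (subst Sdet2_block [of _ n]) (auto simp: mat_diag_def power_mult_distrib)
qed

text \<open>Since \<^const>\<open>Sdet2\<close> is multiplicative and equal to \<open>1\<close> on unitary matrices, it depends on a matrix only through
the diagonal factor of any of its singular value decompositions.\<close>

lemma Sdet_square:
  assumes A: "A \<in> carrier_mat n n"
  shows "(Sdet A)\<^sup>2 = Sdet2 A"
proof -
  have "is_qsingular_values A (qsingular_values A)"
    unfolding qsingular_values_def using exists_qsingular_values [OF A] by (rule someI_ex)
  then obtain U V where s: "length (qsingular_values A) = n" and UV: "qunitary n U" "qunitary n V"
    and eq: "A = U * mat_diag n (\<lambda>i. of_real (qsingular_values A ! i)) * qadjoint V"
    using A unfolding is_qsingular_values_def by auto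
  have c: "U \<in> carrier_mat n n" "V \<in> carrier_mat n n" using UV by (auto intro: qunitary_carrier)
  have "Sdet2 A = Sdet2 (U * mat_diag n (\<lambda>i. of_real (qsingular_values A ! i)) * qadjoint V)"
    using eq by simp
  also have "\<dots> = Sdet2 U * Sdet2 (mat_diag n (\<lambda>i. of_real (qsingular_values A ! i)) :: quat mat) * Sdet2 (qadjoint V)"
    using c by (simp add: Sdet2_mult [of _ n] mult_carrier_mat [of _ n n])
  also have "\<dots> = (\<Prod>i<n. qsingular_values A ! i)\<^sup>2"
    using UV by (simp add: Sdet2_unitary Sdet2_unitary [OF qunitary_adjoint [OF UV(2)]] Sdet2_diag)
  also have "(\<Prod>i<n. qsingular_values A ! i) = Sdet A"
    by (simp add: Sdet_def prod.list_conv_set_nth s lessThan_atLeast0)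
  finally show ?thesis by simp
qed

lemma measurable_Sdet2:
  assumes "\<And>i j. i < n \<Longrightarrow> j < n \<Longrightarrow> (\<lambda>x. A x (i, j)) \<in> borel_measurable M"
  shows "(\<lambda>x. Sdet2 (mat n n (A x))) \<in> borel_measurable M"
proof -
  have "(\<lambda>x. Determinant.det (real_rep (mat n n (A x)))) =
    (\<lambda>x. \<Sum>p | p permutes {0..<n * 4}. signof p * (\<Prod>i = 0..<n * 4. inner (qbasis (i mod 4)) (A x (i div 4, p i div 4) * qbasis (p i mod 4))))"
  proof
    fix x
    have "real_rep (mat n n (A x)) $$ (i, p i) = inner (qbasis (i mod 4)) (A x (i div 4, p i div 4) * qbasis (p i mod 4))"
      if "p permutes {0..<n * 4}" "i \<in> {0..<n * 4}" for p i
    proof -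
      have "p i \<in> {0..<n * 4}" using that by (simp only: permutes_in_image)
      then have "p i < n * 4" "p i div 4 < n" by auto
      then show ?thesis using that by (subst real_rep_entry [of _ n n]) auto
    qed
    then show "Determinant.det (real_rep (mat n n (A x))) =
       (\<Sum>p | p permutes {0..<n * 4}. signof p * (\<Prod>i = 0..<n * 4. inner (qbasis (i mod 4)) (A x (i div 4, p i div 4) * qbasis (p i mod 4))))"
      by (subst Determinant.det_def' [of _ "n * 4"]) (auto intro!: sum.cong prod.cong simp del: index_mat)
  qed
  moreover have ent: "(\<lambda>x. inner (qbasis (i mod 4)) (A x (i div 4, p i div 4) * qbasis (p i mod 4))) \<in> borel_measurable M"
    if p: "p permutes {0..<n * 4}" and i: "i \<in> {0..<n * 4}" for p i
  proof -
    have "p i \<in> {0..<n * 4}" using p i by (simp only: permutes_in_image)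
    then have [measurable]: "(\<lambda>x. A x (i div 4, p i div 4)) \<in> borel_measurable M"
      using i by (intro assms) auto
    show ?thesis by measurable
  qed
  ultimately have [measurable]: "(\<lambda>x. Determinant.det (real_rep (mat n n (A x)))) \<in> borel_measurable M"
    by (simp only:) (intro borel_measurable_sum borel_measurable_times borel_measurable_const borel_measurable_prod ent; simp)
  show ?thesis unfolding Sdet2_def by measurable
qed


section \<open>The Laplace transform of the Study determinant\<close>

text \<open>The maps \<open>f i\<close> may differ from one index to another, as they do when every column is multiplied by a unit of its
own.\<close>

lemma distr_PiM_componentwise:
  assumes I: "finite I" and \<gamma>: "prob_space \<gamma>"
    and f: "\<And>i. i \<in> I \<Longrightarrow> f i \<in> measurable \<gamma> \<gamma>" "\<And>i. i \<in> I \<Longrightarrow> distr \<gamma> \<gamma> (f i) = \<gamma>"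
  shows "distr (PiM I (\<lambda>_. \<gamma>)) (PiM I (\<lambda>_. \<gamma>)) (\<lambda>x. \<lambda>i\<in>I. f i (x i)) = PiM I (\<lambda>_. \<gamma>)"
proof -
  interpret \<gamma>: prob_space \<gamma> by fact
  interpret product_sigma_finite "\<lambda>_. \<gamma>" by unfold_locales
  show ?thesis
  proof (rule PiM_eqI [OF I])
    fix A assume A: "\<And>i. i \<in> I \<Longrightarrow> A i \<in> sets \<gamma>"
    have m: "(\<lambda>x. \<lambda>i\<in>I. f i (x i)) \<in> measurable (PiM I (\<lambda>_. \<gamma>)) (PiM I (\<lambda>_. \<gamma>))"
    proof (rule measurable_restrict)
      fix i assume "i \<in> I"
      then show "(\<lambda>x. f i (x i)) \<in> measurable (PiM I (\<lambda>_. \<gamma>)) \<gamma>"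
        using measurable_compose [OF measurable_component_singleton [of i I] f(1) [of i]] by simp
    qed
    have pre: "f i -` A i \<inter> space \<gamma> \<in> sets \<gamma>" if "i \<in> I" for i
      using f(1) A that by (intro measurable_sets) auto
    have "(\<lambda>x. \<lambda>i\<in>I. f i (x i)) -` PiE I A \<inter> space (PiM I (\<lambda>_. \<gamma>)) = (\<Pi>\<^sub>E i\<in>I. f i -` A i \<inter> space \<gamma>)"
      by (auto simp: space_PiM PiE_iff)
    then have "emeasure (distr (PiM I (\<lambda>_. \<gamma>)) (PiM I (\<lambda>_. \<gamma>)) (\<lambda>x. \<lambda>i\<in>I. f i (x i))) (PiE I A)
       = emeasure (PiM I (\<lambda>_. \<gamma>)) (\<Pi>\<^sub>E i\<in>I. f i -` A i \<inter> space \<gamma>)"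
      using m I A by (subst emeasure_distr) (auto intro!: sets_PiM_I_finite)
    also have "\<dots> = (\<Prod>i\<in>I. emeasure \<gamma> (f i -` A i \<inter> space \<gamma>))"
      using I pre by (rule emeasure_PiM)
    also have "\<dots> = (\<Prod>i\<in>I. emeasure (distr \<gamma> \<gamma> (f i)) (A i))"
      using f(1) A by (intro prod.cong refl) (simp add: emeasure_distr)
    also have "\<dots> = (\<Prod>i\<in>I. emeasure \<gamma> (A i))"
      using f(2) by (intro prod.cong refl) simp
    finally show "emeasure (distr (PiM I (\<lambda>_. \<gamma>)) (PiM I (\<lambda>_. \<gamma>)) (\<lambda>x. \<lambda>i\<in>I. f i (x i))) (PiE I A)
      = (\<Prod>i\<in>I. emeasure \<gamma> (A i))" .
  qed simp
qed

definition last_row_mat :: "nat \<Rightarrow> (nat \<Rightarrow> quat) \<Rightarrow> (nat \<times> nat \<Rightarrow> quat) \<Rightarrow> quat mat" where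
  "last_row_mat m x a = mat (Suc m) (Suc m) (set_row m x a)"

definition Sdet2_row_laplace :: "nat \<Rightarrow> real \<Rightarrow> (nat \<Rightarrow> quat) \<Rightarrow> real" where
  "Sdet2_row_laplace m s x = (\<integral>a. exp (- s * Sdet2 (last_row_mat m x a)) \<partial>qginibre m {..<Suc m})"

lemma last_row_mat_carrier [simp]: "last_row_mat m x a \<in> carrier_mat (Suc m) (Suc m)"
  by (simp add: last_row_mat_def)

lemma measurable_Sdet2_last_row [measurable]:
  "(\<lambda>a. Sdet2 (last_row_mat m x a)) \<in> borel_measurable (qginibre m {..<Suc m})"
  unfolding last_row_mat_def
proof (rule measurable_Sdet2)
  fix i j assume "i < Suc m" "j < Suc m"
  then show "(\<lambda>a. set_row m x a (i, j)) \<in> borel_measurable (qginibre m {..<Suc m})"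
    by (cases "i = m") (auto simp: set_row_def intro!: measurable_qginibre_entry [OF _ _ measurable_ident_sets [OF refl]])
qed

lemma Sdet2_mult_unitary: "A \<in> carrier_mat n n \<Longrightarrow> qunitary n Q \<Longrightarrow> Sdet2 (A * Q) = Sdet2 A"
  by (simp add: Sdet2_mult [of A n Q] qunitary_carrier Sdet2_unitary)

text \<open>Multiplying the columns of the whole matrix by units on the right preserves the determinant, and it preserves the law
of the rows above the last one.\<close>

lemma Sdet2_row_laplace_unit:
  assumes u: "\<And>j. norm (u j) = 1"
  shows "Sdet2_row_laplace m s (\<lambda>j. x j * u j) = Sdet2_row_laplace m s x"
proof -
  let ?I = "{..<m} \<times> {..<Suc m}"
  define T where "T a = (\<lambda>ij\<in>?I. a ij * u (snd ij))" for a :: "nat \<times> nat \<Rightarrow> quat"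
  have D: "distr (qginibre m {..<Suc m}) (qginibre m {..<Suc m}) T = qginibre m {..<Suc m}"
    unfolding qginibre_def T_def
    by (rule distr_PiM_componentwise) (auto simp: prob_space_qgauss distr_qgauss_mult_unit [OF u])
  have T: "T \<in> measurable (qginibre m {..<Suc m}) (qginibre m {..<Suc m})"
    unfolding T_def [abs_def] qginibre_def
  proof (rule measurable_restrict)
    fix ij assume "ij \<in> ?I"
    then have "(\<lambda>x. x ij) \<in> measurable (PiM ?I (\<lambda>_. qgauss)) qgauss"
      by (rule measurable_component_singleton)
    then show "(\<lambda>x. x ij * u (snd ij)) \<in> measurable (PiM ?I (\<lambda>_. qgauss)) qgauss"
      by (simp cong: measurable_cong_sets)
  qed
  have det: "Sdet2 (last_row_mat m (\<lambda>j. x j * u j) (T a)) = Sdet2 (last_row_mat m x a)" for a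
  proof -
    have "last_row_mat m (\<lambda>j. x j * u j) (T a) = last_row_mat m x a * mat_diag (Suc m) u"
      unfolding mat_diag_mult_right [OF last_row_mat_carrier]
      by (rule eq_matI) (auto simp: last_row_mat_def set_row_def T_def)
    then show ?thesis by (simp add: Sdet2_mult_unitary [OF last_row_mat_carrier] qunitary_unit_diag u)
  qed
  have "Sdet2_row_laplace m s (\<lambda>j. x j * u j)
    = (\<integral>a. exp (- s * Sdet2 (last_row_mat m (\<lambda>j. x j * u j) a)) \<partial>distr (qginibre m {..<Suc m}) (qginibre m {..<Suc m}) T)"
    unfolding D Sdet2_row_laplace_def ..
  also have "\<dots> = (\<integral>a. exp (- s * Sdet2 (last_row_mat m (\<lambda>j. x j * u j) (T a))) \<partial>qginibre m {..<Suc m})"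
    by (rule integral_distr [OF T]) measurable
  finally show ?thesis by (simp add: det Sdet2_row_laplace_def)
qed

text \<open>As for units, with a real rotation of two columns: the determinant is preserved because the rotation is unitary,
the law because the columns are independent copies of a rotation-invariant vector.\<close>

lemma Sdet2_row_laplace_rotate:
  assumes p: "p < m" and cs: "c\<^sup>2 + s\<^sup>2 = 1" and s0: "0 \<le> t"
  shows "Sdet2_row_laplace m t (\<lambda>j. if j = p then c *\<^sub>R x p - s *\<^sub>R x m
      else if j = m then s *\<^sub>R x p + c *\<^sub>R x m else x j) = Sdet2_row_laplace m t x"
proof -
  let ?\<nu> = "qvec {..<m}"
  define y where "y j = (if j = p then c *\<^sub>R x p - s *\<^sub>R x m
      else if j = m then s *\<^sub>R x p + c *\<^sub>R x m else x j)" for j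
  define comb where "comb = (\<lambda>c u d v. \<lambda>i\<in>{..<m}. c *\<^sub>R u i + d *\<^sub>R (v i :: quat))"
  interpret rot_invariant ?\<nu> comb
    by unfold_locales (unfold comb_def, rule rot_inv_PiM [OF _ rot_inv_qgauss], simp)
  let ?C = "{..<Suc m}" and ?D = "{..<Suc m} - {p, m}"
  define f where "f z a = exp (- t * Sdet2 (last_row_mat m z a))" for z a
  have fm: "f z \<in> borel_measurable (qginibre m ?C)" for z
    unfolding f_def [abs_def] by measurable
  have fb: "norm (f z a) \<le> 1" for z a using s0 by (simp add: f_def Sdet2_nonneg)
  have split: "(\<integral>a. f z a \<partial>qginibre m ?C) = (\<integral>a. \<integral>w. f z (set_col p (fst w) (set_col m (snd w) a))
     \<partial>(?\<nu> \<Otimes>\<^sub>M ?\<nu>) \<partial>qginibre m ?D)" for z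
    by (rule integral_split_two_cols) (use p fm fb in auto)
  have det: "Sdet2 (last_row_mat m y (set_col p (comb c u (- s) v) (set_col m (comb s u c v) a)))
     = Sdet2 (last_row_mat m x (set_col p u (set_col m v a)))" for u v a
  proof -
    have "last_row_mat m y (set_col p (comb c u (- s) v) (set_col m (comb s u c v) a))
       = last_row_mat m x (set_col p u (set_col m v a)) * givens (Suc m) p m c s"
      using p by (subst mult_givens [OF last_row_mat_carrier])
        (auto simp: last_row_mat_def set_row_def set_col_def comb_def y_def intro!: eq_matI)
    then show ?thesis using p cs by (simp add: Sdet2_mult_unitary [OF last_row_mat_carrier] qunitary_givens)
  qed
  have "Sdet2_row_laplace m t y = (\<integral>a. f y a \<partial>qginibre m ?C)" by (simp add: Sdet2_row_laplace_def f_def)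
  also have "\<dots> = (\<integral>a. \<integral>w. f x (set_col p (fst w) (set_col m (snd w) a)) \<partial>(?\<nu> \<Otimes>\<^sub>M ?\<nu>) \<partial>qginibre m ?D)"
    unfolding split
  proof (rule Bochner_Integration.integral_cong [OF refl])
    fix a assume a: "a \<in> space (qginibre m ?D)"
    have ins: "insert p (insert m ?D) = ?C" using p by auto
    have "(\<lambda>w. set_col p (fst w) (set_col m (snd w) a)) \<in> measurable (?\<nu> \<Otimes>\<^sub>M ?\<nu>) (qginibre m (insert p (insert m ?D)))"
      by (intro measurable_set_col) (use a in measurable)
    then have "(\<lambda>w. f y (set_col p (fst w) (set_col m (snd w) a))) \<in> borel_measurable (?\<nu> \<Otimes>\<^sub>M ?\<nu>)"
      unfolding ins by (rule measurable_compose [OF _ fm])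
    from integral_rotate [OF this cs]
    show "(\<integral>w. f y (set_col p (fst w) (set_col m (snd w) a)) \<partial>(?\<nu> \<Otimes>\<^sub>M ?\<nu>))
        = (\<integral>w. f x (set_col p (fst w) (set_col m (snd w) a)) \<partial>(?\<nu> \<Otimes>\<^sub>M ?\<nu>))"
      by (simp add: f_def det)
  qed
  also have "\<dots> = Sdet2_row_laplace m t x" unfolding split [symmetric] by (simp add: Sdet2_row_laplace_def f_def [abs_def])
  finally show ?thesis by (simp add: y_def [abs_def])
qed

lemma Sdet2_row_laplace_eq:
  assumes s: "0 \<le> s"
  shows "Sdet2_row_laplace m s x = (\<integral>a. exp (- (s * (\<Sum>j<Suc m. (norm (x j))\<^sup>2)) * Sdet2 (mat m m a)) \<partial>qginibre m {..<m})"
proof -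
  let ?P = "\<lambda>x. Sdet2_row_laplace m s x
      = (\<integral>a. exp (- (s * (\<Sum>j<Suc m. (norm (x j))\<^sup>2)) * Sdet2 (mat m m a)) \<partial>qginibre m {..<m})"
  show "?P x"
  proof (rule row_reduction_induct [where m = m and x = x and P = ?P])
    fix x u :: "nat \<Rightarrow> quat"
    assume u: "\<And>j. norm (u j) = 1" and eq: "?P (\<lambda>j. x j * u j)"
    from eq show "?P x"
      by (simp only: Sdet2_row_laplace_unit [OF u] norm_mult u mult_1_right)
  next
    fix x :: "nat \<Rightarrow> quat" and p and c d :: real
    define y where "y = (\<lambda>j. if j = p then c *\<^sub>R x p - d *\<^sub>R x m
        else if j = m then d *\<^sub>R x p + c *\<^sub>R x m else x j)"
    assume p: "p < m" and cs: "c\<^sup>2 + d\<^sup>2 = 1" and eq: "?P (\<lambda>j. if j = p then c *\<^sub>R x p - d *\<^sub>R x m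
        else if j = m then d *\<^sub>R x p + c *\<^sub>R x m else x j)"
    have sum: "(\<Sum>j<Suc m. (norm (f j))\<^sup>2) = ((norm (f p))\<^sup>2 + (norm (f m))\<^sup>2) + (\<Sum>j\<in>{..<m} - {p}. (norm (f j))\<^sup>2)" for f :: "nat \<Rightarrow> quat"
      using p by (simp add: sum.remove [of "{..<m}" p])
    have "(norm (c *\<^sub>R x p - d *\<^sub>R x m))\<^sup>2 + (norm (d *\<^sub>R x p + c *\<^sub>R x m))\<^sup>2
       = (c\<^sup>2 + d\<^sup>2) * ((norm (x p))\<^sup>2 + (norm (x m))\<^sup>2)"
      unfolding power2_norm_eq_inner inner_diff_left inner_diff_right inner_add_left inner_add_right
      by (simp add: inner_commute [of "x m" "x p"] power2_eq_square algebra_simps)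
    then have "(norm (y p))\<^sup>2 + (norm (y m))\<^sup>2 = (norm (x p))\<^sup>2 + (norm (x m))\<^sup>2"
      using p cs by (simp add: y_def)
    moreover have "(\<Sum>j\<in>{..<m} - {p}. (norm (y j))\<^sup>2) = (\<Sum>j\<in>{..<m} - {p}. (norm (x j))\<^sup>2)"
      by (rule sum.cong) (auto simp: y_def)
    ultimately have "(\<Sum>j<Suc m. (norm (y j))\<^sup>2) = (\<Sum>j<Suc m. (norm (x j))\<^sup>2)"
      by (simp only: sum)
    then show "?P x"
      using eq unfolding Sdet2_row_laplace_rotate [OF p cs s] by (simp only: y_def)
  next
    fix x :: "nat \<Rightarrow> quat" and r :: real
    assume r: "0 \<le> r" "\<And>j. j < m \<Longrightarrow> x j = 0" "x m = of_real r"
    interpret v: prob_space "qvec {..<m}" by (rule prob_space_qvec)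
    interpret G: prob_space "qginibre m {..<Suc m}" by (rule prob_space_qginibre)
    have r2: "(\<Sum>j<Suc m. (norm (x j))\<^sup>2) = r\<^sup>2" using r by simp
    have det: "Sdet2 (last_row_mat m x a) = r\<^sup>2 * Sdet2 (mat m m a)" for a
    proof -
      have "mat m m (\<lambda>ij. last_row_mat m x a $$ ij) = mat m m a"
        by (rule eq_matI) (auto simp: last_row_mat_def set_row_def)
      then show ?thesis
        using r by (subst Sdet2_block [of _ m]) (auto simp: last_row_mat_def set_row_def)
    qed
    have "Sdet2_row_laplace m s x = (\<integral>a. exp (- s * Sdet2 (last_row_mat m x a)) \<partial>qginibre m (insert m {..<m}))"
      by (simp add: Sdet2_row_laplace_def lessThan_Suc)
    also have "\<dots> = (\<integral>a. \<integral>u. exp (- s * Sdet2 (last_row_mat m x (set_col m u a))) \<partial>qvec {..<m} \<partial>qginibre m {..<m})"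
    proof (rule integral_split_col)
      show "integrable (qginibre m (insert m {..<m})) (\<lambda>a. exp (- s * Sdet2 (last_row_mat m x a)))"
        unfolding lessThan_Suc [symmetric]
        by (rule G.integrable_const_bound [where B = 1]) (use s in \<open>auto simp: Sdet2_nonneg\<close>)
    qed auto
    also have "\<dots> = (\<integral>a. exp (- (s * r\<^sup>2) * Sdet2 (mat m m a)) \<partial>qginibre m {..<m})"
    proof (rule Bochner_Integration.integral_cong [OF refl])
      fix a
      have "mat m m (set_col m u a) = mat m m a" for u
        by (rule eq_matI) (auto simp: set_col_def)
      then show "(\<integral>u. exp (- s * Sdet2 (last_row_mat m x (set_col m u a))) \<partial>qvec {..<m}) = exp (- (s * r\<^sup>2) * Sdet2 (mat m m a))"
        by (simp add: det v.prob_space mult.assoc)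
    qed
    finally show "?P x"
      by (simp only: r2)
  qed
qed

lemma Sdet2_laplace_eq:
  "0 \<le> s \<Longrightarrow> (\<integral>a. exp (- s * Sdet2 (mat m m a)) \<partial>qginibre m {..<m}) = Sdet2_laplace m s"
proof (induction m arbitrary: s)
  case 0
  interpret G: prob_space "qginibre 0 {..<0}" by (rule prob_space_qginibre)
  have "mat 0 0 a = mat_diag 0 (\<lambda>_. of_real 1 :: quat)" for a
    by (rule eq_matI) (auto simp: mat_diag_def)
  then have "Sdet2 (mat 0 0 a) = 1" for a :: "nat \<times> nat \<Rightarrow> quat" by (simp only: Sdet2_scalar) simp
  then show ?case using G.prob_space by simp
next
  case (Suc m)
  interpret G: prob_space "qginibre (Suc m) {..<Suc m}" by (rule prob_space_qginibre)
  have [measurable]: "(\<lambda>a. Sdet2 (mat (Suc m) (Suc m) a)) \<in> borel_measurable (qginibre (Suc m) {..<Suc m})"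
    by (rule measurable_Sdet2) (auto intro!: measurable_qginibre_entry [OF _ _ measurable_ident_sets [OF refl]])
  have "(\<integral>a. exp (- s * Sdet2 (mat (Suc m) (Suc m) a)) \<partial>qginibre (Suc m) {..<Suc m})
    = (\<integral>x. \<integral>a. exp (- s * Sdet2 (mat (Suc m) (Suc m) (set_row m x a))) \<partial>qginibre m {..<Suc m} \<partial>qvec {..<Suc m})"
    by (rule integral_split_row, simp, rule G.integrable_const_bound [where B = 1])
      (use Suc.prems in \<open>auto simp: Sdet2_nonneg\<close>)
  also have "\<dots> = (\<integral>x. Sdet2_row_laplace m s x \<partial>qvec {..<Suc m})"
    by (simp add: Sdet2_row_laplace_def last_row_mat_def)
  also have "\<dots> = (\<integral>x. Sdet2_laplace m (s * (\<Sum>j<Suc m. (norm (x j))\<^sup>2)) \<partial>qvec {..<Suc m})"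
  proof (rule Bochner_Integration.integral_cong [OF refl])
    fix x :: "nat \<Rightarrow> quat"
    have "0 \<le> s * (\<Sum>j<Suc m. (norm (x j))\<^sup>2)"
      by (intro mult_nonneg_nonneg sum_nonneg Suc.prems zero_le_power2)
    then show "Sdet2_row_laplace m s x = Sdet2_laplace m (s * (\<Sum>j<Suc m. (norm (x j))\<^sup>2))"
      unfolding Sdet2_row_laplace_eq [OF Suc.prems] by (rule Suc.IH)
  qed
  finally show ?case by (simp only: Sdet2_laplace.simps)
qed


section \<open>The row-ordered permanent as a sum over permutations\<close>

text \<open>An injection of \<open>{..<m + 1}\<close> into \<open>C\<close> amounts to its value \<open>j\<close> at \<open>m\<close> and an injection of \<open>{..<m}\<close> into
\<open>C - {j}\<close>.\<close>

lemma row_per_eq_sum_inj: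
  assumes "finite C"
  shows "row_per m C a = (\<Sum>f\<in>{f \<in> {..<m} \<rightarrow>\<^sub>E C. inj_on f {..<m}}. prod_list (map (\<lambda>i. a (i, f i)) [0..<m]))"
  using assms
proof (induction m arbitrary: C)
  case 0
  then show ?case by simp
next
  case (Suc m)
  let ?S = "\<lambda>m C. {f \<in> {..<m} \<rightarrow>\<^sub>E C. inj_on f {..<m}}"
  let ?t = "\<lambda>m f. prod_list (map (\<lambda>i. a (i, f i)) [0..<m])"
  have fin: "finite (?S m C)" if "finite C" for m :: nat and C :: "nat set"
    by (rule finite_subset [of _ "{..<m} \<rightarrow>\<^sub>E C"], blast, intro finite_PiE finite_lessThan that)
  have "row_per (Suc m) C a = (\<Sum>j\<in>C. \<Sum>f\<in>?S m (C - {j}). ?t m f * a (m, j))"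
    using Suc by (simp add: sum_distrib_right)
  also have "\<dots> = (\<Sum>(j, f)\<in>(SIGMA j:C. ?S m (C - {j})). ?t m f * a (m, j))"
    using Suc.prems fin by (subst sum.Sigma) auto
  also have "\<dots> = (\<Sum>f\<in>?S (Suc m) C. ?t (Suc m) f)"
  proof (rule sum.reindex_bij_witness [where i = "\<lambda>f. (f m, restrict f {..<m})" and j = "\<lambda>(j, f). f(m := j)"])
    fix z assume "z \<in> (SIGMA j:C. ?S m (C - {j}))"
    then obtain j f where z: "z = (j, f)" and j: "j \<in> C" and f: "f \<in> {..<m} \<rightarrow>\<^sub>E (C - {j})" "inj_on f {..<m}"
      by auto
    show "(case z of (j, f) \<Rightarrow> f(m := j)) \<in> ?S (Suc m) C"
      using j f by (auto simp: z lessThan_Suc PiE_iff extensional_def inj_on_def)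
    show "((case z of (j, f) \<Rightarrow> f(m := j)) m, restrict (case z of (j, f) \<Rightarrow> f(m := j)) {..<m}) = z"
      using f by (auto simp: z fun_eq_iff PiE_iff extensional_def)
    have "prod_list (map (\<lambda>i. a (i, if i = m then j else f i)) [0..<m]) = prod_list (map (\<lambda>i. a (i, f i)) [0..<m])"
      by (rule arg_cong [of _ _ prod_list]) auto
    then show "?t (Suc m) (case z of (j, f) \<Rightarrow> f(m := j)) = (case z of (j, f) \<Rightarrow> ?t m f * a (m, j))"
      by (simp add: z)
  next
    fix f assume f: "f \<in> ?S (Suc m) C"
    then have fC: "f i \<in> C" if "i < Suc m" for i using that by (auto simp: PiE_iff)
    have inj: "inj_on f {..<Suc m}" using f by simp
    then have "inj_on f {..<m}" by (rule inj_on_subset) auto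
    moreover have "f i \<noteq> f m" if "i < m" for i
      using inj_onD [OF inj, of i m] that by auto
    ultimately show "(f m, restrict f {..<m}) \<in> (SIGMA j:C. ?S m (C - {j}))"
      using fC by (simp add: inj_on_restrict_eq)
    show "(case (f m, restrict f {..<m}) of (j, f) \<Rightarrow> f(m := j)) = f"
      using f by (auto simp: fun_eq_iff PiE_iff extensional_def less_Suc_eq)
  qed
  finally show ?case .
qed

lemma qpermanent_eq_row_per: "qpermanent (mat n n a) = row_per n {..<n} a"
proof -
  have "row_per n {..<n} a = (\<Sum>p | p permutes {0..<n}. prod_list (map (\<lambda>i. a (i, p i)) [0..<n]))"
    unfolding row_per_eq_sum_inj [OF finite_lessThan]
  proof (rule sum.reindex_bij_witness [where j = "\<lambda>f i. if i < n then f i else i" and i = "\<lambda>p. restrict p {..<n}"])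
    fix f assume f: "f \<in> {f \<in> {..<n} \<rightarrow>\<^sub>E {..<n}. inj_on f {..<n}}"
    let ?p = "\<lambda>i. if i < n then f i else i"
    have "inj_on ?p {..<n}" "?p ` {..<n} \<subseteq> {..<n}" using f by (auto simp: inj_on_def PiE_iff)
    then have "bij_betw ?p {..<n} {..<n}"
      unfolding bij_betw_def using endo_inj_surj [OF finite_lessThan] by blast
    then show "?p \<in> {p. p permutes {0..<n}}"
      by (auto simp: lessThan_atLeast0 intro!: bij_imp_permutes)
    show "restrict ?p {..<n} = f"
      using f by (auto simp: fun_eq_iff PiE_iff extensional_def)
    show "prod_list (map (\<lambda>i. a (i, ?p i)) [0..<n]) = prod_list (map (\<lambda>i. a (i, f i)) [0..<n])"
      by (rule arg_cong [of _ _ prod_list]) auto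
  next
    fix p assume p: "p \<in> {p. p permutes {0..<n}}"
    show "(\<lambda>i. if i < n then restrict p {..<n} i else i) = p"
      using p by (auto simp: fun_eq_iff permutes_def)
    show "restrict p {..<n} \<in> {f \<in> {..<n} \<rightarrow>\<^sub>E {..<n}. inj_on f {..<n}}"
      using p permutes_in_image [of p "{0..<n}"] by (auto simp: inj_on_def dest: permutes_inj injD)
  qed
  also have "\<dots> = (\<Sum>p | p permutes {0..<n}. prod_list (map (\<lambda>i. mat n n a $$ (i, p i)) [0..<n]))"
  proof (rule sum.cong [OF refl], rule arg_cong [of _ _ prod_list], rule map_cong [OF refl])
    fix p i assume "p \<in> {p. p permutes {0..<n}}" "i \<in> set [0..<n]"
    then show "a (i, p i) = mat n n a $$ (i, p i)"
      using permutes_in_image [of p "{0..<n}" i] by auto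
  qed
  finally show ?thesis by (simp add: qpermanent_def)
qed


section \<open>Comparison of permanent and determinant\<close>

lemma distr_four_gauss:
  assumes d: "distinct [r, s, t, u]"
  shows "distr (PiM {r, s, t, u} (\<lambda>_. gauss)) borel (\<lambda>y. Quat (y r) (y s) (y t) (y u)) = qgauss"
proof -
  let ?P = "PiM {r, s, t, u} (\<lambda>_. gauss)"
  let ?h = "\<lambda>y. ((y r, y s), (y t, y u))"
  interpret g: prob_space gauss by (rule prob_space_gauss)
  interpret gg: pair_prob_space gauss gauss ..
  interpret product_sigma_finite "\<lambda>_. gauss" by unfold_locales
  have h [measurable]: "?h \<in> measurable ?P gauss4"
    by (intro measurable_Pair measurable_component_singleton) auto
  have "distr ?P gauss4 ?h = gauss4"
  proof (rule measure_eqI)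
    fix X assume "X \<in> sets (distr ?P gauss4 ?h)"
    then have X [measurable]: "X \<in> sets gauss4" by simp
    have f1: "(\<lambda>y. indicator X (?h y) :: ennreal) \<in> borel_measurable (PiM (insert r {s, t, u}) (\<lambda>_. gauss))"
      by measurable
    have f2: "(\<lambda>y. indicator X ((a, y s), (y t, y u)) :: ennreal) \<in> borel_measurable (PiM (insert s {t, u}) (\<lambda>_. gauss))" for a
    proof -
      have "(\<lambda>y. ((a, y s), (y t, y u))) \<in> measurable (PiM (insert s {t, u}) (\<lambda>_. gauss)) gauss4"
        by (intro measurable_Pair measurable_component_singleton) auto
      then show ?thesis by measurable
    qed
    have f3: "(\<lambda>y. indicator X ((a, b), (y t, y u)) :: ennreal) \<in> borel_measurable (PiM (insert t {u}) (\<lambda>_. gauss))" for a b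
    proof -
      have "(\<lambda>y. ((a, b), (y t, y u))) \<in> measurable (PiM (insert t {u}) (\<lambda>_. gauss)) gauss4"
        by (intro measurable_Pair measurable_component_singleton) auto
      then show ?thesis by measurable
    qed
    have "emeasure (distr ?P gauss4 ?h) X = (\<integral>\<^sup>+y. indicator X y \<partial>distr ?P gauss4 ?h)"
      using X by simp
    also have "\<dots> = (\<integral>\<^sup>+y. indicator X (?h y) \<partial>PiM (insert r {s, t, u}) (\<lambda>_. gauss))"
      by (rule nn_integral_distr [OF h]) measurable
    also have "\<dots> = (\<integral>\<^sup>+a. \<integral>\<^sup>+y. indicator X ((a, y s), (y t, y u)) \<partial>PiM (insert s {t, u}) (\<lambda>_. gauss) \<partial>gauss)"
      using d by (subst product_nn_integral_insert_rev [OF _ _ f1]) auto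
    also have "\<dots> = (\<integral>\<^sup>+a. \<integral>\<^sup>+b. \<integral>\<^sup>+y. indicator X ((a, b), (y t, y u)) \<partial>PiM (insert t {u}) (\<lambda>_. gauss) \<partial>gauss \<partial>gauss)"
      using d by (subst product_nn_integral_insert_rev [OF _ _ f2]) auto
    also have "\<dots> = (\<integral>\<^sup>+a. \<integral>\<^sup>+b. \<integral>\<^sup>+c. \<integral>\<^sup>+y. indicator X ((a, b), (c, y u)) \<partial>PiM {u} (\<lambda>_. gauss) \<partial>gauss \<partial>gauss \<partial>gauss)"
      using d by (subst product_nn_integral_insert_rev [OF _ _ f3]) auto
    also have "\<dots> = (\<integral>\<^sup>+a. \<integral>\<^sup>+b. \<integral>\<^sup>+c. \<integral>\<^sup>+e. indicator X ((a, b), (c, e)) \<partial>gauss \<partial>gauss \<partial>gauss \<partial>gauss)"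
      by (intro nn_integral_cong product_nn_integral_singleton) measurable
    also have "\<dots> = (\<integral>\<^sup>+a. \<integral>\<^sup>+b. \<integral>\<^sup>+q. indicator X ((a, b), q) \<partial>(gauss \<Otimes>\<^sub>M gauss) \<partial>gauss \<partial>gauss)"
      by (intro nn_integral_cong) (subst g.nn_integral_fst [symmetric], auto)
    also have "\<dots> = (\<integral>\<^sup>+p. \<integral>\<^sup>+q. indicator X (p, q) \<partial>(gauss \<Otimes>\<^sub>M gauss) \<partial>(gauss \<Otimes>\<^sub>M gauss))"
      by (subst g.nn_integral_fst [symmetric]) auto
    also have "\<dots> = emeasure gauss4 X"
      using X by (subst gg.nn_integral_fst) auto
    finally show "emeasure (distr ?P gauss4 ?h) X = emeasure gauss4 X" .
  qed simp
  then have "qgauss = distr (distr ?P gauss4 ?h) borel quat_of_pairs" by (simp add: qgauss_def)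
  also have "\<dots> = distr ?P borel (quat_of_pairs \<circ> ?h)"
    by (rule distr_distr) (use h in auto)
  finally show ?thesis by (simp add: comp_def)
qed

lemma quat_coordinates_distinct: "distinct [qRe, qIm1, qIm2, qIm3]"
proof -
  have "qRe (Quat 0 1 2 3) \<noteq> qIm1 (Quat 0 1 2 3)" "qRe (Quat 0 1 2 3) \<noteq> qIm2 (Quat 0 1 2 3)"
    "qRe (Quat 0 1 2 3) \<noteq> qIm3 (Quat 0 1 2 3)" "qIm1 (Quat 0 1 2 3) \<noteq> qIm2 (Quat 0 1 2 3)"
    "qIm1 (Quat 0 1 2 3) \<noteq> qIm3 (Quat 0 1 2 3)" "qIm2 (Quat 0 1 2 3) \<noteq> qIm3 (Quat 0 1 2 3)"
    by simp_all
  then show ?thesis by (metis distinct_length_2_or_more distinct_singleton)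
qed

text \<open>The independence of all real coordinates is used twice: grouped by entries it gives the independence of the
entries, and within one entry it gives the law \<^const>\<open>qgauss\<close>.\<close>

lemma distr_quat_gaussian_matrix:
  assumes M: "prob_space M" and n: "1 \<le> n" and G: "quat_gaussian_matrix M n G"
  shows "(\<lambda>\<omega>. \<lambda>ij\<in>{..<n} \<times> {..<n}. G \<omega> $$ ij) \<in> measurable M (qginibre n {..<n})"
    and "distr M (qginibre n {..<n}) (\<lambda>\<omega>. \<lambda>ij\<in>{..<n} \<times> {..<n}. G \<omega> $$ ij) = qginibre n {..<n}"
proof -
  interpret prob_space M by fact
  let ?K = "{qRe, qIm1, qIm2, qIm3}"
  let ?I = "{..<n} \<times> {..<n}"
  define X where "X = (\<lambda>(i, j, c) \<omega>. (c :: quat \<Rightarrow> real) (G \<omega> $$ (i, j)))"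
  define L where "L ij = {(fst ij, snd ij, c) | c. c \<in> ?K}" for ij :: "nat \<times> nat"
  have indep: "indep_vars (\<lambda>_. borel) X ({..<n} \<times> {..<n} \<times> ?K)"
    using G by (simp add: quat_gaussian_matrix_def X_def lessThan_atLeast0)
  have Xd: "distributed M lborel (X (i, j, c)) (normal_density 0 (1/2))" if "i < n" "j < n" "c \<in> ?K" for i j c
    using G that unfolding quat_gaussian_matrix_def X_def by auto
  have Lsub: "L ij \<subseteq> {..<n} \<times> {..<n} \<times> ?K" if "ij \<in> ?I" for ij
    using that by (auto simp: L_def)
  have L4: "L (i, j) = {(i, j, qRe), (i, j, qIm1), (i, j, qIm2), (i, j, qIm3)}" for i j
    by (auto simp: L_def)
  define \<phi> where "\<phi> ij y = Quat (y (fst ij, snd ij, qRe)) (y (fst ij, snd ij, qIm1)) (y (fst ij, snd ij, qIm2)) (y (fst ij, snd ij, qIm3))"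
    for ij :: "nat \<times> nat" and y :: "nat \<times> nat \<times> (quat \<Rightarrow> real) \<Rightarrow> real"
  have \<phi>_meas: "\<phi> ij \<in> borel_measurable (PiM (L ij) (\<lambda>_. borel))" for ij
    unfolding \<phi>_def [abs_def]
    by (intro borel_measurable_Quat measurable_component_singleton) (auto simp: L_def)
  have \<phi>_X: "\<phi> ij (restrict (\<lambda>t. X t \<omega>) (L ij)) = G \<omega> $$ ij" for ij \<omega>
    by (cases ij) (simp add: \<phi>_def L4 X_def quat_eq_iff)
  have "indep_vars (\<lambda>ij. PiM (L ij) (\<lambda>_. borel)) (\<lambda>ij \<omega>. restrict (\<lambda>t. X t \<omega>) (L ij)) ?I"
    by (rule indep_vars_restrict [OF indep Lsub]) (auto simp: disjoint_family_on_def L_def)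
  from indep_vars_compose2 [OF this \<phi>_meas]
  have ind: "indep_vars (\<lambda>_. borel) (\<lambda>ij \<omega>. G \<omega> $$ ij) ?I" by (simp only: \<phi>_X)
  have rv: "(\<lambda>\<omega>. G \<omega> $$ ij) \<in> borel_measurable M" if "ij \<in> ?I" for ij
    using ind that unfolding indep_vars_def by blast
  have law: "distr M borel (\<lambda>\<omega>. G \<omega> $$ ij) = qgauss" if ij: "ij \<in> ?I" for ij
  proof -
    obtain i j where [simp]: "ij = (i, j)" and ij': "i < n" "j < n" using ij by auto
    have Xm: "X t \<in> borel_measurable M" and Xl: "distr M borel (X t) = gauss" if "t \<in> L ij" for t
    proof -
      have "\<exists>c. t = (i, j, c) \<and> c \<in> ?K" using that by (simp add: L_def)
      then obtain c where t: "t = (i, j, c)" "c \<in> ?K" by blast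
      have D: "distributed M lborel (X t) (normal_density 0 (1/2))" using Xd ij' t by simp
      show "X t \<in> borel_measurable M"
        using distributed_measurable [OF D] by (simp cong: measurable_cong_sets)
      have "distr M borel (X t) = distr M lborel (X t)" by (rule distr_cong) auto
      also have "\<dots> = gauss" by (rule distributed_distr_eq_density [OF D])
      finally show "distr M borel (X t) = gauss" .
    qed
    have "indep_vars (\<lambda>_. borel) X (L ij)" using indep Lsub [OF ij] by (rule indep_vars_subset)
    then have "distr M (PiM (L ij) (\<lambda>_. borel)) (\<lambda>\<omega>. \<lambda>t\<in>L ij. X t \<omega>) = PiM (L ij) (\<lambda>t. distr M borel (X t))"
      by (subst (asm) indep_vars_iff_distr_eq_PiM') (auto simp: Xm, auto simp: L4)
    also have "\<dots> = PiM (L ij) (\<lambda>_. gauss)" by (rule PiM_cong) (auto simp: Xl)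
    finally have D: "distr M (PiM (L ij) (\<lambda>_. borel)) (\<lambda>\<omega>. \<lambda>t\<in>L ij. X t \<omega>) = PiM (L ij) (\<lambda>_. gauss)" .
    have "distr M borel (\<lambda>\<omega>. G \<omega> $$ ij) = distr M borel (\<phi> ij \<circ> (\<lambda>\<omega>. \<lambda>t\<in>L ij. X t \<omega>))"
      by (simp only: comp_def \<phi>_X)
    also have "\<dots> = distr (distr M (PiM (L ij) (\<lambda>_. borel)) (\<lambda>\<omega>. \<lambda>t\<in>L ij. X t \<omega>)) borel (\<phi> ij)"
      by (rule distr_distr [symmetric, OF \<phi>_meas]) (rule measurable_restrict, rule Xm)
    also have "\<dots> = distr (PiM (L ij) (\<lambda>_. gauss)) borel (\<phi> ij)" by (simp only: D)
    also have "\<dots> = qgauss"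
      using distr_four_gauss [of "(i, j, qRe)" "(i, j, qIm1)" "(i, j, qIm2)" "(i, j, qIm3)"] quat_coordinates_distinct
      by (simp add: L4 \<phi>_def [abs_def])
    finally show ?thesis .
  qed
  have sets: "sets (qginibre n {..<n}) = sets (PiM ?I (\<lambda>_. borel))"
    unfolding qginibre_def by (rule sets_PiM_cong) auto
  have "(\<lambda>\<omega>. \<lambda>ij\<in>?I. G \<omega> $$ ij) \<in> measurable M (PiM ?I (\<lambda>_. borel))"
    by (rule measurable_restrict) (rule rv)
  then show "(\<lambda>\<omega>. \<lambda>ij\<in>?I. G \<omega> $$ ij) \<in> measurable M (qginibre n {..<n})"
    by (simp add: measurable_cong_sets [OF refl sets])
  have "distr M (PiM ?I (\<lambda>_. borel)) (\<lambda>\<omega>. \<lambda>ij\<in>?I. G \<omega> $$ ij) = PiM ?I (\<lambda>ij. distr M borel (\<lambda>\<omega>. G \<omega> $$ ij))"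
    using ind n rv by (subst (asm) indep_vars_iff_distr_eq_PiM') (auto simp: lessThan_empty_iff)
  also have "\<dots> = qginibre n {..<n}"
    unfolding qginibre_def by (rule PiM_cong) (auto simp: law)
  finally show "distr M (qginibre n {..<n}) (\<lambda>\<omega>. \<lambda>ij\<in>?I. G \<omega> $$ ij) = qginibre n {..<n}"
    using sets by (simp cong: distr_cong)
qed

theorem theorem3p7:
  fixes M :: "'a measure" and n :: nat and G :: "'a \<Rightarrow> quat mat"
  assumes "prob_space M"
    and "1 \<le> n"
    and "quat_gaussian_matrix M n G"
  shows "laplace_le M (\<lambda>\<omega>. (Sdet (G \<omega>))\<^sup>2) (\<lambda>\<omega>. (norm (qpermanent (G \<omega>)))\<^sup>2) \<and>
    laplace_le M (\<lambda>\<omega>. (Sdet (G \<omega>))\<^sup>2 / fact n) (\<lambda>\<omega>. (norm (qpermanent (G \<omega>)))\<^sup>2 / fact n)"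
proof -
  define A where "A \<omega> = (\<lambda>ij\<in>{..<n} \<times> {..<n}. G \<omega> $$ ij)" for \<omega>
  have A: "A \<in> measurable M (qginibre n {..<n})" and law: "distr M (qginibre n {..<n}) A = qginibre n {..<n}"
    using distr_quat_gaussian_matrix [OF assms] unfolding A_def [abs_def] by auto
  have GA: "G \<omega> = mat n n (A \<omega>)" if "\<omega> \<in> space M" for \<omega>
  proof -
    have "G \<omega> \<in> carrier_mat n n" using assms(3) that by (simp add: quat_gaussian_matrix_def)
    then show ?thesis by (intro eq_matI) (auto simp: A_def)
  qed
  have D: "(Sdet (G \<omega>))\<^sup>2 = Sdet2 (mat n n (A \<omega>))" and P: "qpermanent (G \<omega>) = row_per n {..<n} (A \<omega>)" if "\<omega> \<in> space M" for \<omega>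
    using GA [OF that] Sdet_square [of "mat n n (A \<omega>)" n] by (simp_all add: qpermanent_eq_row_per)
  have ent: "(\<lambda>a. a (i, j)) \<in> borel_measurable (qginibre n {..<n})" if "i < n" "j < n" for i j
    using that by (intro measurable_qginibre_entry [OF _ _ measurable_ident_sets [OF refl]]) auto
  have mD: "(\<lambda>a. Sdet2 (mat n n a)) \<in> borel_measurable (qginibre n {..<n})"
    by (rule measurable_Sdet2) (rule ent)
  have mP: "(\<lambda>a. row_per n {..<n} a) \<in> borel_measurable (qginibre n {..<n})"
    by (rule measurable_row_per) (auto intro: ent)
  have "(\<lambda>\<omega>. Sdet2 (mat n n (A \<omega>))) \<in> borel_measurable M"
    by (rule measurable_compose [OF A mD])
  then have UM: "(\<lambda>\<omega>. (Sdet (G \<omega>))\<^sup>2) \<in> borel_measurable M"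
    by (simp add: D cong: measurable_cong_simp)
  have "(\<lambda>\<omega>. row_per n {..<n} (A \<omega>)) \<in> borel_measurable M"
    by (rule measurable_compose [OF A mP])
  then have VM: "(\<lambda>\<omega>. (norm (qpermanent (G \<omega>)))\<^sup>2) \<in> borel_measurable M"
    by (simp add: P cong: measurable_cong_simp)
  have le: "(LINT \<omega>|M. exp (- s * (norm (qpermanent (G \<omega>)))\<^sup>2)) \<le> (LINT \<omega>|M. exp (- s * (Sdet (G \<omega>))\<^sup>2))"
    if s: "0 \<le> s" for s
  proof -
    have "(LINT \<omega>|M. exp (- s * (norm (qpermanent (G \<omega>)))\<^sup>2)) = (LINT \<omega>|M. exp (- s * (norm (row_per n {..<n} (A \<omega>)))\<^sup>2))"
      by (rule Bochner_Integration.integral_cong) (simp_all add: P)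
    also have "\<dots> = (LINT a|distr M (qginibre n {..<n}) A. exp (- s * (norm (row_per n {..<n} a))\<^sup>2))"
      using mP by (intro integral_distr [symmetric] A) measurable
    also have "\<dots> \<le> Sdet2_laplace n s"
      unfolding law using s by (intro row_per_laplace_le) auto
    also have "\<dots> = (LINT a|distr M (qginibre n {..<n}) A. exp (- s * Sdet2 (mat n n a)))"
      unfolding law using s by (rule Sdet2_laplace_eq [symmetric])
    also have "\<dots> = (LINT \<omega>|M. exp (- s * Sdet2 (mat n n (A \<omega>))))"
      using mD by (intro integral_distr A) measurable
    also have "\<dots> = (LINT \<omega>|M. exp (- s * (Sdet (G \<omega>))\<^sup>2))"
      by (rule Bochner_Integration.integral_cong) (simp_all add: D)
    finally show ?thesis .
  qed
  have le': "(LINT \<omega>|M. exp (- s * ((norm (qpermanent (G \<omega>)))\<^sup>2 / fact n))) \<le> (LINT \<omega>|M. exp (- s * ((Sdet (G \<omega>))\<^sup>2 / fact n)))"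
    if "0 \<le> s" for s
    using le [of "s / fact n"] that by simp
  show ?thesis
    unfolding laplace_le_def
    by (intro conjI allI ballI impI UM VM le le' borel_measurable_divide borel_measurable_const) simp_all
qed

end
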